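(* Let $p\ge1$, $k\in\{1,\dots,p\}$ and $\alpha\ge0$. The following are equivalent: (i) A Wishart semigroup with state space $D_p(k)$ and drift parameter $\alpha$ exists. (ii) If $k\in\{1,\dots,p-1\}$ then $\alpha=k$; if $k=p$ then $\alpha\ge p-1$.
   Context: $D_p(k)$ is the (closed) set of positive semidefinite $p\times p$ matrices of rank $\le k$; $D_p(p)=\bar{\mathcal S}_p^+$. For $u\in\bar{\mathcal S}_p^+$, $f_u(x)=\exp(-\operatorname{tr}(ux))$. A Wishart semigroup on a closed set $D\subseteq\bar{\mathcal S}_p^+$ with drift parameter $\alpha\ge0$ is a positive, strongly continuous contraction semigroup $(P_t)_{t\ge0}$ on $C_0(D)$ such that for all $u\in\mathcal S_p^+$, $t\ge0$, $x\in D$: $P_tf_u(x)=\det(I+2tu)^{-\alpha/2}\exp(-\operatorname{tr}(x(u^{-1}+2tI)^{-1}))$. *)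

theory Defs
  imports "HOL-Analysis.Analysis"
begin

definition psd :: "real^'n^'n \<Rightarrow> bool" where
  "psd A \<longleftrightarrow> transpose A = A \<and> (\<forall>v. 0 \<le> v \<bullet> (A *v v))"

definition pd :: "real^'n^'n \<Rightarrow> bool" where
  "pd A \<longleftrightarrow> transpose A = A \<and> (\<forall>v. v \<noteq> 0 \<longrightarrow> 0 < v \<bullet> (A *v v))"

definition Dpk :: "nat \<Rightarrow> (real^'n^'n) set" where
  "Dpk k = {A. psd A \<and> rank A \<le> k}"

text \<open>C_0(D): continuous real functions on D vanishing at infinity; elements
  are represented extensionally as functions that are 0 outside D.\<close>
definition C0 :: "'a::real_normed_vector set \<Rightarrow> ('a \<Rightarrow> real) set" where
  "C0 D = {f. continuous_on D f \<and> (\<forall>x. x \<notin> D \<longrightarrow> f x = 0) \<and>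
              (\<forall>e>0. \<exists>r. \<forall>x\<in>D. r \<le> norm x \<longrightarrow> \<bar>f x\<bar> < e)}"

definition pos_sc_contraction_semigroup ::
  "'a::real_normed_vector set \<Rightarrow> (real \<Rightarrow> ('a \<Rightarrow> real) \<Rightarrow> ('a \<Rightarrow> real)) \<Rightarrow> bool" where
  "pos_sc_contraction_semigroup D P \<longleftrightarrow>
     (\<forall>t\<ge>0. \<forall>f\<in>C0 D. P t f \<in> C0 D)
   \<and> (\<forall>t\<ge>0. \<forall>f\<in>C0 D. \<forall>g\<in>C0 D. \<forall>a::real.
        P t (\<lambda>x. a * f x + g x) = (\<lambda>x. a * P t f x + P t g x))
   \<and> (\<forall>t\<ge>0. \<forall>f\<in>C0 D. (\<forall>x\<in>D. 0 \<le> f x) \<longrightarrow> (\<forall>x\<in>D. 0 \<le> P t f x))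
   \<and> (\<forall>t\<ge>0. \<forall>f\<in>C0 D. \<forall>c. (\<forall>x\<in>D. \<bar>f x\<bar> \<le> c) \<longrightarrow> (\<forall>x\<in>D. \<bar>P t f x\<bar> \<le> c))
   \<and> (\<forall>f\<in>C0 D. P 0 f = f)
   \<and> (\<forall>s\<ge>0. \<forall>t\<ge>0. \<forall>f\<in>C0 D. P (s + t) f = P s (P t f))
   \<and> (\<forall>f\<in>C0 D. \<forall>e>0. \<exists>\<delta>>0. \<forall>t. 0 \<le> t \<and> t < \<delta> \<longrightarrow> (\<forall>x\<in>D. \<bar>P t f x - f x\<bar> \<le> e))"

definition fexp :: "(real^'n^'n) set \<Rightarrow> real^'n^'n \<Rightarrow> real^'n^'n \<Rightarrow> real" where
  "fexp D u = (\<lambda>x. if x \<in> D then exp (- trace (u ** x)) else 0)"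

definition wishart_semigroup ::
  "(real^'n^'n) set \<Rightarrow> real \<Rightarrow> (real \<Rightarrow> (real^'n^'n \<Rightarrow> real) \<Rightarrow> (real^'n^'n \<Rightarrow> real)) \<Rightarrow> bool" where
  "wishart_semigroup D \<alpha> P \<longleftrightarrow> 0 \<le> \<alpha> \<and> pos_sc_contraction_semigroup D P \<and>
     (\<forall>u t x. pd u \<longrightarrow> 0 \<le> t \<longrightarrow> x \<in> D \<longrightarrow>
        P t (fexp D u) x =
          det (mat 1 + (2 * t) *\<^sub>R u) powr (- \<alpha> / 2) *
          exp (- trace (x ** matrix_inv (matrix_inv u + (2 * t) *\<^sub>R mat 1))))"

end

theory Submission
  imports Defs "HOL-Probability.Probability"
begin

text \<open>
  Write \<open>f\<^sub>u(x) = exp (- u \<bullet> x)\<close> with the Frobenius inner product, which is \<open>tr (u x)\<close> on symmetric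
  matrices. The linear span of the \<open>f\<^sub>u\<close> is dense in \<open>C\<^sub>0\<close> by Stone-Weierstrass, so everything about
  the semigroup can be checked on these functions.

  Existence: in terms of \<open>w = u\<^sup>-\<^sup>1\<close> the semigroup replaces \<open>w\<close> by \<open>w + 2 t I\<close>, hence it is the
  composition over the coordinates \<open>i\<close> of operators replacing \<open>w\<close> by \<open>w + 2 t e\<^sub>i e\<^sub>i\<^sup>T\<close>.
  Such an operator is realised by writing \<open>x = W\<^sup>T W\<close> and moving only column \<open>i\<close> of \<open>W\<close>.
  If \<open>W\<close> has \<open>k\<close> nonzero rows and \<open>\<alpha> = k\<close>, Gaussian noise does this. In full rank, \<open>W\<close> is
  chosen such that row \<open>i\<close> is supported in column \<open>i\<close>; its entry moves as the square root of a
  squared Bessel process of dimension \<open>\<alpha> - (p - 1) \<ge> 0\<close> and the other \<open>p - 1\<close> entries of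
  the column receive Gaussian noise.

  Necessity: at the projection \<open>\<pi>\<close> to the coordinates in \<open>K\<close> the generator of a nonnegative cubic
  polynomial, which vanishes at \<open>\<pi>\<close> and agrees to second order with the principal minor
  on \<open>K \<union> {m}\<close>, has the value \<open>\<alpha> - card K\<close>. The positive minimum principle
  gives \<open>\<alpha> \<ge> card K\<close>. On matrices of rank at most \<open>card K\<close> the same polynomial is bounded by a
  multiple of \<open>norm (x - \<pi>) ^ 4\<close>, whose generator vanishes at \<open>\<pi>\<close>, so there \<open>\<alpha> \<le> card K\<close>.
\<close>

section \<open>Real exponentials and uniform limits\<close>

lemma power_mult_exp_bounded:
  assumes "0 < (c :: real)"
  obtains B where "\<And>r. 0 \<le> r \<Longrightarrow> (1 + r) ^ N * exp (- (c * r)) \<le> B"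
proof -
  have "(1 + r) ^ N * exp (- (c * r)) \<le> fact N * exp c / c ^ N" if r_nonneg: "0 \<le> r" for r
  proof -
    let ?y = "c * (1 + r)"
    have y_nonneg: "0 \<le> ?y" using assms r_nonneg by simp
    have "?y ^ N /\<^sub>R fact N \<le> (\<Sum>n\<le>N. ?y ^ n /\<^sub>R fact n)"
      using y_nonneg by (intro member_le_sum) auto
    also have "\<dots> \<le> exp ?y"
      unfolding exp_def using y_nonneg by (intro sum_le_suminf summable_exp_generic) auto
    finally have "c ^ N * (1 + r) ^ N \<le> fact N * exp (c * (1 + r))"
      by (simp add: power_mult_distrib divide_inverse_commute[symmetric] pos_divide_le_eq
          mult.commute)
    then have "(1 + r) ^ N \<le> fact N * exp (c * (1 + r)) / c ^ N"
      using assms by (simp add: pos_le_divide_eq mult.commute)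
    then have "(1 + r) ^ N * exp (- (c * r)) \<le> fact N * exp (c * (1 + r)) / c ^ N * exp (- (c * r))"
      by (rule mult_right_mono) simp
    also have "\<dots> = fact N * exp c / c ^ N" by (simp add: exp_add exp_minus field_simps)
    finally show ?thesis .
  qed
  then show thesis by (rule that)
qed

lemma abs_exp_minus_one_le: "\<bar>exp z - 1\<bar> \<le> \<bar>z\<bar> * exp \<bar>z :: real\<bar>"
proof -
  have "exp z * (1 - z) \<le> exp z * exp (- z)"
    using exp_ge_add_one_self[of "- z"] by (intro mult_left_mono) auto
  then have upper: "exp z - 1 \<le> z * exp z" by (simp add: mult_exp_exp algebra_simps)
  have lower: "z \<le> exp z - 1" using exp_ge_add_one_self[of z] by linarith
  show ?thesis
  proof (cases "0 \<le> z")
    case True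
    then show ?thesis using upper lower by simp
  next
    case False
    then have "\<bar>z\<bar> * 1 \<le> \<bar>z\<bar> * exp \<bar>z\<bar>" by (intro mult_left_mono) auto
    moreover have "exp z \<le> 1" using False by simp
    ultimately show ?thesis using lower False by linarith
  qed
qed

lemma abs_exp_minus_linear_le: "\<bar>exp z - 1 - z\<bar> \<le> z\<^sup>2 * exp \<bar>z :: real\<bar>"
proof -
  have "exp z * (1 - z) \<le> exp z * exp (- z)"
    using exp_ge_add_one_self[of "- z"] by (intro mult_left_mono) auto
  then have "exp z - 1 - z \<le> z * (exp z - 1)" by (simp add: mult_exp_exp algebra_simps)
  also have "\<dots> \<le> \<bar>z\<bar> * (\<bar>z\<bar> * exp \<bar>z\<bar>)"
    using mult_left_mono[OF abs_exp_minus_one_le[of z], of "\<bar>z\<bar>"] by (simp add: abs_mult[symmetric])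
  also have "\<dots> = z\<^sup>2 * exp \<bar>z\<bar>" by (simp add: power2_eq_square)
  finally show ?thesis using exp_ge_add_one_self[of z] by linarith
qed

lemma abs_exp_difference_quotient_le:
  assumes "0 < (s :: real)"
  shows "\<bar>(exp (- (a + s * b)) - exp (- a)) / s + d * exp (- a)\<bar>
    \<le> (s * b\<^sup>2 * exp \<bar>s * b\<bar> + \<bar>d - b\<bar>) * exp (- a)"
proof -
  have "(exp (- (a + s * b)) - exp (- a)) / s + d * exp (- a)
      = ((exp (- (s * b)) - 1 - (- (s * b))) / s + (d - b)) * exp (- a)"
    using assms by (simp add: exp_diff exp_minus field_simps exp_add)
  moreover have "\<bar>(exp (- (s * b)) - 1 - (- (s * b))) / s\<bar> \<le> s * b\<^sup>2 * exp \<bar>s * b\<bar>"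
    using abs_exp_minus_linear_le[of "- (s * b)"] assms
    by (simp add: pos_divide_le_eq power_mult_distrib power2_eq_square ac_simps)
  then have "\<bar>(exp (- (s * b)) - 1 - (- (s * b))) / s + (d - b)\<bar> \<le> s * b\<^sup>2 * exp \<bar>s * b\<bar> + \<bar>d - b\<bar>"
    by linarith
  ultimately show ?thesis by (simp add: abs_mult mult_right_mono del: minus_mult_minus)
qed

lemma uniform_limit_realI:
  fixes f :: "'a \<Rightarrow> 'b \<Rightarrow> real"
  assumes "\<forall>\<^sub>F s in F. \<forall>x\<in>S. \<bar>f s x - g x\<bar> \<le> b s" "(b \<longlongrightarrow> 0) F"
  shows "uniform_limit S f g F"
proof (rule uniform_limitI)
  fix e :: real assume "0 < e"
  with assms(2) have "\<forall>\<^sub>F s in F. b s < e" by (rule order_tendstoD)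
  with assms(1) show "\<forall>\<^sub>F s in F. \<forall>x\<in>S. dist (f s x) (g x) < e"
    by eventually_elim (auto simp: dist_real_def intro: le_less_trans)
qed

lemma uniform_limit_tendsto_mult:
  fixes f :: "'a \<Rightarrow> real"
  assumes "(f \<longlongrightarrow> a) F" "uniform_limit S g h F" "bounded (h ` S)"
  shows "uniform_limit S (\<lambda>s x. f s * g s x) (\<lambda>x. a * h x) F"
proof (rule uniform_lim_mult[OF _ assms(2) _ assms(3)])
  show "uniform_limit S (\<lambda>s x. f s) (\<lambda>x. a) F"
    using assms(1) by (auto simp: uniform_limit_iff tendsto_iff elim: eventually_mono)
  show "bounded ((\<lambda>x. a) ` S)" by (auto simp: bounded_iff)
qed

lemma uniform_limit_at_right_0_iff:
  fixes f :: "real \<Rightarrow> 'a \<Rightarrow> real"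
  assumes "\<And>x. x \<in> D \<Longrightarrow> f 0 x = g x"
  shows "uniform_limit D f g (at_right 0) \<longleftrightarrow>
    (\<forall>e>0. \<exists>\<delta>>0. \<forall>t. 0 \<le> t \<and> t < \<delta> \<longrightarrow> (\<forall>x\<in>D. \<bar>f t x - g x\<bar> \<le> e))"
    (is "?lim \<longleftrightarrow> ?bound")
proof
  assume ?lim
  show ?bound
  proof (intro allI impI)
    fix e :: real assume "0 < e"
    from uniform_limitD[OF \<open>?lim\<close> this]
    obtain \<delta> where \<delta>_bound: "0 < \<delta>" "\<And>t x. 0 < t \<Longrightarrow> t < \<delta> \<Longrightarrow> x \<in> D \<Longrightarrow> \<bar>f t x - g x\<bar> < e"
      unfolding eventually_at_right_field dist_real_def by blast
    have "\<bar>f t x - g x\<bar> \<le> e" if "0 \<le> t" "t < \<delta>" "x \<in> D" for t x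
      using that \<delta>_bound(2)[of t x] assms[of x] \<open>0 < e\<close> by (cases "t = 0") auto
    then show "\<exists>\<delta>>0. \<forall>t. 0 \<le> t \<and> t < \<delta> \<longrightarrow> (\<forall>x\<in>D. \<bar>f t x - g x\<bar> \<le> e)"
      using \<delta>_bound(1) by blast
  qed
next
  assume ?bound
  show ?lim
  proof (rule uniform_limitI)
    fix e :: real assume "0 < e"
    then have "0 < e / 2" by simp
    with \<open>?bound\<close> obtain \<delta> where \<delta>_bound: "0 < \<delta>"
      "\<forall>t. 0 \<le> t \<and> t < \<delta> \<longrightarrow> (\<forall>x\<in>D. \<bar>f t x - g x\<bar> \<le> e / 2)" by meson
    have "dist (f t x) (g x) < e" if "0 < t" "t < \<delta>" "x \<in> D" for t x
    proof -
      have "\<bar>f t x - g x\<bar> \<le> e / 2" using \<delta>_bound(2) that by simp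
      then show ?thesis using \<open>0 < e\<close> by (simp add: dist_real_def)
    qed
    then show "\<forall>\<^sub>F t in at_right 0. \<forall>x\<in>D. dist (f t x) (g x) < e"
      using \<delta>_bound(1) by (auto simp: eventually_at_right_field)
  qed
qed

section \<open>Positive semidefinite matrices\<close>

subsection \<open>Rank-one matrices and Gram matrices\<close>

definition outer :: "real^'n \<Rightarrow> real^'n^'n" where
  "outer v = (\<chi> i j. v $ i * v $ j)"

definition gram :: "real^'n^'m \<Rightarrow> real^'n^'n" where
  "gram W = (\<Sum>l\<in>UNIV. outer (W $ l))"

lemma outer_nth [simp]: "outer v $ i $ j = v $ i * v $ j"
  by (simp add: outer_def)

lemma outer_zero [simp]: "outer 0 = 0"
  by (simp add: vec_eq_iff)

lemma outer_mult_vec: "outer a *v v = (a \<bullet> v) *\<^sub>R a"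
  by (simp add: vec_eq_iff matrix_vector_mult_def inner_vec_def sum_distrib_left
      sum_distrib_right algebra_simps)

lemma transpose_outer [simp]: "transpose (outer v) = outer v"
  by (simp add: transpose_def vec_eq_iff mult.commute)

lemma inner_outer: "u \<bullet> outer w = w \<bullet> (u *v w)"
  by (simp add: inner_vec_def matrix_vector_mult_def sum_distrib_left algebra_simps)

lemma inner_gram: "u \<bullet> gram W = (\<Sum>l\<in>UNIV. W $ l \<bullet> (u *v W $ l))"
  by (simp add: gram_def inner_sum_right inner_outer)

lemma norm_outer: "norm (outer w) = (norm w)\<^sup>2"
proof -
  have "(norm (outer w))\<^sup>2 = (w \<bullet> w)\<^sup>2"
    by (simp only: power2_norm_eq_inner inner_outer outer_mult_vec)
      (simp add: power2_eq_square)
  then show ?thesis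
    by (metis dot_square_norm norm_ge_zero power2_eq_iff_nonneg zero_le_power2)
qed

lemma inner_mat_1_gram: "mat 1 \<bullet> gram W = (norm W)\<^sup>2"
  by (simp add: inner_gram power2_norm_eq_inner inner_vec_def[of W W])

lemma inner_mat_1_outer: "mat 1 \<bullet> outer v = (norm v)\<^sup>2"
  by (simp add: inner_outer power2_norm_eq_inner)

lemma continuous_on_gram: "continuous_on S gram"
  unfolding gram_def outer_def by (intro continuous_intros)

lemma inner_axis_mult_axis: "axis i 1 \<bullet> (u *v axis j 1) = (u :: real^'n^'m) $ i $ j"
  by (simp add: matrix_vector_mult_basis inner_axis_axis column_def inner_axis')

lemma matrix_mult_axis_nth: "(u *v axis j 1) $ i = (u :: real^'n^'m) $ i $ j"
  by (simp add: matrix_vector_mult_basis column_def)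

lemma matrix_axis_expansion:
  "y = (\<Sum>i\<in>UNIV. \<Sum>j\<in>UNIV. y $ i $ j *\<^sub>R axis i (axis j 1))" for y :: "real^'n^'m"
proof -
  have "(\<Sum>j\<in>UNIV. y $ i $ j * (axis i (axis j (1::real)) :: real^'n^'m) $ a $ b)
      = (if i = a then y $ i $ b else 0)" for i a b
  proof (cases "i = a")
    case True
    then have "(\<Sum>j\<in>UNIV. y $ i $ j * (axis i (axis j (1::real)) :: real^'n^'m) $ a $ b)
        = (\<Sum>j\<in>UNIV. if b = j then y $ i $ j else 0)"
      by (intro sum.cong) (auto simp: axis_def)
    then show ?thesis using True by simp
  qed (simp add: axis_def)
  then show ?thesis by (simp add: vec_eq_iff)
qed

lemma sum_matrix_mult_vec: "(\<Sum>i\<in>I. (A i :: real^'n^'m)) *v v = (\<Sum>i\<in>I. A i *v v)"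
  by (induction I rule: infinite_finite_induct) (auto simp: matrix_vector_mult_add_rdistrib)

lemma rank_sum_outer_le:
  assumes "finite K"
  shows "rank (\<Sum>l\<in>K. outer (w l :: real^'n)) \<le> card K"
proof -
  have "range ((*v) (\<Sum>l\<in>K. outer (w l))) \<subseteq> span (w ` K)"
    unfolding sum_matrix_mult_vec outer_mult_vec
    by (intro image_subsetI span_sum span_scale span_base imageI)
  then have "rank (\<Sum>l\<in>K. outer (w l)) \<le> dim (w ` K)"
    by (metis rank_dim_range dim_span dim_subset)
  also have "\<dots> \<le> card K"
    using assms by (metis card_image_le dim_le_card' finite_imageI order_trans)
  finally show ?thesis .
qed

subsection \<open>Symmetric, semidefinite and definite matrices\<close>

lemma sym_nth: "transpose x = x \<Longrightarrow> x $ i $ j = x $ j $ i"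
  by (metis transpose_def vec_lambda_beta)

lemma sym_inner: "transpose (x :: real^'n^'n) = x \<Longrightarrow> v \<bullet> (x *v w) = w \<bullet> (x *v v)"
  by (metis dot_lmul_matrix inner_commute transpose_matrix_vector)

lemma trace_eq_inner: "trace (x :: real^'n^'n) = mat 1 \<bullet> x"
  by (simp add: trace_def inner_vec_def mat_def if_distrib if_distribR cong: if_cong)

lemma trace_scaleR: "trace (s *\<^sub>R (v :: real^'n^'n)) = s * trace v"
  by (simp add: trace_def sum_distrib_left)

lemma trace_mult_eq_inner: "transpose x = x \<Longrightarrow> trace (u ** x) = u \<bullet> (x :: real^'n^'n)"
  by (simp add: trace_def matrix_matrix_mult_def inner_vec_def sym_nth)

lemma transpose_add: "transpose (a + b) = transpose a + transpose (b :: real^'n^'m)"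
  and transpose_diff: "transpose (a - b) = transpose a - transpose (b :: real^'n^'m)"
  by (simp_all add: transpose_def vec_eq_iff)

lemma psdD:
  assumes "psd x"
  shows "transpose x = x" and "0 \<le> v \<bullet> (x *v v)"
  using assms by (auto simp: psd_def)

lemma pdD:
  assumes "pd x"
  shows "transpose x = x" and "v \<noteq> 0 \<Longrightarrow> 0 < v \<bullet> (x *v v)"
  using assms by (auto simp: pd_def)

lemma pd_imp_psd: "pd x \<Longrightarrow> psd x"
  by (metis inner_zero_left less_eq_real_def pd_def psd_def)

lemma psd_outer [simp]: "psd (outer v)"
  by (simp add: psd_def outer_mult_vec inner_commute)

lemma psd_zero [simp]: "psd 0"
  by (simp add: psd_def transpose_def vec_eq_iff)

lemma psd_add: "psd x \<Longrightarrow> psd y \<Longrightarrow> psd (x + y)"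
  by (simp add: psd_def transpose_add matrix_vector_mult_add_rdistrib inner_add_right)

lemma psd_scaleR: "psd x \<Longrightarrow> 0 \<le> c \<Longrightarrow> psd (c *\<^sub>R x)"
  by (simp add: psd_def transpose_scalar scaleR_matrix_vector_assoc[symmetric])

lemma psd_sum: "(\<And>i. i \<in> I \<Longrightarrow> psd (x i)) \<Longrightarrow> psd (sum x I)"
  by (induction I rule: infinite_finite_induct) (auto intro: psd_add)

lemma psd_gram: "psd (gram W)"
  unfolding gram_def by (intro psd_sum psd_outer)

lemma pd_add_psd: "pd x \<Longrightarrow> psd y \<Longrightarrow> pd (x + y)"
  by (auto simp: psd_def pd_def transpose_add matrix_vector_mult_add_rdistrib inner_add_right
      intro: add_pos_nonneg)

lemma pd_scaleR: "pd x \<Longrightarrow> 0 < c \<Longrightarrow> pd (c *\<^sub>R x)"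
  by (simp add: pd_def transpose_scalar scaleR_matrix_vector_assoc[symmetric])

lemma pd_mat_1 [simp]: "pd (mat 1)"
  by (simp add: pd_def)

lemma pd_add_scaled_mat_1:
  assumes "pd w" "0 \<le> t"
  shows "pd (w + t *\<^sub>R mat 1)"
  using assms by (intro pd_add_psd psd_scaleR pd_imp_psd[OF pd_mat_1])

lemma psd_diag_nonneg: "psd x \<Longrightarrow> 0 \<le> x $ i $ i"
  by (metis inner_axis_mult_axis psdD(2))

lemma psd_mult_vec_eq_0:
  assumes "psd x" "v \<bullet> (x *v v) = 0"
  shows "x *v v = 0"
proof (rule ccontr)
  assume "x *v v \<noteq> 0"
  define w where "w = x *v v"
  define b where "b = w \<bullet> (x *v w)"
  define s where "s = - (w \<bullet> w) / (b + 1)"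
  have w_pos: "0 < w \<bullet> w" using \<open>x *v v \<noteq> 0\<close> by (simp add: w_def)
  have b_nonneg: "0 \<le> b" unfolding b_def by (rule psdD(2)[OF assms(1)])
  have s_neg: "s < 0" using w_pos b_nonneg by (simp add: s_def add_nonneg_pos)
  have "s * (b + 1) = - (w \<bullet> w)" using b_nonneg by (simp add: s_def)
  then have "s * b = - (w \<bullet> w) - s" by (simp add: distrib_left)
  then have "0 < 2 * (w \<bullet> w) + s * b" using w_pos s_neg by linarith
  with s_neg have "s * (2 * (w \<bullet> w) + s * b) < 0" by (rule mult_neg_pos)
  also have "s * (2 * (w \<bullet> w) + s * b) = (v + s *\<^sub>R w) \<bullet> (x *v (v + s *\<^sub>R w))"
    using sym_inner[OF psdD(1)[OF assms(1)], of v w] assms(2)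
    by (simp add: inner_add_left inner_add_right matrix_vector_right_distrib
        matrix_vector_mult_scaleR w_def[symmetric] b_def[symmetric] algebra_simps)
  finally show False using psdD(2)[OF assms(1), of "v + s *\<^sub>R w"] by simp
qed

subsection \<open>Decomposition into rank-one matrices\<close>

(* If d \<bullet> (x *v d) = 0, then the pivot is 0 because 1 / 0 = 0, which is what elimination needs. *)
definition pivot :: "real^'n^'n \<Rightarrow> real^'n \<Rightarrow> real^'n" where
  "pivot x d = (1 / sqrt (d \<bullet> (x *v d))) *\<^sub>R (x *v d)"

lemma psd_eliminate:
  assumes "psd x"
  shows "psd (x - outer (pivot x d))" and "(x - outer (pivot x d)) *v d = 0"
proof -
  define q where "q = d \<bullet> (x *v d)"
  have q_nonneg: "0 \<le> q" unfolding q_def by (rule psdD(2)[OF assms])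
  have form: "(x - outer (pivot x d)) *v v = x *v v - (((x *v d) \<bullet> v) / q) *\<^sub>R (x *v d)" for v
    using q_nonneg
    by (simp add: matrix_vector_mult_diff_rdistrib outer_mult_vec pivot_def q_def[symmetric])
  have null: "x *v d = 0" if "q = 0"
    using that psd_mult_vec_eq_0[OF assms] by (simp add: q_def)
  show "(x - outer (pivot x d)) *v d = 0"
    unfolding form using null by (cases "q = 0") (auto simp: q_def inner_commute)
  show "psd (x - outer (pivot x d))"
    unfolding psd_def
  proof (intro conjI allI)
    show "transpose (x - outer (pivot x d)) = x - outer (pivot x d)"
      by (simp add: transpose_diff psdD(1)[OF assms])
    fix v
    define c where "c = (x *v d) \<bullet> v / q"
    have eval_eq: "(x *v d) \<bullet> v = c * q"
      using null by (cases "q = 0") (auto simp: c_def)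
    have "(v - c *\<^sub>R d) \<bullet> (x *v (v - c *\<^sub>R d)) = v \<bullet> (x *v v) - c * (c * q)"
      using eval_eq sym_inner[OF psdD(1)[OF assms], of d v]
      by (simp add: inner_diff_left inner_diff_right matrix_vector_mult_diff_distrib
          matrix_vector_mult_scaleR q_def[symmetric] inner_commute[of v])
    also have "\<dots> = v \<bullet> ((x - outer (pivot x d)) *v v)"
      using eval_eq by (simp add: form inner_diff_right c_def[symmetric] inner_commute[of v])
    finally show "0 \<le> v \<bullet> ((x - outer (pivot x d)) *v v)"
      using psdD(2)[OF assms] by metis
  qed
qed

lemma rank_eliminate_less:
  fixes x :: "real^'n^'n"
  assumes "psd x" "x *v d \<noteq> 0"
  shows "rank (x - outer (pivot x d)) < rank x"
proof -
  let ?y = "x - outer (pivot x d)"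
  have "?y *v v = x *v (v - (pivot x d \<bullet> v / sqrt (d \<bullet> (x *v d))) *\<^sub>R d)" for v
    by (simp add: matrix_vector_mult_diff_distrib matrix_vector_mult_diff_rdistrib
        outer_mult_vec matrix_vector_mult_scaleR) (simp add: pivot_def)
  then have "range ((*v) ?y) \<subseteq> range ((*v) x)" by auto
  moreover have "x *v d \<notin> range ((*v) ?y)"
  proof
    assume "x *v d \<in> range ((*v) ?y)"
    then obtain v where image_eq: "x *v d = ?y *v v" by auto
    have "d \<bullet> (x *v d) = v \<bullet> (?y *v d)"
      unfolding image_eq using psd_eliminate(1)[OF assms(1)] by (intro sym_inner psdD(1))
    then show False
      using psd_mult_vec_eq_0[OF assms(1)] assms(2) by (simp add: psd_eliminate(2)[OF assms(1)])
  qed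
  ultimately have "range ((*v) ?y) \<subset> range ((*v) x)" by blast
  moreover have "span (range ((*v) (y :: real^'n^'n))) = range ((*v) y)" for y
    by (simp add: span_eq_iff linear_subspace_image)
  ultimately have "dim (range ((*v) ?y)) < dim (range ((*v) x))"
    by (metis dim_psubset)
  then show ?thesis by (simp add: rank_dim_range)
qed

lemma psd_rank_decomposition:
  fixes x :: "real^'n^'n"
  assumes "finite K" "psd x" "rank x \<le> card K"
  shows "\<exists>w. x = (\<Sum>l\<in>K. outer (w l))"
  using assms
proof (induction K arbitrary: x)
  case empty
  then show ?case by (simp add: rank_eq_0)
next
  case (insert j K)
  obtain z where z_step: "psd (x - outer z)" "rank (x - outer z) \<le> card K"
  proof (cases "x = 0")
    case True
    then show ?thesis using that[of 0] by simp
  next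
    case False
    then obtain d where "x *v d \<noteq> 0" by (metis matrix_eq matrix_vector_mult_0)
    then show ?thesis
      using that[of "pivot x d"] psd_eliminate(1) rank_eliminate_less insert by fastforce
  qed
  from insert.IH[OF this] obtain w where w_decomp: "x - outer z = (\<Sum>l\<in>K. outer (w l))" by blast
  have "(\<Sum>l\<in>insert j K. outer ((w(j := z)) l)) = outer z + (\<Sum>l\<in>K. outer (w l))"
    using insert.hyps by simp (rule sum.cong, auto)
  also have "\<dots> = x" by (simp flip: w_decomp)
  finally show ?case by metis
qed

lemma psd_cholesky:
  fixes x :: "real^'n^'n"
  assumes "finite J" "psd x"
  shows "\<exists>w. psd (x - (\<Sum>j\<in>J. outer (w j))) \<and>
    (\<forall>j\<in>J. (x - (\<Sum>j\<in>J. outer (w j))) *v axis j 1 = 0)"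
  using assms(1)
proof (induction J)
  case empty
  then show ?case using assms(2) by simp
next
  case (insert j J)
  then obtain w where w_psd: "psd (x - (\<Sum>j\<in>J. outer (w j)))"
    and null: "\<And>a. a \<in> J \<Longrightarrow> (x - (\<Sum>j\<in>J. outer (w j))) *v axis a 1 = 0" by blast
  define y where "y = x - (\<Sum>j\<in>J. outer (w j))"
  define z where "z = pivot y (axis j 1)"
  have psd_y: "psd y" using w_psd by (simp add: y_def)
  have "(y - outer z) *v axis a 1 = 0" if "a \<in> insert j J" for a
  proof (cases "a = j")
    case True
    then show ?thesis using psd_eliminate(2)[OF psd_y] by (simp add: z_def)
  next
    case False
    then have y_axis: "y *v axis a 1 = 0" using that null by (simp add: y_def)
    then have "z \<bullet> axis a 1 = 0"
      using sym_inner[OF psdD(1)[OF psd_y], of "axis a 1" "axis j 1"]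
      by (simp add: z_def pivot_def inner_commute)
    then show ?thesis using y_axis by (simp add: matrix_vector_mult_diff_rdistrib outer_mult_vec)
  qed
  moreover have "psd (y - outer z)" unfolding z_def by (rule psd_eliminate(1)[OF psd_y])
  moreover have "y - outer z = x - (\<Sum>i\<in>insert j J. outer ((w(j := z)) i))"
  proof -
    have "(\<Sum>i\<in>J. outer ((w(j := z)) i)) = (\<Sum>i\<in>J. outer (w i))"
      using insert.hyps by (intro sum.cong) auto
    then show ?thesis using insert.hyps by (simp add: y_def)
  qed
  ultimately show ?case by (intro exI[of _ "w(j := z)"]) auto
qed

lemma psd_eq_outer_axis:
  assumes "psd r" "\<And>j. j \<noteq> i \<Longrightarrow> r *v axis j 1 = 0"
  shows "r = outer (sqrt (r $ i $ i) *\<^sub>R axis i 1)"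
proof -
  have zero: "r $ a $ b = 0" if "a \<noteq> i \<or> b \<noteq> i" for a b
    using that assms(2) sym_nth[OF psdD(1)[OF assms(1)], of a b]
    by (metis matrix_mult_axis_nth zero_index)
  have "r $ a $ b = (sqrt (r $ i $ i) *\<^sub>R axis i 1) $ a * (sqrt (r $ i $ i) *\<^sub>R axis i 1) $ b"
    for a b
    using zero[of a b] psd_diag_nonneg[OF assms(1), of i]
    by (cases "a = i"; cases "b = i") (auto simp: axis_def)
  then show ?thesis unfolding vec_eq_iff outer_nth by blast
qed

lemma psd_gram_axis_row:
  fixes x :: "real^'n^'n"
  assumes "psd x"
  obtains W :: "real^'n^'n" where "x = gram W" "\<And>j. j \<noteq> i \<Longrightarrow> W $ i $ j = 0"
proof -
  obtain v where psd_rest: "psd (x - (\<Sum>j\<in>UNIV - {i}. outer (v j)))"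
    and null: "\<And>j. j \<noteq> i \<Longrightarrow> (x - (\<Sum>j\<in>UNIV - {i}. outer (v j))) *v axis j 1 = 0"
    using psd_cholesky[OF _ assms, of "UNIV - {i}"] by auto
  define r where "r = x - (\<Sum>j\<in>UNIV - {i}. outer (v j))"
  define W where "W = (\<chi> l. if l = i then sqrt (r $ i $ i) *\<^sub>R axis i 1 else v l)"
  have "gram W = outer (W $ i) + (\<Sum>l\<in>UNIV - {i}. outer (W $ l))"
    unfolding gram_def by (simp add: sum.remove[of UNIV i])
  also have "outer (W $ i) = r"
    using psd_eq_outer_axis[OF psd_rest null, folded r_def] by (simp add: W_def)
  also have "(\<Sum>l\<in>UNIV - {i}. outer (W $ l)) = (\<Sum>l\<in>UNIV - {i}. outer (v l))"
    by (rule sum.cong) (auto simp: W_def)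
  finally have "x = gram W" by (simp add: r_def)
  moreover have "W $ i $ j = 0" if "j \<noteq> i" for j
    using that by (simp add: W_def axis_def)
  ultimately show thesis by (rule that)
qed

lemma Dpk_subset_psd: "Dpk k \<subseteq> Collect psd"
  by (auto simp: Dpk_def)

lemma Dpk_card: "Dpk CARD('n) = Collect (psd :: real^'n^'n \<Rightarrow> bool)"
  using rank_bound by (fastforce simp: Dpk_def)

lemma Dpk_eq_gram_image:
  fixes K :: "'m::finite set"
  shows "(Dpk (card K) :: (real^'n^'n) set) = gram ` {W :: real^'n^'m. \<forall>l. l \<notin> K \<longrightarrow> W $ l = 0}"
    (is "_ = gram ` ?supported")
proof (intro set_eqI iffI)
  have gram_eq: "gram W = (\<Sum>l\<in>K. outer (W $ l))" if "W \<in> ?supported" for W :: "real^'n^'m"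
    unfolding gram_def using that by (intro sum.mono_neutral_right) auto
  fix x :: "real^'n^'n"
  {
    assume "x \<in> Dpk (card K)"
    then obtain w where w_decomp: "x = (\<Sum>l\<in>K. outer (w l))"
      using psd_rank_decomposition[of K x] by (auto simp: Dpk_def)
    let ?W = "\<chi> l. if l \<in> K then w l else 0"
    have "x = gram ?W" by (subst gram_eq) (auto simp: w_decomp)
    then show "x \<in> gram ` ?supported" by (intro image_eqI[of _ _ ?W]) auto
  next
    assume "x \<in> gram ` ?supported"
    then obtain W where W_factor: "W \<in> ?supported" "x = gram W" by blast
    then have "rank x \<le> card K" by (simp add: gram_eq rank_sum_outer_le)
    then show "x \<in> Dpk (card K)" by (simp add: Dpk_def W_factor(2) psd_gram)
  }
qed

lemma psd_gram_decomposition: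
  assumes "psd (x :: real^'n^'n)"
  obtains W :: "real^'n^'n" where "x = gram W"
  using psd_gram_axis_row[OF assms] by metis

lemma closed_Dpk:
  assumes "k \<le> CARD('n::finite)"
  shows "closed (Dpk k :: (real^'n^'n) set)"
  unfolding closed_sequential_limits
proof (intro allI impI, elim conjE)
  fix x :: "nat \<Rightarrow> real^'n^'n" and l
  assume x_in_Dpk: "\<forall>n. x n \<in> Dpk k" and x_tendsto: "x \<longlonglongrightarrow> l"
  obtain K :: "'n set" where card_K: "card K = k"
    using obtain_subset_with_card_n[OF assms] by metis
  define S where "S = {W :: real^'n^'n. \<forall>l. l \<notin> K \<longrightarrow> W $ l = 0}"
  have Dpk_eq: "Dpk k = gram ` S" using Dpk_eq_gram_image[of K] by (simp add: S_def card_K)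
  then have "\<forall>n. \<exists>W. W \<in> S \<and> x n = gram W" using x_in_Dpk by blast
  then obtain W where W_factor: "\<And>n. W n \<in> S" "\<And>n. x n = gram (W n)"
    by (elim choice[THEN exE]) blast
  have "S = (\<Inter>l\<in>-K. {W. W $ l = 0})" by (auto simp: S_def)
  moreover have "closed (\<Inter>l\<in>-K. {W :: real^'n^'n. W $ l = 0})"
    by (intro closed_INT ballI closed_Collect_eq continuous_intros)
  ultimately have closed: "closed S" by (simp only:)
  obtain r where x_bounded: "\<And>n. norm (x n) \<le> r"
    using convergent_imp_bounded[OF x_tendsto] by (auto simp: bounded_iff)
  have "norm (W n) \<le> sqrt (norm (mat 1 :: real^'n^'n) * r)" for n
  proof (rule real_le_rsqrt)
    have "(norm (W n))\<^sup>2 = mat 1 \<bullet> x n" by (simp only: W_factor(2) inner_mat_1_gram)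
    also have "\<dots> \<le> norm (mat 1 :: real^'n^'n) * r"
      using norm_cauchy_schwarz x_bounded by (meson mult_left_mono norm_ge_zero order_trans)
    finally show "(norm (W n))\<^sup>2 \<le> norm (mat 1 :: real^'n^'n) * r" .
  qed
  then have "bounded (range W)" by (auto simp: bounded_iff)
  then obtain L \<rho> where W_tendsto: "strict_mono \<rho>" "(W \<circ> \<rho>) \<longlonglongrightarrow> L"
    using bounded_imp_convergent_subsequence by blast
  have "L \<in> S" using closed W_tendsto(2) W_factor(1) closed_sequentially by (metis comp_apply)
  have "(\<lambda>n. gram ((W \<circ> \<rho>) n)) \<longlonglongrightarrow> gram L"
    by (rule continuous_on_tendsto_compose[OF continuous_on_gram[of UNIV] W_tendsto(2)]) auto
  then have "(x \<circ> \<rho>) \<longlonglongrightarrow> gram L" by (simp add: comp_def W_factor(2))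
  then have "l = gram L"
    using LIMSEQ_unique LIMSEQ_subseq_LIMSEQ[OF x_tendsto W_tendsto(1)] by blast
  then show "l \<in> Dpk k" using \<open>L \<in> S\<close> by (simp add: Dpk_eq)
qed

subsection \<open>Norm bounds\<close>

lemma power2_norm_matrix: "(norm (x :: real^'n^'m))\<^sup>2 = (\<Sum>i\<in>UNIV. \<Sum>j\<in>UNIV. (x $ i $ j)\<^sup>2)"
  unfolding power2_norm_eq_inner by (simp add: inner_vec_def power2_eq_square)

lemma abs_matrix_nth_le_norm: "\<bar>x $ i $ j\<bar> \<le> norm (x :: real^'n^'m)"
  using component_le_norm_cart[of "x $ i" j] Finite_Cartesian_Product.norm_nth_le[of x i]
  by linarith

lemma norm_matrix_mult_le: "norm (A ** B) \<le> norm (A :: real^'k^'m) * norm (B :: real^'n^'k)"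
proof -
  have "(norm (A ** B))\<^sup>2 = (\<Sum>i\<in>UNIV. \<Sum>j\<in>UNIV. (\<Sum>k\<in>UNIV. A $ i $ k * B $ k $ j)\<^sup>2)"
    by (simp add: power2_norm_matrix matrix_matrix_mult_def)
  also have "\<dots> \<le> (\<Sum>i\<in>UNIV. \<Sum>j\<in>UNIV. (\<Sum>k\<in>UNIV. (A $ i $ k)\<^sup>2) * (\<Sum>k\<in>UNIV. (B $ k $ j)\<^sup>2))"
    by (intro sum_mono Cauchy_Schwarz_ineq_sum)
  also have "\<dots> = (norm A)\<^sup>2 * (\<Sum>j\<in>UNIV. \<Sum>k\<in>UNIV. (B $ k $ j)\<^sup>2)"
    by (simp add: sum_product power2_norm_matrix)
  also have "(\<Sum>j\<in>UNIV. \<Sum>k\<in>UNIV. (B $ k $ j)\<^sup>2) = (norm B)\<^sup>2"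
    unfolding power2_norm_matrix by (rule sum.swap)
  finally show ?thesis by (simp add: power_mult_distrib[symmetric] power2_le_iff_abs_le)
qed

lemma norm_matrix_vector_mult_le: "norm (x *v v) \<le> norm (x :: real^'n^'m) * norm v"
proof -
  have "(norm (x *v v))\<^sup>2 = (\<Sum>i\<in>UNIV. (x $ i \<bullet> v)\<^sup>2)"
    unfolding power2_norm_eq_inner inner_vec_def[of "x *v v"]
    by (simp add: matrix_vector_mul_component power2_eq_square)
  also have "\<dots> \<le> (\<Sum>i\<in>UNIV. (norm (x $ i))\<^sup>2 * (norm v)\<^sup>2)"
    unfolding power_mult_distrib[symmetric]
    by (intro sum_mono) (metis Cauchy_Schwarz_ineq2 abs_ge_zero power2_abs power_mono)
  also have "\<dots> = (norm x * norm v)\<^sup>2"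
    by (simp add: sum_distrib_right[symmetric] power_mult_distrib norm_vec_def[of x] L2_set_def
        sum_nonneg)
  finally show ?thesis by (simp add: power2_le_iff_abs_le)
qed

lemma abs_quadratic_form_le: "\<bar>v \<bullet> (x *v v)\<bar> \<le> norm (x :: real^'n^'n) * (norm v)\<^sup>2"
  using Cauchy_Schwarz_ineq2[of x "outer v"] by (simp add: inner_outer norm_outer)

lemma inner_psd_ge:
  fixes u x :: "real^'n^'n"
  assumes "0 \<le> c" "\<And>w. c * (norm w)\<^sup>2 \<le> w \<bullet> (u *v w)" "psd x"
  shows "c * norm x \<le> u \<bullet> x"
proof -
  obtain W :: "real^'n^'n" where x_eq_gram: "x = gram W"
    by (rule psd_gram_decomposition[OF assms(3)])
  have "c * norm x \<le> c * (\<Sum>l\<in>UNIV. (norm (W $ l))\<^sup>2)"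
    using assms(1) norm_sum[of "\<lambda>l. outer (W $ l)" UNIV]
    by (simp add: x_eq_gram gram_def norm_outer mult_left_mono)
  also have "\<dots> \<le> (\<Sum>l\<in>UNIV. W $ l \<bullet> (u *v W $ l))"
    unfolding sum_distrib_left by (intro sum_mono assms(2))
  also have "\<dots> = u \<bullet> x" by (simp add: x_eq_gram inner_gram)
  finally show ?thesis .
qed

lemma psd_norm_le_trace: "psd x \<Longrightarrow> norm x \<le> trace (x :: real^'n^'n)"
  using inner_psd_ge[of 1 "mat 1" x] by (simp add: trace_eq_inner power2_norm_eq_inner)

lemma pd_coercive:
  fixes u :: "real^'n^'n"
  assumes "pd u"
  obtains c where "0 < c" "\<And>w. c * (norm w)\<^sup>2 \<le> w \<bullet> (u *v w)"
proof -
  have "\<exists>x\<in>sphere 0 1. \<forall>y\<in>sphere 0 1. x \<bullet> (u *v x) \<le> y \<bullet> (u *v y)"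
    by (intro continuous_attains_inf continuous_intros compact_sphere
        linear_continuous_on linear_conv_bounded_linear[THEN iffD1])
      (auto intro: exI[of _ "axis i 1" for i])
  then obtain x where norm_x: "norm x = 1"
    and x_minimal: "\<And>y. norm y = 1 \<Longrightarrow> x \<bullet> (u *v x) \<le> y \<bullet> (u *v y)"
    by auto
  have "0 < x \<bullet> (u *v x)" using assms norm_x by (intro pdD(2)) auto
  moreover have "x \<bullet> (u *v x) * (norm w)\<^sup>2 \<le> w \<bullet> (u *v w)" for w
  proof (cases "w = 0")
    case False
    then have "x \<bullet> (u *v x) \<le> (w /\<^sub>R norm w) \<bullet> (u *v (w /\<^sub>R norm w))" by (intro x_minimal) simp
    also have "\<dots> = w \<bullet> (u *v w) / (norm w)\<^sup>2"
      by (simp add: matrix_vector_mult_scaleR power2_eq_square field_simps)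
    finally show ?thesis using False by (simp add: field_simps)
  qed simp
  ultimately show thesis using that by blast
qed

lemma pd_inner_psd_ge:
  fixes u :: "real^'n^'n"
  assumes "pd u"
  obtains c where "0 < c" "\<And>x. psd x \<Longrightarrow> c * norm x \<le> u \<bullet> x"
  using pd_coercive[OF assms] inner_psd_ge by (metis less_imp_le)

lemma eventually_pd_perturb:
  fixes u v :: "real^'n^'n"
  assumes "pd u" "transpose v = v"
  shows "\<forall>\<^sub>F s in at 0. pd (u + s *\<^sub>R v)"
proof -
  obtain c where coercive: "0 < c" "\<And>w. c * (norm w)\<^sup>2 \<le> w \<bullet> (u *v w)"
    using pd_coercive[OF assms(1)] by blast
  have "((\<lambda>s. \<bar>s\<bar> * norm v) \<longlongrightarrow> \<bar>0\<bar> * norm v) (at 0)" by (intro tendsto_intros)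
  then have "\<forall>\<^sub>F s in at 0. \<bar>s\<bar> * norm v < c" using coercive(1) by (intro order_tendstoD) auto
  then show ?thesis
  proof eventually_elim
    case (elim s)
    have "0 < w \<bullet> ((u + s *\<^sub>R v) *v w)" if "w \<noteq> 0" for w
    proof -
      have "\<bar>s * (w \<bullet> (v *v w))\<bar> \<le> \<bar>s\<bar> * (norm v * (norm w)\<^sup>2)"
        unfolding abs_mult by (intro mult_left_mono abs_quadratic_form_le) auto
      also have "\<dots> < c * (norm w)\<^sup>2"
        using elim that by (simp add: mult.assoc[symmetric])
      also have "\<dots> \<le> w \<bullet> (u *v w)" by (rule coercive(2))
      finally show ?thesis
        by (simp add: matrix_vector_mult_add_rdistrib inner_add_right
            scaleR_matrix_vector_assoc[symmetric])
    qed
    moreover have "transpose (u + s *\<^sub>R v) = u + s *\<^sub>R v"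
      using assms by (simp add: transpose_add transpose_scalar pdD)
    ultimately show ?case by (simp add: pd_def)
  qed
qed

subsection \<open>Inverses and determinants\<close>

lemma matrix_mult_scaleR_right: "A ** (c *\<^sub>R B) = c *\<^sub>R (A ** (B :: real^'n^'m))"
  and matrix_mult_scaleR_left: "(c *\<^sub>R A) ** B = c *\<^sub>R (A ** (B :: real^'n^'m))"
  by (simp_all add: matrix_matrix_mult_def vec_eq_iff sum_distrib_left ac_simps)

lemma tendsto_matrix_mult_right:
  fixes A :: "real^'k^'m"
  assumes "(f \<longlongrightarrow> B) F"
  shows "((\<lambda>x. A ** f x) \<longlongrightarrow> A ** B) F"
  using assms unfolding matrix_matrix_mult_def by (intro tendsto_intros)

lemma matrix_add_rdistrib_real: "(A + B) ** C = A ** C + B ** (C :: real^'n^'m)"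
  by (simp add: matrix_matrix_mult_def vec_eq_iff distrib_right sum.distrib)

lemma matrix_inv_cancel:
  assumes "invertible u"
  shows "u ** matrix_inv u = mat 1" and "matrix_inv u ** u = mat 1"
  using assms someI_ex[of "\<lambda>A'. u ** A' = mat 1 \<and> A' ** u = mat 1"]
  unfolding invertible_def matrix_inv_def by auto

lemma matrix_inv_unique:
  fixes u v :: "real^'n^'n"
  assumes "u ** v = mat 1"
  shows "matrix_inv u = v"
proof -
  have "invertible u" using assms invertible_right_inverse by blast
  then have "matrix_inv u ** (u ** v) = v"
    by (simp add: matrix_mul_assoc matrix_inv_cancel)
  then show ?thesis using assms by simp
qed

lemma pd_invertible: "pd u \<Longrightarrow> invertible u"
  unfolding invertible_left_inverse matrix_left_invertible_ker
  by (metis inner_zero_right less_irrefl pdD(2))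

lemmas pd_inv_cancel = matrix_inv_cancel[OF pd_invertible]

lemma pd_inv_mult_vec: "pd u \<Longrightarrow> u *v (matrix_inv u *v v) = v"
  by (simp add: matrix_vector_mul_assoc pd_inv_cancel)

lemma matrix_inv_matrix_inv: "pd u \<Longrightarrow> matrix_inv (matrix_inv u) = u"
  by (intro matrix_inv_unique pd_inv_cancel)

lemma pd_matrix_inv:
  assumes "pd u"
  shows "pd (matrix_inv u)"
proof -
  have "u ** transpose (matrix_inv u) = mat 1"
    by (metis assms matrix_transpose_mul pd_inv_cancel(2) pdD(1) transpose_mat)
  then have "transpose (matrix_inv u) = matrix_inv u" by (metis matrix_inv_unique)
  moreover have "0 < v \<bullet> (matrix_inv u *v v)" if "v \<noteq> 0" for v
  proof -
    have "matrix_inv u *v v \<noteq> 0"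
      using that pd_inv_mult_vec[OF assms] by (metis matrix_vector_mult_0_right)
    from pdD(2)[OF assms this] show ?thesis by (simp add: pd_inv_mult_vec[OF assms] inner_commute)
  qed
  ultimately show ?thesis by (simp add: pd_def)
qed

lemma continuous_on_det:
  fixes f :: "'a::topological_space \<Rightarrow> real^'n^'n"
  assumes "continuous_on S f"
  shows "continuous_on S (\<lambda>x. det (f x))"
  unfolding det_def by (intro continuous_intros assms)

lemma pd_det_pos:
  fixes u :: "real^'n^'n"
  assumes "pd u"
  shows "0 < det u"
proof (rule ccontr)
  assume det_nonpos: "\<not> 0 < det u"
  define f where "f s = det ((1 - s) *\<^sub>R mat 1 + s *\<^sub>R u)" for s :: real
  have "\<exists>s\<ge>0. s \<le> 1 \<and> f s = 0"
    unfolding f_def using det_nonpos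
    by (intro IVT2' continuous_on_det continuous_intros) auto
  then obtain s where s_root: "0 \<le> s" "s \<le> 1" "f s = 0" by blast
  have "pd ((1 - s) *\<^sub>R mat 1 + s *\<^sub>R u)"
  proof (cases "s = 1")
    case False
    then show ?thesis using s_root assms by (intro pd_add_psd pd_scaleR psd_scaleR pd_imp_psd) auto
  qed (use assms in simp)
  then show False using pd_invertible s_root(3) by (auto simp: f_def invertible_det_nz)
qed

lemma matrix_inv_add_outer:
  fixes w :: "real^'n^'n"
  assumes "pd w" "0 \<le> c"
  defines "u \<equiv> matrix_inv w"
  shows "matrix_inv (w + c *\<^sub>R outer v) = u - (c / (1 + c * (v \<bullet> (u *v v)))) *\<^sub>R outer (u *v v)"
proof (rule matrix_inv_unique, subst matrix_eq, intro allI)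
  fix y
  define q where "q = v \<bullet> (u *v v)"
  define s where "s = v \<bullet> (u *v y)"
  define k where "k = c / (1 + c * q)"
  have pd_u: "pd u" unfolding u_def by (rule pd_matrix_inv[OF assms(1)])
  have w_mult_u: "w *v (u *v y) = y" for y unfolding u_def by (rule pd_inv_mult_vec[OF assms(1)])
  have "0 \<le> q" unfolding q_def by (rule psdD(2)[OF pd_imp_psd[OF pd_u]])
  then have "1 + c * q \<noteq> 0"
    using assms(2) by (metis add_nonneg_eq_0_iff mult_nonneg_nonneg zero_le_one zero_neq_one)
  then have k_eq: "k * (1 + c * q) = c" by (simp add: k_def)
  have s_sym: "(u *v v) \<bullet> y = s" unfolding s_def by (metis inner_commute sym_inner pdD(1) pd_u)
  have apply_inv: "(u - k *\<^sub>R outer (u *v v)) *v y = u *v y - (k * s) *\<^sub>R (u *v v)"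
    by (simp add: matrix_vector_mult_diff_rdistrib scaleR_matrix_vector_assoc[symmetric]
        outer_mult_vec s_sym)
  have "(w + c *\<^sub>R outer v) *v ((u - k *\<^sub>R outer (u *v v)) *v y)
      = y - (k * s) *\<^sub>R v + (c * (s - k * s * q)) *\<^sub>R v"
    unfolding apply_inv
    by (simp add: matrix_vector_mult_add_rdistrib matrix_vector_mult_diff_distrib w_mult_u
        matrix_vector_mult_scaleR scaleR_matrix_vector_assoc[symmetric] outer_mult_vec
        inner_diff_right q_def[symmetric] s_def[symmetric] algebra_simps)
  also have "\<dots> = y + (s * (c - k * (1 + c * q))) *\<^sub>R v" by (simp add: algebra_simps)
  also have "\<dots> = y" by (simp add: k_eq)
  finally show "((w + c *\<^sub>R outer v) ** (u - (c / (1 + c * (v \<bullet> (u *v v)))) *\<^sub>R outer (u *v v))) *v y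
      = mat 1 *v y"
    by (simp add: matrix_vector_mul_assoc[symmetric] k_def q_def)
qed

lemma det_add_outer_axis:
  fixes w :: "real^'n^'n"
  assumes "pd w"
  shows "det (w + c *\<^sub>R outer (axis i 1)) = (1 + c * matrix_inv w $ i $ i) * det w"
proof -
  define v where "v = axis i 1 + c *\<^sub>R (matrix_inv w *v axis i 1)"
  have "w *v v = w *v axis i 1 + c *\<^sub>R axis i 1"
    by (simp add: v_def matrix_vector_right_distrib matrix_vector_mult_scaleR
        pd_inv_mult_vec[OF assms])
  then have "(w *v v) $ a = w $ a $ i + c * axis i 1 $ a" for a
    by (simp add: matrix_mult_axis_nth)
  then have "w + c *\<^sub>R outer (axis i 1) = (\<chi> a j. if j = i then (w *v v) $ a else w $ a $ j)"
    by (simp add: vec_eq_iff axis_def)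
  then have "det (w + c *\<^sub>R outer (axis i 1)) = v $ i * det w" by (simp only: cramer_lemma)
  then show ?thesis by (simp add: v_def matrix_mult_axis_nth)
qed

lemma det_one_plus_matrix_inv:
  fixes w :: "real^'n^'n"
  assumes "pd w"
  shows "det (mat 1 + c *\<^sub>R matrix_inv w) = det (w + c *\<^sub>R mat 1) / det w"
proof -
  have "w ** (mat 1 + c *\<^sub>R matrix_inv w) = w + c *\<^sub>R mat 1"
    by (simp add: matrix_add_ldistrib matrix_mult_scaleR_right pd_inv_cancel[OF assms])
  then have "det w * det (mat 1 + c *\<^sub>R matrix_inv w) = det (w + c *\<^sub>R mat 1)"
    by (metis det_mul)
  then show ?thesis using pd_det_pos[OF assms] by (simp add: field_simps)
qed

lemma prod_mat_1_permutes_eq_0: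
  assumes p_permutes: "p permutes (UNIV :: 'n::finite set)" "p \<noteq> id"
  shows "(\<Prod>j\<in>UNIV - {i}. (mat 1 :: real^'n^'n) $ j $ p j) = 0"
proof -
  have "\<exists>j. j \<noteq> i \<and> p j \<noteq> j"
  proof (rule ccontr)
    assume "\<not> ?thesis"
    then have fixed: "\<And>j. j \<noteq> i \<Longrightarrow> p j = j" by blast
    then have "p i = i" using permutes_inj[OF p_permutes(1)] by (metis injD)
    then show False using fixed p_permutes(2) by (metis eq_id_iff)
  qed
  then obtain j where "j \<noteq> i" "p j \<noteq> j" by blast
  then show ?thesis by (intro prod_zero) (auto simp: mat_def intro!: bexI[of _ j])
qed

lemma det_one_plus_has_derivative:
  fixes u :: "real^'n^'n"
  shows "((\<lambda>s. det (mat 1 + s *\<^sub>R u)) has_real_derivative trace u) (at 0)"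
proof -
  let ?P = "{p. p permutes (UNIV :: 'n set)}"
  let ?d = "\<lambda>p. \<Sum>i\<in>UNIV. u $ i $ p i * (\<Prod>j\<in>UNIV - {i}. (mat 1 :: real^'n^'n) $ j $ p j)"
  have "((\<lambda>s. \<Prod>i\<in>UNIV. (mat 1 + s *\<^sub>R u) $ i $ p i) has_real_derivative ?d p) (at 0)" for p
  proof -
    have "((\<lambda>s. \<Prod>i\<in>UNIV. mat 1 $ i $ p i + s * u $ i $ p i) has_derivative
      (\<lambda>y. \<Sum>i\<in>UNIV. (y * u $ i $ p i) * (\<Prod>j\<in>UNIV - {i}. mat 1 $ j $ p j + 0 * u $ j $ p j))) (at 0)"
      by (rule has_derivative_prod) (auto intro!: derivative_eq_intros)
    moreover have "(\<lambda>y. \<Sum>i\<in>UNIV. (y * u $ i $ p i) *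
        (\<Prod>j\<in>UNIV - {i}. mat 1 $ j $ p j + 0 * u $ j $ p j)) = (*) (?d p)"
      by (simp add: fun_eq_iff sum_distrib_left sum_distrib_right ac_simps)
    ultimately show ?thesis by (simp add: has_field_derivative_def)
  qed
  then have "((\<lambda>s. det (mat 1 + s *\<^sub>R u)) has_real_derivative (\<Sum>p\<in>?P. of_int (sign p) * ?d p)) (at 0)"
    unfolding det_def by (intro derivative_intros DERIV_cmult)
  moreover have "of_int (sign p) * ?d p = (if p = id then trace u else 0)" if "p \<in> ?P" for p
  proof (cases "p = id")
    case True
    then show ?thesis by (simp add: mat_def trace_def sign_id)
  next
    case False
    then have "(\<Prod>j\<in>UNIV - {i}. (mat 1 :: real^'n^'n) $ j $ p j) = 0" for i
      using prod_mat_1_permutes_eq_0 that by blast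
    with False show ?thesis by (simp only: mult_zero_right sum.neutral_const if_False)
  qed
  then have "(\<Sum>p\<in>?P. of_int (sign p) * ?d p) = trace u"
    by (subst sum.cong[OF refl, where h = "\<lambda>p. if p = id then trace u else 0"])
      (auto simp: permutes_id)
  ultimately show ?thesis by simp
qed

section \<open>Functions vanishing at infinity\<close>

abbreviation at_infinity_within :: "'a::real_normed_vector set \<Rightarrow> 'a filter" where
  "at_infinity_within D \<equiv> inf at_infinity (principal D)"

lemma C0_iff:
  "f \<in> C0 D \<longleftrightarrow> continuous_on D f \<and> (\<forall>x. x \<notin> D \<longrightarrow> f x = 0) \<and> (f \<longlongrightarrow> 0) (at_infinity_within D)"
proof -
  have "(f \<longlongrightarrow> 0) (at_infinity_within D) \<longleftrightarrow> (\<forall>e>0. \<exists>r. \<forall>x\<in>D. r \<le> norm x \<longrightarrow> \<bar>f x\<bar> < e)"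
    unfolding tendsto_iff eventually_inf_principal eventually_at_infinity
    by (simp add: imp_conjL) blast
  then show ?thesis by (simp add: C0_def)
qed

lemma C0D:
  assumes "f \<in> C0 D"
  shows "continuous_on D f" and "x \<notin> D \<Longrightarrow> f x = 0" and "(f \<longlongrightarrow> 0) (at_infinity_within D)"
  using assms by (auto simp: C0_iff)

lemma C0_zero: "(\<lambda>x. 0) \<in> C0 D"
  by (simp add: C0_iff)

lemma C0_lincomb:
  assumes "f \<in> C0 D" "g \<in> C0 D"
  shows "(\<lambda>x. a * f x + g x) \<in> C0 D"
proof -
  have "((\<lambda>x. a * f x + g x) \<longlongrightarrow> a * 0 + 0) (at_infinity_within D)"
    using assms by (intro tendsto_intros C0D)
  moreover have "continuous_on D (\<lambda>x. a * f x + g x)"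
    using assms by (intro continuous_intros C0D)
  ultimately show ?thesis using assms by (simp add: C0_iff)
qed

lemma C0_scale: "f \<in> C0 D \<Longrightarrow> (\<lambda>x. a * f x) \<in> C0 D"
  using C0_lincomb[OF _ C0_zero] by fastforce

lemma C0_uniform_limit:
  assumes "\<forall>\<^sub>F n in F. f n \<in> C0 D" "uniform_limit D f g F" "F \<noteq> bot"
    and "\<And>x. x \<notin> D \<Longrightarrow> g x = 0"
  shows "g \<in> C0 D"
proof -
  have "\<forall>\<^sub>F n in F. continuous_on D (f n)"
    using assms(1) by eventually_elim (rule C0D)
  then have "continuous_on D g" by (rule uniform_limit_theorem) fact+
  moreover have "\<forall>\<^sub>F n in F. (f n \<longlongrightarrow> 0) (at_infinity_within D)"
    using assms(1) by eventually_elim (rule C0D)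
  then have "(g \<longlongrightarrow> 0) (at_infinity_within D)"
    by (rule swap_uniform_limit') (use assms in \<open>auto simp: eventually_inf_principal\<close>)
  ultimately show ?thesis using assms(4) by (simp add: C0_iff)
qed

lemma compact_insert_limit_image:
  fixes h :: "'a::{real_normed_vector,heine_borel} \<Rightarrow> 'b::topological_space"
  assumes closed_D: "closed D" and h_limit: "continuous_on D h" "(h \<longlongrightarrow> l) (at_infinity_within D)"
  shows "compact (insert l (h ` D))"
  unfolding compact_eq_Heine_Borel
proof (intro allI impI, elim conjE)
  fix C assume C_cover: "\<forall>B\<in>C. open B" "insert l (h ` D) \<subseteq> \<Union>C"
  then obtain B where B_nbhd: "B \<in> C" "open B" "l \<in> B" by auto
  obtain r where far_in_B: "\<And>x. x \<in> D \<Longrightarrow> r \<le> norm x \<Longrightarrow> h x \<in> B"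
    using topological_tendstoD[OF h_limit(2) B_nbhd(2,3)]
    by (auto simp: eventually_inf_principal eventually_at_infinity)
  have "compact (D \<inter> cball 0 r)" using closed_D by (simp add: closed_Int_compact)
  then have compact: "compact (h ` (D \<inter> cball 0 r))"
    by (rule compact_continuous_image[OF continuous_on_subset[OF h_limit(1)], rotated]) simp
  have "h ` (D \<inter> cball 0 r) \<subseteq> \<Union>C" using C_cover(2) by auto
  then obtain C' where finite_subcover: "C' \<subseteq> C" "finite C'" "h ` (D \<inter> cball 0 r) \<subseteq> \<Union>C'"
    using compactE[OF compact] C_cover(1) by metis
  have "insert l (h ` D) \<subseteq> \<Union>(insert B C')"
    using finite_subcover(3) B_nbhd(3) far_in_B by fastforce
  then show "\<exists>C'\<subseteq>C. finite C' \<and> insert l (h ` D) \<subseteq> \<Union>C'"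
    using finite_subcover(1,2) B_nbhd(1) by (intro exI[of _ "insert B C'"]) auto
qed

lemma C0_bounded:
  fixes f :: "'a::euclidean_space \<Rightarrow> real"
  assumes "closed D" "f \<in> C0 D"
  obtains B where "0 \<le> B" "\<And>x. \<bar>f x\<bar> \<le> B"
proof -
  have "bounded (insert 0 (f ` D))"
    using assms C0D by (intro compact_imp_bounded compact_insert_limit_image)
  then obtain B where f_bounded: "\<And>x. x \<in> D \<Longrightarrow> \<bar>f x\<bar> \<le> B" "0 \<le> B"
    by (auto simp: bounded_iff)
  then have "\<bar>f x\<bar> \<le> B" for x using C0D(2)[OF assms(2)] by (cases "x \<in> D") auto
  then show thesis using f_bounded(2) that by blast
qed

lemma C0_borel_measurable:
  fixes f :: "'a::euclidean_space \<Rightarrow> real"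
  assumes "closed D" "f \<in> C0 D"
  shows "f \<in> borel_measurable borel"
proof -
  have "(\<lambda>x. indicator D x *\<^sub>R f x) \<in> borel_measurable borel"
    using assms by (intro borel_measurable_continuous_on_indicator C0D) auto
  moreover have "(\<lambda>x. indicator D x *\<^sub>R f x) = f"
    using C0D(2)[OF assms(2)] by (auto simp: indicator_def fun_eq_iff)
  ultimately show ?thesis by simp
qed

text \<open>If \<open>h\<close> embeds \<open>D\<close> and sends infinity to \<open>l\<close>, then \<open>insert l (h ` D)\<close> is the one-point
  compactification of \<open>D\<close>.\<close>

lemma C0_extends_to_compactification:
  fixes h :: "'a::{real_normed_vector,heine_borel} \<Rightarrow> 'b::t2_space"
  assumes closed_D: "closed D" and h_limit: "continuous_on D h" "(h \<longlongrightarrow> l) (at_infinity_within D)"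
    and inj_h: "inj_on h D" and l_notin: "l \<notin> h ` D" and f_C0: "f \<in> C0 D"
  obtains F where "continuous_on (insert l (h ` D)) F" "F l = 0" "\<And>x. x \<in> D \<Longrightarrow> F (h x) = f x"
proof -
  define F where "F y = (if y = l then 0 else f (inv_into D h y))" for y
  have F_h: "F (h x) = f x" if "x \<in> D" for x
    using that l_notin inj_h by (auto simp: F_def)
  have F_l: "F l = 0" by (simp add: F_def)
  have "closed (insert l (h ` D))"
    by (rule compact_imp_closed[OF compact_insert_limit_image[OF closed_D h_limit]])
  moreover have "closed (F -` B \<inter> insert l (h ` D))" if closed_B: "closed B" for B
  proof -
    let ?E = "D \<inter> f -` B"
    have closed_E: "closed ?E"
      using continuous_closed_vimage[OF closed_D] C0D(1)[OF f_C0] closed_B closed_D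
        continuous_on_closed_vimage[of D f]
      by (simp add: Int_commute)
    have h_E: "continuous_on ?E h" by (rule continuous_on_subset[OF h_limit(1)]) simp
    have preimage: "F -` B \<inter> insert l (h ` D) = (if 0 \<in> B then insert l (h ` ?E) else h ` ?E)"
      by (auto simp: F_h F_l)
    show ?thesis
    proof (cases "0 \<in> B")
      case True
      have "(h \<longlongrightarrow> l) (at_infinity_within ?E)"
        by (rule tendsto_mono[OF inf_mono[OF order_refl] h_limit(2)]) simp
      then show ?thesis
        unfolding preimage using True
        by (simp add: compact_imp_closed[OF compact_insert_limit_image[OF closed_E h_E]])
    next
      case False
      then have "\<forall>\<^sub>F x in at_infinity_within D. f x \<in> - B"
        using closed_B by (intro topological_tendstoD[OF C0D(3)[OF f_C0]]) auto
      then obtain r where "\<And>x. x \<in> D \<Longrightarrow> r \<le> norm x \<Longrightarrow> f x \<notin> B"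
        by (auto simp: eventually_inf_principal eventually_at_infinity)
      then have "bounded ?E" by (intro boundedI[of _ r]) force
      then have "compact (h ` ?E)"
        using closed_E
        by (intro compact_continuous_image[OF h_E]) (simp add: compact_eq_bounded_closed)
      then show ?thesis unfolding preimage using False by (simp add: compact_imp_closed)
    qed
  qed
  ultimately have "continuous_on (insert l (h ` D)) F" by (simp add: continuous_on_closed_vimage)
  then show thesis using F_l F_h by (rule that)
qed

section \<open>Exponentials on the cone\<close>

subsection \<open>Polynomial growth against exponential decay\<close>

definition poly_growth :: "('a::real_normed_vector \<Rightarrow> real) \<Rightarrow> bool" where
  "poly_growth q \<longleftrightarrow> continuous_on UNIV q \<and> (\<exists>C N. 0 \<le> C \<and> (\<forall>x. \<bar>q x\<bar> \<le> C * (1 + norm x) ^ N))"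

lemma poly_growthE:
  assumes "poly_growth q"
  obtains C N where "0 \<le> C" "\<And>x. \<bar>q x\<bar> \<le> C * (1 + norm x) ^ N"
  using assms unfolding poly_growth_def by blast

lemma poly_growth_const: "poly_growth (\<lambda>x. c)"
  unfolding poly_growth_def by (intro conjI exI[of _ "\<bar>c\<bar>"] exI[of _ 0]) auto

lemma poly_growth_norm_diff: "poly_growth (\<lambda>x. norm (x - c))"
  unfolding poly_growth_def
proof (intro conjI exI[of _ "1 + norm c"] exI[of _ 1] allI)
  show "\<bar>norm (x - c)\<bar> \<le> (1 + norm c) * (1 + norm x) ^ 1" for x
  proof -
    have "0 \<le> norm c * norm x" by simp
    then have "norm (x - c) \<le> 1 + norm x + (norm c + norm c * norm x)"
      using norm_triangle_ineq4[of x c] by linarith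
    then show ?thesis by (simp add: distrib_left distrib_right)
  qed
qed (auto intro!: continuous_intros)

lemma poly_growth_inner: "poly_growth (\<lambda>x. v \<bullet> x)"
  unfolding poly_growth_def
proof (intro conjI exI[of _ "norm v"] exI[of _ 1] allI)
  show "\<bar>v \<bullet> x\<bar> \<le> norm v * (1 + norm x) ^ 1" for x
    using Cauchy_Schwarz_ineq2[of v x] norm_ge_zero[of v] unfolding power_one_right distrib_left
    by linarith
qed (auto intro: continuous_intros)

lemma poly_growth_add:
  assumes "poly_growth p" "poly_growth q"
  shows "poly_growth (\<lambda>x. p x + q x)"
proof -
  obtain C N where p_le: "0 \<le> C" "\<And>x. \<bar>p x\<bar> \<le> C * (1 + norm x) ^ N"
    using poly_growthE[OF assms(1)] by blast
  obtain C' N' where q_le: "0 \<le> C'" "\<And>x. \<bar>q x\<bar> \<le> C' * (1 + norm x) ^ N'"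
    using poly_growthE[OF assms(2)] by blast
  have "\<bar>p x + q x\<bar> \<le> (C + C') * (1 + norm x) ^ (N + N')" for x
  proof -
    have "C * (1 + norm x) ^ N \<le> C * (1 + norm x) ^ (N + N')"
      "C' * (1 + norm x) ^ N' \<le> C' * (1 + norm x) ^ (N + N')"
      using p_le(1) q_le(1) by (auto intro!: mult_left_mono power_increasing)
    then show ?thesis using p_le(2)[of x] q_le(2)[of x] unfolding distrib_right by linarith
  qed
  moreover have "continuous_on UNIV (\<lambda>x. p x + q x)"
    using assms by (intro continuous_intros) (auto simp: poly_growth_def)
  ultimately show ?thesis
    unfolding poly_growth_def using p_le(1) q_le(1) by (meson add_nonneg_nonneg)
qed

lemma poly_growth_mult:
  assumes "poly_growth p" "poly_growth q"
  shows "poly_growth (\<lambda>x. p x * q x)"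
proof -
  obtain C N where p_le: "0 \<le> C" "\<And>x. \<bar>p x\<bar> \<le> C * (1 + norm x) ^ N"
    using poly_growthE[OF assms(1)] by blast
  obtain C' N' where q_le: "0 \<le> C'" "\<And>x. \<bar>q x\<bar> \<le> C' * (1 + norm x) ^ N'"
    using poly_growthE[OF assms(2)] by blast
  have "\<bar>p x * q x\<bar> \<le> (C * C') * (1 + norm x) ^ (N + N')" for x
  proof -
    have "\<bar>p x * q x\<bar> \<le> (C * (1 + norm x) ^ N) * (C' * (1 + norm x) ^ N')"
      unfolding abs_mult using p_le q_le by (intro mult_mono) auto
    then show ?thesis by (simp add: power_add ac_simps)
  qed
  moreover have "continuous_on UNIV (\<lambda>x. p x * q x)"
    using assms by (intro continuous_intros) (auto simp: poly_growth_def)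
  ultimately show ?thesis
    unfolding poly_growth_def using p_le(1) q_le(1) by (meson mult_nonneg_nonneg)
qed

lemma poly_growth_uminus: "poly_growth p \<Longrightarrow> poly_growth (\<lambda>x. - p x)"
  using poly_growth_mult[OF poly_growth_const, of p "-1"] by simp

lemma poly_growth_diff: "poly_growth p \<Longrightarrow> poly_growth q \<Longrightarrow> poly_growth (\<lambda>x. p x - q x)"
  using poly_growth_add[of p "\<lambda>x. - q x"] poly_growth_uminus[of q] by simp

lemma poly_growth_inner_diff: "poly_growth (\<lambda>x. v \<bullet> (x - c))"
  unfolding inner_diff_right by (intro poly_growth_diff poly_growth_inner poly_growth_const)

lemma poly_growth_mult_exp_bounded:
  fixes u c :: "real^'n^'n"
  assumes "pd u" "poly_growth q"
  shows "\<exists>\<delta>>0. \<exists>B. \<forall>W x. norm W \<le> \<delta> \<longrightarrow> psd x \<longrightarrow>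
    \<bar>q x\<bar> * exp (\<bar>W \<bullet> (x - c)\<bar> - u \<bullet> (x - c)) \<le> B"
proof -
  obtain a where u_coercive: "0 < a" "\<And>x. psd x \<Longrightarrow> a * norm x \<le> u \<bullet> x"
    using pd_inner_psd_ge[OF assms(1)] by blast
  obtain C N where q_le: "0 \<le> C" "\<And>x. \<bar>q x\<bar> \<le> C * (1 + norm x) ^ N"
    using poly_growthE[OF assms(2)] by blast
  have "0 < a / 2" using u_coercive(1) by simp
  then obtain B where power_exp_le: "\<And>r. 0 \<le> r \<Longrightarrow> (1 + r) ^ N * exp (- (a / 2 * r)) \<le> B"
    using power_mult_exp_bounded by blast
  define b where "b = a / 2 * norm c + u \<bullet> c"
  have "\<bar>q x\<bar> * exp (\<bar>W \<bullet> (x - c)\<bar> - u \<bullet> (x - c)) \<le> C * B * exp b"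
    if W_small: "norm W \<le> a / 2" and psd_x: "psd x" for W x
  proof -
    have "\<bar>W \<bullet> (x - c)\<bar> \<le> a / 2 * (norm x + norm c)"
      using W_small u_coercive(1)
      by (intro order_trans[OF Cauchy_Schwarz_ineq2] mult_mono norm_triangle_ineq4) auto
    then have "\<bar>W \<bullet> (x - c)\<bar> - u \<bullet> (x - c) \<le> - (a / 2 * norm x) + b"
      using u_coercive(2)[OF psd_x] by (simp add: b_def inner_diff_right field_simps)
    then have "exp (\<bar>W \<bullet> (x - c)\<bar> - u \<bullet> (x - c)) \<le> exp (- (a / 2 * norm x)) * exp b"
      by (simp flip: exp_add)
    then have "\<bar>q x\<bar> * exp (\<bar>W \<bullet> (x - c)\<bar> - u \<bullet> (x - c)) \<le>
        (C * (1 + norm x) ^ N) * (exp (- (a / 2 * norm x)) * exp b)"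
      using q_le by (intro mult_mono) auto
    also have "\<dots> = C * ((1 + norm x) ^ N * exp (- (a / 2 * norm x))) * exp b" by simp
    also have "\<dots> \<le> C * B * exp b"
      using q_le(1) power_exp_le[of "norm x"] by (intro mult_right_mono mult_left_mono) auto
    finally show ?thesis .
  qed
  then show ?thesis using u_coercive(1) by (intro exI[of _ "a / 2"] exI[of _ "C * B * exp b"]) auto
qed

definition exp_weighted ::
  "(real^'n^'n) set \<Rightarrow> real^'n^'n \<Rightarrow> real^'n^'n \<Rightarrow> (real^'n^'n \<Rightarrow> real) \<Rightarrow> real^'n^'n \<Rightarrow> real" where
  "exp_weighted D c u q = (\<lambda>x. if x \<in> D then q x * exp (- (u \<bullet> (x - c))) else 0)"

lemma exp_weighted_in_C0:
  assumes D_psd: "D \<subseteq> Collect psd" and pd_u: "pd u" and growth_q: "poly_growth q"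
  shows "exp_weighted D c u q \<in> C0 D"
  unfolding C0_iff
proof (intro conjI allI impI)
  have "continuous_on D q" using growth_q continuous_on_subset unfolding poly_growth_def by blast
  then have "continuous_on D (\<lambda>x. q x * exp (- (u \<bullet> (x - c))))" by (intro continuous_intros)
  then show "continuous_on D (exp_weighted D c u q)"
    by (rule continuous_on_eq) (simp add: exp_weighted_def)
  have "poly_growth (\<lambda>x. norm x * q x)"
    using poly_growth_mult[OF poly_growth_norm_diff[of 0] growth_q] by simp
  from poly_growth_mult_exp_bounded[OF pd_u this, of c] obtain \<delta> B where \<delta>_pos: "0 < \<delta>"
    and weighted_le: "\<And>W x. norm W \<le> \<delta> \<Longrightarrow> psd x \<Longrightarrow>
      \<bar>norm x * q x\<bar> * exp (\<bar>W \<bullet> (x - c)\<bar> - u \<bullet> (x - c)) \<le> B" by blast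
  show "(exp_weighted D c u q \<longlongrightarrow> 0) (at_infinity_within D)"
  proof (rule Lim_null_comparison)
    show "\<forall>\<^sub>F x in at_infinity_within D. norm (exp_weighted D c u q x) \<le> B * inverse (norm x)"
      unfolding eventually_inf_principal eventually_at_infinity
    proof (intro exI[of _ 1] allI impI)
      fix x assume x_far: "1 \<le> norm x" "x \<in> D"
      then have "psd x" using D_psd by blast
      then have "norm x * (\<bar>q x\<bar> * exp (- (u \<bullet> (x - c)))) \<le> B"
        using weighted_le[of 0 x] \<delta>_pos by (simp add: abs_mult mult.assoc)
      moreover have "0 < norm x" using x_far(1) by linarith
      ultimately show "norm (exp_weighted D c u q x) \<le> B * inverse (norm x)"
        using x_far(2) by (simp add: exp_weighted_def abs_mult pos_le_divide_eq mult.commute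
            flip: divide_inverse)
    qed
    have "((\<lambda>x. B * inverse (norm x)) \<longlongrightarrow> B * 0) at_infinity"
      by (intro tendsto_mult tendsto_const tendsto_inverse_0_at_top filterlim_norm_at_top)
    then show "((\<lambda>x. B * inverse (norm x)) \<longlongrightarrow> 0) (at_infinity_within D)"
      by (intro tendsto_mono[OF inf_le1]) simp
  qed
qed (simp add: exp_weighted_def)

lemma fexp_eq_exp_weighted:
  assumes "D \<subseteq> Collect psd"
  shows "fexp D u = exp_weighted D 0 u (\<lambda>_. 1)"
  using assms by (auto simp: fexp_def exp_weighted_def fun_eq_iff trace_mult_eq_inner psdD)

lemma fexp_eq:
  assumes "D \<subseteq> Collect psd"
  shows "fexp D u = (\<lambda>x. if x \<in> D then exp (- (u \<bullet> x)) else 0)"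
  by (simp add: fexp_eq_exp_weighted[OF assms] exp_weighted_def cong: if_cong)

lemma fexp_in_C0:
  assumes "D \<subseteq> Collect psd" "pd u"
  shows "fexp D u \<in> C0 D"
  using exp_weighted_in_C0[OF assms poly_growth_const]
  by (simp add: fexp_eq_exp_weighted[OF assms(1)])

subsection \<open>Dependence on the exponent\<close>

lemma bounded_exp_weighted:
  assumes D_psd: "D \<subseteq> Collect psd" and pd_u: "pd u" and growth_q: "poly_growth q"
  shows "bounded (exp_weighted D c u q ` D)"
proof -
  from poly_growth_mult_exp_bounded[OF pd_u growth_q, of c] obtain \<delta> B where \<delta>_pos: "0 < \<delta>"
    and weighted_le: "\<And>W x. norm W \<le> \<delta> \<Longrightarrow> psd x \<Longrightarrow> \<bar>q x\<bar> * exp (\<bar>W \<bullet> (x - c)\<bar> - u \<bullet> (x - c)) \<le> B"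
      by blast
  have "\<bar>exp_weighted D c u q x\<bar> \<le> B" if "x \<in> D" for x
    using weighted_le[of 0 x] \<delta>_pos that D_psd by (auto simp: exp_weighted_def abs_mult)
  then show ?thesis by (auto simp: bounded_iff)
qed

lemma uniform_limit_exp_weighted:
  assumes D_psd: "D \<subseteq> Collect psd" and pd_u: "pd u" and growth_q: "poly_growth q"
    and U_tendsto: "(U \<longlongrightarrow> u) F"
  shows "uniform_limit D (\<lambda>s. exp_weighted D c (U s) q) (exp_weighted D c u q) F"
proof -
  have "poly_growth (\<lambda>x. q x * norm (x - c))"
    by (intro poly_growth_mult poly_growth_norm_diff growth_q)
  from poly_growth_mult_exp_bounded[OF pd_u this, of c] obtain \<delta> B where \<delta>_pos: "0 < \<delta>"
    and weighted_le: "\<And>W x. norm W \<le> \<delta> \<Longrightarrow> psd x \<Longrightarrow>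
      \<bar>q x * norm (x - c)\<bar> * exp (\<bar>W \<bullet> (x - c)\<bar> - u \<bullet> (x - c)) \<le> B" by blast
  have dist: "((\<lambda>s. norm (U s - u)) \<longlongrightarrow> 0) F"
    using U_tendsto by (simp add: tendsto_norm_zero_iff LIM_zero_iff)
  show ?thesis
  proof (rule uniform_limit_realI)
    have "\<forall>\<^sub>F s in F. norm (U s - u) < \<delta>" by (rule order_tendstoD(2)[OF dist \<delta>_pos])
    then show "\<forall>\<^sub>F s in F. \<forall>x\<in>D.
      \<bar>exp_weighted D c (U s) q x - exp_weighted D c u q x\<bar> \<le> norm (U s - u) * B"
    proof (eventually_elim, intro ballI)
      fix s x assume close: "norm (U s - u) < \<delta>" and x_in_D: "x \<in> D"
      define a where "a = u \<bullet> (x - c)"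
      define b where "b = (U s - u) \<bullet> (x - c)"
      have "exp (- (U s \<bullet> (x - c))) - exp (- a) = (exp (- b) - 1) * exp (- a)"
        by (simp add: a_def b_def inner_diff_left left_diff_distrib flip: exp_add)
      then have "\<bar>exp_weighted D c (U s) q x - exp_weighted D c u q x\<bar>
          = \<bar>q x\<bar> * \<bar>exp (- b) - 1\<bar> * exp (- a)"
        using x_in_D
        by (simp add: exp_weighted_def a_def abs_mult mult.assoc flip: right_diff_distrib)
      also have "\<dots> \<le> \<bar>q x\<bar> * (norm (U s - u) * norm (x - c) * exp \<bar>b\<bar>) * exp (- a)"
        using abs_exp_minus_one_le[of "- b"]
          Cauchy_Schwarz_ineq2[of "U s - u" "x - c", folded b_def]
        by (intro mult_right_mono mult_left_mono) (auto elim!: order_trans intro: mult_right_mono)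
      also have "\<dots> = norm (U s - u) * (\<bar>q x * norm (x - c)\<bar> * exp (\<bar>b\<bar> - a))"
        by (simp add: abs_mult exp_diff exp_minus divide_inverse)
      also have "\<dots> \<le> norm (U s - u) * B"
        unfolding a_def b_def using weighted_le[of "U s - u" x] close x_in_D D_psd
        by (intro mult_left_mono) auto
      finally show "\<bar>exp_weighted D c (U s) q x - exp_weighted D c u q x\<bar> \<le> norm (U s - u) * B" .
    qed
    show "((\<lambda>s. norm (U s - u) * B) \<longlongrightarrow> 0) F" using tendsto_mult_left_zero[OF dist] .
  qed
qed

lemma exp_weighted_difference_quotient_le:
  assumes s_pos: "0 < s" and x_in_D: "x \<in> D"
  shows "\<bar>(exp_weighted D c (u + s *\<^sub>R w) q x - exp_weighted D c u q x) / s
      - exp_weighted D c u (\<lambda>x. - (v \<bullet> (x - c)) * q x) x\<bar>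
    \<le> s * (norm w)\<^sup>2 * (\<bar>q x * norm (x - c) ^ 2\<bar> * exp (\<bar>(s *\<^sub>R w) \<bullet> (x - c)\<bar> - u \<bullet> (x - c)))
      + norm (v - w) * (\<bar>q x * norm (x - c)\<bar> * exp (- (u \<bullet> (x - c))))"
proof -
  let ?y = "x - c"
  let ?a = "u \<bullet> ?y" and ?b = "w \<bullet> ?y" and ?d = "v \<bullet> ?y"
  have square: "?b\<^sup>2 \<le> (norm w * norm ?y)\<^sup>2"
    by (metis Cauchy_Schwarz_ineq2 abs_ge_zero power2_abs power_mono)
  have difference: "\<bar>?d - ?b\<bar> \<le> norm (v - w) * norm ?y"
    by (metis Cauchy_Schwarz_ineq2 inner_diff_left)
  have "\<bar>(exp_weighted D c (u + s *\<^sub>R w) q x - exp_weighted D c u q x) / s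
      - exp_weighted D c u (\<lambda>x. - (v \<bullet> (x - c)) * q x) x\<bar>
    = \<bar>q x\<bar> * \<bar>(exp (- (?a + s * ?b)) - exp (- ?a)) / s + ?d * exp (- ?a)\<bar>"
    using x_in_D
    by (simp add: exp_weighted_def inner_add_left abs_mult[symmetric] algebra_simps
        diff_divide_distrib)
  also have "\<dots> \<le> \<bar>q x\<bar> * ((s * ?b\<^sup>2 * exp \<bar>s * ?b\<bar> + \<bar>?d - ?b\<bar>) * exp (- ?a))"
    by (intro mult_left_mono abs_exp_difference_quotient_le s_pos) simp
  also have "\<dots> \<le> \<bar>q x\<bar> *
      ((s * (norm w * norm ?y)\<^sup>2 * exp \<bar>s * ?b\<bar> + norm (v - w) * norm ?y) * exp (- ?a))"
    using s_pos square difference by (intro mult_left_mono mult_right_mono add_mono) auto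
  also have "\<dots> = s * (norm w)\<^sup>2 * (\<bar>q x * norm ?y ^ 2\<bar> * exp (\<bar>(s *\<^sub>R w) \<bullet> ?y\<bar> - ?a))
      + norm (v - w) * (\<bar>q x * norm ?y\<bar> * exp (- ?a))"
    by (simp add: abs_mult exp_diff exp_minus field_simps power_mult_distrib)
  finally show ?thesis .
qed

lemma uniform_limit_exp_weighted_difference_quotient:
  assumes D_psd: "D \<subseteq> Collect psd" and pd_u: "pd u" and growth_q: "poly_growth q"
    and V_tendsto: "(V \<longlongrightarrow> v) (at_right 0)"
  shows "uniform_limit D
    (\<lambda>s x. (exp_weighted D c (u + s *\<^sub>R V s) q x - exp_weighted D c u q x) / s)
    (exp_weighted D c u (\<lambda>x. - (v \<bullet> (x - c)) * q x)) (at_right 0)"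
proof -
  have "poly_growth (\<lambda>x. q x * norm (x - c) ^ 2)"
    unfolding power2_eq_square by (intro poly_growth_mult poly_growth_norm_diff growth_q)
  from poly_growth_mult_exp_bounded[OF pd_u this, of c] obtain \<delta> B where \<delta>_pos: "0 < \<delta>"
    and quadratic_le: "\<And>W x. norm W \<le> \<delta> \<Longrightarrow> psd x \<Longrightarrow>
      \<bar>q x * norm (x - c) ^ 2\<bar> * exp (\<bar>W \<bullet> (x - c)\<bar> - u \<bullet> (x - c)) \<le> B" by blast
  have "poly_growth (\<lambda>x. q x * norm (x - c))"
    by (intro poly_growth_mult poly_growth_norm_diff growth_q)
  from poly_growth_mult_exp_bounded[OF pd_u this, of c] obtain \<delta>' B' where \<delta>'_pos: "0 < \<delta>'"
    and linear_le: "\<And>W x. norm W \<le> \<delta>' \<Longrightarrow> psd x \<Longrightarrow>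
      \<bar>q x * norm (x - c)\<bar> * exp (\<bar>W \<bullet> (x - c)\<bar> - u \<bullet> (x - c)) \<le> B'" by blast
  show ?thesis
  proof (rule uniform_limit_realI)
    have "((\<lambda>s. norm (s *\<^sub>R V s)) \<longlongrightarrow> norm (0 *\<^sub>R v)) (at_right 0)"
      by (intro tendsto_intros V_tendsto)
    then have "\<forall>\<^sub>F s in at_right 0. norm (s *\<^sub>R V s) < \<delta>" using \<delta>_pos by (intro order_tendstoD) auto
    moreover have "\<forall>\<^sub>F s in at_right 0. 0 < (s :: real)" by (rule eventually_at_right_less)
    ultimately show "\<forall>\<^sub>F s in at_right 0. \<forall>x\<in>D.
      \<bar>(exp_weighted D c (u + s *\<^sub>R V s) q x - exp_weighted D c u q x) / s
        - exp_weighted D c u (\<lambda>x. - (v \<bullet> (x - c)) * q x) x\<bar>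
      \<le> s * (norm (V s))\<^sup>2 * B + norm (v - V s) * B'"
    proof (eventually_elim, intro ballI)
      fix s x assume s_small: "norm (s *\<^sub>R V s) < \<delta>" "0 < s" and x_in_D: "x \<in> D"
      have "s * (norm (V s))\<^sup>2 *
            (\<bar>q x * norm (x - c) ^ 2\<bar> * exp (\<bar>(s *\<^sub>R V s) \<bullet> (x - c)\<bar> - u \<bullet> (x - c)))
          + norm (v - V s) * (\<bar>q x * norm (x - c)\<bar> * exp (- (u \<bullet> (x - c))))
        \<le> s * (norm (V s))\<^sup>2 * B + norm (v - V s) * B'"
        using s_small x_in_D D_psd quadratic_le[of "s *\<^sub>R V s" x] linear_le[of 0 x] \<delta>'_pos
        by (intro add_mono mult_left_mono) auto
      with exp_weighted_difference_quotient_le[OF s_small(2) x_in_D]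
      show "\<bar>(exp_weighted D c (u + s *\<^sub>R V s) q x - exp_weighted D c u q x) / s
          - exp_weighted D c u (\<lambda>x. - (v \<bullet> (x - c)) * q x) x\<bar>
        \<le> s * (norm (V s))\<^sup>2 * B + norm (v - V s) * B'"
        by (rule order_trans)
    qed
    have "((\<lambda>s. s * (norm (V s))\<^sup>2 * B + norm (v - V s) * B')
      \<longlongrightarrow> 0 * (norm v)\<^sup>2 * B + norm (v - v) * B') (at_right 0)"
      by (intro tendsto_intros V_tendsto)
    then show "((\<lambda>s. s * (norm (V s))\<^sup>2 * B + norm (v - V s) * B') \<longlongrightarrow> 0) (at_right 0)" by simp
  qed
qed

section \<open>Density of the exponentials\<close>

inductive_set fexp_span :: "(real^'n^'n) set \<Rightarrow> (real^'n^'n \<Rightarrow> real) set" for D where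
  zero: "(\<lambda>x. 0) \<in> fexp_span D"
| lincomb: "pd u \<Longrightarrow> g \<in> fexp_span D \<Longrightarrow> (\<lambda>x. a * fexp D u x + g x) \<in> fexp_span D"

lemma fexp_span_fexp: "pd u \<Longrightarrow> (\<lambda>x. a * fexp D u x) \<in> fexp_span D"
  using fexp_span.lincomb[OF _ fexp_span.zero, of u a D] by simp

lemma fexp_span_add: "f \<in> fexp_span D \<Longrightarrow> g \<in> fexp_span D \<Longrightarrow> (\<lambda>x. f x + g x) \<in> fexp_span D"
  by (induction rule: fexp_span.induct) (auto simp: add.assoc intro: fexp_span.lincomb)

lemma fexp_span_scale: "f \<in> fexp_span D \<Longrightarrow> (\<lambda>x. c * f x) \<in> fexp_span D"
proof (induction rule: fexp_span.induct)
  case (lincomb u g a)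
  then show ?case
    using fexp_span.lincomb[of u "\<lambda>x. c * g x" D "c * a"] by (simp add: algebra_simps)
qed (simp add: fexp_span.zero)

lemma fexp_span_sum:
  "(\<And>i. i \<in> I \<Longrightarrow> f i \<in> fexp_span D) \<Longrightarrow> (\<lambda>x. \<Sum>i\<in>I. f i x) \<in> fexp_span D"
  by (induction I rule: infinite_finite_induct) (auto intro: fexp_span_add fexp_span.zero)

lemma fexp_span_fexp_mult:
  assumes D_psd: "D \<subseteq> Collect psd" and pd_u: "pd u" and "g \<in> fexp_span D"
  shows "(\<lambda>x. fexp D u x * g x) \<in> fexp_span D"
  using assms(3)
proof (induction rule: fexp_span.induct)
  case (lincomb v h a)
  have "fexp D u x * (a * fexp D v x + h x) = a * fexp D (u + v) x + fexp D u x * h x" for x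
    by (simp add: fexp_eq[OF D_psd] inner_add_left exp_add[symmetric] algebra_simps)
  moreover have "pd (u + v)" using pd_u lincomb.hyps by (intro pd_add_psd pd_imp_psd)
  ultimately show ?case
    using fexp_span.lincomb[of "u + v" "\<lambda>x. fexp D u x * h x" D a] lincomb.IH by simp
qed (simp add: fexp_span.zero)

lemma fexp_span_mult:
  assumes D_psd: "D \<subseteq> Collect psd" and "f \<in> fexp_span D" and g_span: "g \<in> fexp_span D"
  shows "(\<lambda>x. f x * g x) \<in> fexp_span D"
  using assms(2)
proof (induction rule: fexp_span.induct)
  case (lincomb u h a)
  have "(\<lambda>x. a * (fexp D u x * g x) + h x * g x) \<in> fexp_span D"
    by (intro fexp_span_add fexp_span_scale fexp_span_fexp_mult D_psd g_span lincomb)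
  then show ?case by (simp add: algebra_simps)
qed (simp add: fexp_span.zero)

lemma fexp_span_subset_C0:
  assumes "D \<subseteq> Collect psd" "f \<in> fexp_span D"
  shows "f \<in> C0 D"
  using assms(2) by induction (intro C0_zero C0_lincomb fexp_in_C0[OF assms(1)]; assumption)+

(* The term 2 * trace x makes every entry decay on the cone and makes each entry a function fexp u
   with u positive definite. *)
definition expchart :: "real^'n^'n \<Rightarrow> real^'n^'n" where
  "expchart x = (\<chi> i j. exp (- (2 * trace x + x $ i $ j)))"

definition expchart_form :: "'n \<Rightarrow> 'n \<Rightarrow> real^'n^'n" where
  "expchart_form i j = 2 *\<^sub>R mat 1 + (1/2) *\<^sub>R (axis i (axis j 1) + axis j (axis i 1))"

lemma inner_expchart_form:
  fixes i j :: "'n::finite"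
  assumes "transpose x = x"
  shows "expchart_form i j \<bullet> x = 2 * trace x + x $ i $ j"
  using sym_nth[OF assms, of j i]
  by (simp add: expchart_form_def inner_add_left inner_axis' trace_eq_inner)

lemma pd_expchart_form: "pd (expchart_form i j :: real^'n^'n)"
  unfolding pd_def
proof (intro conjI allI impI)
  show "transpose (expchart_form i j) = expchart_form i j"
    by (auto simp: expchart_form_def transpose_def vec_eq_iff mat_def axis_def)
  fix v :: "real^'n" assume v_nonzero: "v \<noteq> 0"
  have "v \<bullet> (expchart_form i j *v v) = 2 * (norm v)\<^sup>2 + v $ i * v $ j"
    by (subst inner_outer[symmetric], subst inner_expchart_form)
      (simp_all add: trace_eq_inner inner_mat_1_outer)
  moreover have "\<bar>v $ i * v $ j\<bar> \<le> norm v * norm v"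
    unfolding abs_mult by (intro mult_mono component_le_norm_cart) auto
  moreover have "0 < (norm v)\<^sup>2" using v_nonzero by simp
  ultimately show "0 < v \<bullet> (expchart_form i j *v v)" by (simp add: power2_eq_square)
qed

lemma continuous_on_expchart: "continuous_on S expchart"
  unfolding expchart_def trace_def by (intro continuous_intros)

lemma inj_expchart: "inj (expchart :: real^'n^'n \<Rightarrow> real^'n^'n)"
proof (rule injI)
  fix x y :: "real^'n^'n" assume "expchart x = expchart y"
  from arg_cong[OF this, of "\<lambda>m. - ln (m $ i $ j)" for i j]
  have entry_eq: "2 * trace x + x $ i $ j = 2 * trace y + y $ i $ j" for i j
    by (simp only: expchart_def vec_lambda_beta ln_exp minus_minus)
  have "(\<Sum>i\<in>UNIV. 2 * trace z + z $ i $ i) = (2 * real CARD('n) + 1) * trace z"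
    for z :: "real^'n^'n"
    by (simp add: sum.distrib trace_def algebra_simps)
  moreover have "(\<Sum>i\<in>UNIV. 2 * trace x + x $ i $ i) = (\<Sum>i\<in>UNIV. 2 * trace y + y $ i $ i)"
    by (simp only: entry_eq)
  ultimately have "trace x = trace y" by (simp add: add_nonneg_eq_0_iff)
  then show "x = y" using entry_eq by (simp add: vec_eq_iff)
qed

lemma expchart_nonzero: "expchart x \<noteq> 0"
  by (simp add: expchart_def vec_eq_iff)

lemma expchart_tendsto_zero:
  assumes "D \<subseteq> Collect psd"
  shows "(expchart \<longlongrightarrow> 0) (at_infinity_within D)"
proof (intro vec_tendstoI)
  fix i j
  have "((\<lambda>x. expchart x $ i $ j) \<longlongrightarrow> 0) (at_infinity_within D)"
  proof (rule Lim_null_comparison)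
    show "\<forall>\<^sub>F x in at_infinity_within D. norm (expchart x $ i $ j) \<le> exp (- norm x)"
      unfolding eventually_inf_principal
    proof (intro always_eventually allI impI)
      fix x assume "x \<in> D"
      then have "norm x \<le> trace x" using assms psd_norm_le_trace by blast
      then show "norm (expchart x $ i $ j) \<le> exp (- norm x)"
        using abs_matrix_nth_le_norm[of x i j] by (simp add: expchart_def)
    qed
    have "((\<lambda>x. exp (- norm x)) \<longlongrightarrow> 0) at_infinity"
      by (intro filterlim_compose[OF exp_at_bot]
          filterlim_uminus_at_bot_at_top[THEN filterlim_compose]
          filterlim_norm_at_top)
    then show "((\<lambda>x. exp (- norm x)) \<longlongrightarrow> 0) (at_infinity_within D)"
      by (rule tendsto_mono[OF inf_le1])
  qed
  then show "((\<lambda>x. expchart x $ i $ j) \<longlongrightarrow> 0 $ i $ j) (at_infinity_within D)" by simp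
qed

lemma polynomial_expchart:
  assumes D_psd: "D \<subseteq> Collect psd" and "real_polynomial_function p"
  shows "\<exists>g\<in>fexp_span D. \<forall>x\<in>D. p (expchart x) = p 0 + g (x :: real^'n^'n)"
  using assms(2)
proof (induction rule: real_polynomial_function.induct)
  case (linear f)
  interpret f: bounded_linear f by fact
  define g where "g x = (\<Sum>i\<in>UNIV. \<Sum>j\<in>UNIV. f (axis i (axis j 1)) * fexp D (expchart_form i j) x)"
    for x
  have g_span: "g \<in> fexp_span D"
    unfolding g_def by (intro fexp_span_sum fexp_span_fexp pd_expchart_form)
  have "f (expchart x) = f 0 + g x" if x_in_D: "x \<in> D" for x
  proof -
    from arg_cong[OF matrix_axis_expansion[of "expchart x"], of f]
    have "f (expchart x) = (\<Sum>i\<in>UNIV. \<Sum>j\<in>UNIV. expchart x $ i $ j * f (axis i (axis j 1)))"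
      by (simp add: f.sum f.scaleR)
    moreover have "transpose x = x" using D_psd x_in_D psdD by auto
    ultimately show ?thesis using x_in_D
      by (simp only: g_def fexp_eq[OF D_psd] inner_expchart_form)
        (simp add: expchart_def mult.commute)
  qed
  then show ?case using g_span by blast
next
  case (const c)
  then show ?case using fexp_span.zero[of D] by force
next
  case (add p q)
  then obtain g h where "g \<in> fexp_span D" "\<forall>x\<in>D. p (expchart x) = p 0 + g x"
    "h \<in> fexp_span D" "\<forall>x\<in>D. q (expchart x) = q 0 + h x" by blast
  then show ?case
    by (intro bexI[of _ "\<lambda>x. g x + h x"]) (auto intro: fexp_span_add)
next
  case (mult p q)
  then obtain g h where spans: "g \<in> fexp_span D" "\<forall>x\<in>D. p (expchart x) = p 0 + g x"
    "h \<in> fexp_span D" "\<forall>x\<in>D. q (expchart x) = q 0 + h x" by blast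
  then have "(\<lambda>x. (p 0 * h x + q 0 * g x) + g x * h x) \<in> fexp_span D"
    by (intro fexp_span_add fexp_span_scale fexp_span_mult D_psd)
  with spans show ?case
    by (intro bexI[of _ "\<lambda>x. (p 0 * h x + q 0 * g x) + g x * h x"]) (auto simp: algebra_simps)
qed

lemma fexp_span_approx:
  fixes D :: "(real^'n^'n) set"
  assumes D_cone: "closed D" "D \<subseteq> Collect psd" and f_C0: "f \<in> C0 D" and e_pos: "0 < e"
  obtains g where "g \<in> fexp_span D" "\<And>x. x \<in> D \<Longrightarrow> \<bar>f x - g x\<bar> < e"
proof -
  note chart = continuous_on_expchart expchart_tendsto_zero[OF D_cone(2)]
  let ?S = "insert 0 (expchart ` D)"
  have "0 \<notin> expchart ` D" by (metis expchart_nonzero imageE)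
  then obtain F where F_extends: "continuous_on ?S F" "F 0 = 0" "\<And>x. x \<in> D \<Longrightarrow> F (expchart x) = f x"
    using C0_extends_to_compactification[OF D_cone(1) chart
      inj_on_subset[OF inj_expchart subset_UNIV] _ f_C0]
    by blast
  obtain p where p_approx: "real_polynomial_function p" "\<And>y. y \<in> ?S \<Longrightarrow> \<bar>F y - p y\<bar> < e / 2"
    using Stone_Weierstrass_real_polynomial_function[
        OF compact_insert_limit_image[OF D_cone(1) chart] F_extends(1), of "e / 2"] e_pos
    by auto
  obtain g where g_eq: "g \<in> fexp_span D" "\<And>x. x \<in> D \<Longrightarrow> p (expchart x) = p 0 + g x"
    using polynomial_expchart[OF D_cone(2) p_approx(1)] by blast
  have "\<bar>f x - g x\<bar> < e" if x_in_D: "x \<in> D" for x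
  proof -
    have "\<bar>f x - (p 0 + g x)\<bar> < e / 2"
      using p_approx(2)[of "expchart x"] x_in_D by (simp add: F_extends(3) g_eq(2))
    moreover have "\<bar>p 0\<bar> < e / 2" using p_approx(2)[of 0] by (simp add: F_extends(2))
    ultimately show ?thesis by linarith
  qed
  then show thesis using g_eq(1) by (rule that[rotated])
qed

lemma fexp_span_dense:
  fixes D :: "(real^'n^'n) set"
  assumes D_cone: "closed D" "D \<subseteq> Collect psd" and f_C0: "f \<in> C0 D"
  obtains g where "\<And>n. g n \<in> fexp_span D" "uniform_limit D g f sequentially"
proof -
  have "\<exists>g\<in>fexp_span D. \<forall>x\<in>D. \<bar>g x - f x\<bar> \<le> inverse (real (Suc n))" for n
    using fexp_span_approx[OF D_cone f_C0, of "inverse (real (Suc n))"]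
    by (metis abs_minus_commute inverse_positive_iff_positive less_imp_le of_nat_0_less_iff
        zero_less_Suc)
  then obtain g where "\<And>n. g n \<in> fexp_span D" "\<And>n x. x \<in> D \<Longrightarrow> \<bar>g n x - f x\<bar> \<le> inverse (real (Suc n))"
    by metis
  then show thesis
    by (intro that[of g] uniform_limit_realI[OF _ LIMSEQ_inverse_real_of_nat]) auto
qed

section \<open>Positive contractions\<close>

definition linear_contraction ::
  "'a::real_normed_vector set \<Rightarrow> (('a \<Rightarrow> real) \<Rightarrow> ('a \<Rightarrow> real)) \<Rightarrow> bool" where
  "linear_contraction D Q \<longleftrightarrow>
     (\<forall>f\<in>C0 D. \<forall>g\<in>C0 D. \<forall>a. Q (\<lambda>x. a * f x + g x) = (\<lambda>x. a * Q f x + Q g x))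
   \<and> (\<forall>f\<in>C0 D. \<forall>c. (\<forall>x\<in>D. \<bar>f x\<bar> \<le> c) \<longrightarrow> (\<forall>x\<in>D. \<bar>Q f x\<bar> \<le> c))"

definition pos_contraction ::
  "'a::real_normed_vector set \<Rightarrow> (('a \<Rightarrow> real) \<Rightarrow> ('a \<Rightarrow> real)) \<Rightarrow> bool" where
  "pos_contraction D Q \<longleftrightarrow> linear_contraction D Q \<and> (\<forall>f\<in>C0 D. Q f \<in> C0 D)
   \<and> (\<forall>f\<in>C0 D. (\<forall>x\<in>D. 0 \<le> f x) \<longrightarrow> (\<forall>x\<in>D. 0 \<le> Q f x))"

lemma linear_contractionD:
  assumes "linear_contraction D Q" "f \<in> C0 D"
  shows linear_contraction_lincomb:
      "g \<in> C0 D \<Longrightarrow> Q (\<lambda>x. a * f x + g x) = (\<lambda>x. a * Q f x + Q g x)"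
    and linear_contraction_abs_le:
      "(\<And>x. x \<in> D \<Longrightarrow> \<bar>f x\<bar> \<le> c) \<Longrightarrow> x \<in> D \<Longrightarrow> \<bar>Q f x\<bar> \<le> c"
  using assms unfolding linear_contraction_def by blast+

lemma linear_contraction_dist_le:
  assumes contraction_Q: "linear_contraction D Q" and f_C0: "f \<in> C0 D" and g_C0: "g \<in> C0 D"
    and close: "\<And>x. x \<in> D \<Longrightarrow> \<bar>f x - g x\<bar> \<le> e" and x_in_D: "x \<in> D"
  shows "\<bar>Q f x - Q g x\<bar> \<le> e"
proof -
  have "Q (\<lambda>x. (-1) * g x + f x) = (\<lambda>x. (-1) * Q g x + Q f x)"
    by (rule linear_contraction_lincomb[OF contraction_Q g_C0 f_C0])
  moreover have "\<bar>Q (\<lambda>x. (-1) * g x + f x) x\<bar> \<le> e"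
    by (rule linear_contraction_abs_le[OF contraction_Q C0_lincomb[OF g_C0 f_C0] _ x_in_D])
      (use close in auto)
  ultimately show ?thesis by simp
qed

lemma linear_contraction_uniform_limit:
  assumes contraction_Q: "linear_contraction D Q" and g_C0: "\<forall>\<^sub>F n in F. g n \<in> C0 D"
    and f_C0: "f \<in> C0 D"
    and g_tendsto: "uniform_limit D g f F"
  shows "uniform_limit D (\<lambda>n. Q (g n)) (Q f) F"
proof (rule uniform_limitI)
  fix e :: real assume "0 < e"
  then have "\<forall>\<^sub>F n in F. \<forall>x\<in>D. dist (g n x) (f x) < e / 2"
    by (intro uniform_limitD[OF g_tendsto]) simp
  with g_C0 show "\<forall>\<^sub>F n in F. \<forall>x\<in>D. dist (Q (g n) x) (Q f x) < e"
  proof eventually_elim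
    case (elim n)
    show ?case
    proof
      fix x assume "x \<in> D"
      have "\<bar>Q (g n) x - Q f x\<bar> \<le> e / 2"
        by (rule linear_contraction_dist_le[OF contraction_Q elim(1) f_C0 _ \<open>x \<in> D\<close>])
          (use elim(2) in \<open>auto simp: dist_real_def less_imp_le\<close>)
      then show "dist (Q (g n) x) (Q f x) < e" using \<open>0 < e\<close> by (simp add: dist_real_def)
    qed
  qed
qed

lemma pos_contractionD:
  assumes "pos_contraction D Q"
  shows pos_contraction_linear: "linear_contraction D Q"
    and pos_contraction_C0: "f \<in> C0 D \<Longrightarrow> Q f \<in> C0 D"
    and pos_contraction_nonneg:
      "f \<in> C0 D \<Longrightarrow> (\<And>x. x \<in> D \<Longrightarrow> 0 \<le> f x) \<Longrightarrow> x \<in> D \<Longrightarrow> 0 \<le> Q f x"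
  using assms unfolding pos_contraction_def by blast+

lemmas pos_contraction_lincomb = linear_contraction_lincomb[OF pos_contraction_linear]
lemmas pos_contraction_dist_le = linear_contraction_dist_le[OF pos_contraction_linear]
lemmas pos_contraction_uniform_limit = linear_contraction_uniform_limit[OF pos_contraction_linear]

lemma pos_contraction_zero: "pos_contraction D Q \<Longrightarrow> Q (\<lambda>x. 0) = (\<lambda>x. 0)"
  using pos_contraction_lincomb[OF _ C0_zero C0_zero, of D Q "-1"] by (simp add: fun_eq_iff)

lemma pos_contraction_scale:
  "pos_contraction D Q \<Longrightarrow> f \<in> C0 D \<Longrightarrow> Q (\<lambda>x. a * f x) = (\<lambda>x. a * Q f x)"
  using pos_contraction_lincomb[OF _ _ C0_zero, of D Q f a] by (simp add: pos_contraction_zero)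

lemma pos_contraction_id: "pos_contraction D (\<lambda>f. f)"
  by (simp add: pos_contraction_def linear_contraction_def)

lemma pos_contraction_comp:
  assumes contraction_Q: "pos_contraction D Q" and contraction_R: "pos_contraction D R"
  shows "pos_contraction D (\<lambda>f. Q (R f))"
  unfolding pos_contraction_def linear_contraction_def
proof (intro conjI ballI allI impI)
  fix f assume f_C0: "f \<in> C0 D"
  show "Q (R f) \<in> C0 D"
    by (intro pos_contraction_C0[OF contraction_Q] pos_contraction_C0[OF contraction_R] f_C0)
  show "0 \<le> Q (R f) x" if "\<forall>x\<in>D. 0 \<le> f x" "x \<in> D" for x
    using that f_C0
    by (intro pos_contraction_nonneg[OF contraction_Q] pos_contraction_nonneg[OF contraction_R]
        pos_contraction_C0[OF contraction_R]) auto
  show "\<bar>Q (R f) x\<bar> \<le> c" if "\<forall>x\<in>D. \<bar>f x\<bar> \<le> c" "x \<in> D" for c x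
    using that f_C0 by (intro linear_contraction_abs_le[OF pos_contraction_linear[OF contraction_Q]]
        linear_contraction_abs_le[OF pos_contraction_linear[OF contraction_R]]
        pos_contraction_C0[OF contraction_R]) auto
  show "Q (R (\<lambda>x. a * f x + g x)) = (\<lambda>x. a * Q (R f) x + Q (R g) x)" if "g \<in> C0 D" for g a
    using pos_contraction_lincomb[OF contraction_R f_C0 that]
      pos_contraction_lincomb[OF contraction_Q]
      pos_contraction_C0[OF contraction_R] f_C0 that by simp
qed

lemma pos_contraction_eqI:
  fixes D :: "(real^'n^'n) set"
  assumes D_cone: "closed D" "D \<subseteq> Collect psd" and contraction_Q: "pos_contraction D Q"
    and contraction_R: "pos_contraction D R"
    and agree_on_fexp: "\<And>u. pd u \<Longrightarrow> Q (fexp D u) = R (fexp D u)" and f_C0: "f \<in> C0 D"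
  shows "Q f = R f"
proof
  obtain g where g_approx: "\<And>n. g n \<in> fexp_span D" "uniform_limit D g f sequentially"
    using fexp_span_dense[OF D_cone f_C0] by blast
  have g_C0: "\<forall>\<^sub>F n in sequentially. g n \<in> C0 D"
    by (simp add: fexp_span_subset_C0[OF D_cone(2) g_approx(1)])
  have "Q h = R h" if "h \<in> fexp_span D" for h
    using that
  proof (induction rule: fexp_span.induct)
    case (lincomb u g a)
    note C0 = fexp_in_C0[OF D_cone(2) lincomb.hyps(1)]
      fexp_span_subset_C0[OF D_cone(2) lincomb.hyps(2)]
    show ?case
      using pos_contraction_lincomb[OF contraction_Q C0]
        pos_contraction_lincomb[OF contraction_R C0] lincomb agree_on_fexp by simp
  qed (simp add: pos_contraction_zero[OF contraction_Q] pos_contraction_zero[OF contraction_R])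
  then have "Q (g n) = R (g n)" for n using g_approx(1) by blast
  then have lims: "uniform_limit D (\<lambda>n. Q (g n)) (Q f) sequentially"
    "uniform_limit D (\<lambda>n. Q (g n)) (R f) sequentially"
    using pos_contraction_uniform_limit[OF contraction_Q g_C0 f_C0 g_approx(2)]
      pos_contraction_uniform_limit[OF contraction_R g_C0 f_C0 g_approx(2)] by simp_all
  fix x
  show "Q f x = R f x"
  proof (cases "x \<in> D")
    case True
    then show ?thesis
      using tendsto_uniform_limitI[OF lims(1)] tendsto_uniform_limitI[OF lims(2)] LIMSEQ_unique
      by blast
  next
    case False
    then show ?thesis
      using contraction_Q contraction_R f_C0 by (simp add: C0D(2)[OF pos_contraction_C0])
  qed
qed

subsection \<open>Semigroups\<close>

lemma pos_sc_contraction_semigroup_iff: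
  "pos_sc_contraction_semigroup D P \<longleftrightarrow>
    (\<forall>t\<ge>0. pos_contraction D (P t)) \<and> (\<forall>f\<in>C0 D. P 0 f = f) \<and>
    (\<forall>s\<ge>0. \<forall>t\<ge>0. \<forall>f\<in>C0 D. P (s + t) f = P s (P t f)) \<and>
    (\<forall>f\<in>C0 D. uniform_limit D (\<lambda>t. P t f) f (at_right 0))"
  unfolding pos_sc_contraction_semigroup_def pos_contraction_def linear_contraction_def
  using uniform_limit_at_right_0_iff[of D "\<lambda>t. P t f" f for f] by (safe; simp)

lemma strongly_continuous_if_dense:
  fixes P :: "real \<Rightarrow> ('a::real_normed_vector \<Rightarrow> real) \<Rightarrow> 'a \<Rightarrow> real"
  assumes contraction_P: "\<And>t. 0 \<le> t \<Longrightarrow> pos_contraction D (P t)" and f_C0: "f \<in> C0 D"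
    and g_approx: "\<And>n. g n \<in> C0 D" "uniform_limit D g f sequentially"
    and cont: "\<And>n. uniform_limit D (\<lambda>t. P t (g n)) (g n) (at_right 0)"
  shows "uniform_limit D (\<lambda>t. P t f) f (at_right 0)"
proof (rule uniform_limitI)
  fix e :: real assume "0 < e"
  then have e_pos: "0 < e / 3" by simp
  then obtain n where close: "\<And>x. x \<in> D \<Longrightarrow> \<bar>f x - g n x\<bar> < e / 3"
    using eventually_happens[OF uniform_limitD[OF g_approx(2) e_pos]]
    by (auto simp: dist_real_def abs_minus_commute)
  have "\<forall>\<^sub>F t in at_right 0. 0 < (t :: real)" by (rule eventually_at_right_less)
  moreover note uniform_limitD[OF cont[of n] e_pos]
  ultimately show "\<forall>\<^sub>F t in at_right 0. \<forall>x\<in>D. dist (P t f x) (f x) < e"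
  proof eventually_elim
    case (elim t)
    show ?case
    proof
      fix x assume x_in_D: "x \<in> D"
      have "\<bar>P t f x - P t (g n) x\<bar> \<le> e / 3"
        using close
        by (intro pos_contraction_dist_le[OF contraction_P[OF less_imp_le[OF elim(1)]] f_C0
            g_approx(1) _ x_in_D]
            less_imp_le)
      moreover have "\<bar>P t (g n) x - g n x\<bar> < e / 3" using elim x_in_D by (simp add: dist_real_def)
      ultimately show "dist (P t f x) (f x) < e"
        using close[OF x_in_D] unfolding dist_real_def by linarith
    qed
  qed
qed

subsection \<open>Operators given by Markov kernels\<close>

definition markov_kernel :: "'a::real_normed_vector set \<Rightarrow> ('a \<Rightarrow> 'a measure) \<Rightarrow> bool" where
  "markov_kernel D M \<longleftrightarrow>
    (\<forall>x\<in>D. prob_space (M x) \<and> sets (M x) = sets borel \<and> (AE y in M x. y \<in> D))"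

definition kernel_op :: "'a::real_normed_vector set \<Rightarrow> ('a \<Rightarrow> 'a measure) \<Rightarrow> ('a \<Rightarrow> real) \<Rightarrow> 'a \<Rightarrow> real"
where
  "kernel_op D M f = (\<lambda>x. if x \<in> D then \<integral>y. f y \<partial>M x else 0)"

lemma markov_kernelD:
  assumes "markov_kernel D M" "x \<in> D"
  shows "prob_space (M x)" and "sets (M x) = sets borel" and "AE y in M x. y \<in> D"
  using assms by (auto simp: markov_kernel_def)

context
  fixes D :: "'a::euclidean_space set" and M
  assumes closed_D: "closed D" and kernel_M: "markov_kernel D M"
begin

lemma C0_integrable_kernel:
  assumes "f \<in> C0 D" "x \<in> D"
  shows "integrable (M x) f"
proof -
  interpret prob_space "M x" by (rule markov_kernelD[OF kernel_M assms(2)])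
  obtain B where "\<And>x. \<bar>f x\<bar> \<le> B" using C0_bounded[OF closed_D assms(1)] by blast
  moreover have "f \<in> borel_measurable (M x)"
    using C0_borel_measurable[OF closed_D assms(1)] markov_kernelD(2)[OF kernel_M assms(2)]
      measurable_cong_sets
    by blast
  ultimately show ?thesis by (intro integrable_const_bound[of _ B]) auto
qed

lemma kernel_op_lincomb:
  "f \<in> C0 D \<Longrightarrow> g \<in> C0 D \<Longrightarrow>
    kernel_op D M (\<lambda>x. a * f x + g x) = (\<lambda>x. a * kernel_op D M f x + kernel_op D M g x)"
  using C0_integrable_kernel by (auto simp: kernel_op_def fun_eq_iff)

lemma kernel_op_nonneg:
  assumes "\<And>y. y \<in> D \<Longrightarrow> 0 \<le> f y" "x \<in> D"
  shows "0 \<le> kernel_op D M f x"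
proof -
  have "AE y in M x. 0 \<le> f y"
    using markov_kernelD(3)[OF kernel_M assms(2)] by eventually_elim (rule assms(1))
  then show ?thesis using assms(2) by (auto simp: kernel_op_def intro: integral_nonneg_AE)
qed

lemma kernel_op_abs_le:
  assumes "f \<in> C0 D" "\<And>y. y \<in> D \<Longrightarrow> \<bar>f y\<bar> \<le> c" "x \<in> D"
  shows "\<bar>kernel_op D M f x\<bar> \<le> c"
proof -
  interpret prob_space "M x" by (rule markov_kernelD[OF kernel_M assms(3)])
  have "AE y in M x. \<bar>f y\<bar> \<le> c"
    using markov_kernelD(3)[OF kernel_M assms(3)] by eventually_elim (rule assms(2))
  then have abs_le: "(\<integral>y. \<bar>f y\<bar> \<partial>M x) \<le> (\<integral>y. c \<partial>M x)"
    using C0_integrable_kernel[OF assms(1,3)] by (intro integral_mono_AE) auto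
  have "\<bar>\<integral>y. f y \<partial>M x\<bar> \<le> (\<integral>y. \<bar>f y\<bar> \<partial>M x)" by (rule integral_abs_bound)
  also note abs_le
  finally have "\<bar>\<integral>y. f y \<partial>M x\<bar> \<le> c" by (simp add: prob_space)
  then show ?thesis using assms(3) by (simp add: kernel_op_def)
qed

lemma linear_contraction_kernel_op: "linear_contraction D (kernel_op D M)"
  using kernel_op_lincomb kernel_op_abs_le by (simp add: linear_contraction_def)

end

lemma pos_contraction_kernel_op:
  fixes D :: "(real^'n^'n) set"
  assumes D_cone: "closed D" "D \<subseteq> Collect psd" and kernel_M: "markov_kernel D M"
    and fexp: "\<And>u. pd u \<Longrightarrow> kernel_op D M (fexp D u) \<in> C0 D"
  shows "pos_contraction D (kernel_op D M)"
proof -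
  note linear = linear_contraction_kernel_op[OF D_cone(1) kernel_M]
  have span: "kernel_op D M g \<in> C0 D" if "g \<in> fexp_span D" for g
    using that
  proof (induction rule: fexp_span.induct)
    case zero
    then show ?case using C0_zero by (simp add: kernel_op_def cong: if_cong)
  next
    case (lincomb u g a)
    have "kernel_op D M (\<lambda>x. a * fexp D u x + g x)
        = (\<lambda>x. a * kernel_op D M (fexp D u) x + kernel_op D M g x)"
      by (intro linear_contraction_lincomb[OF linear] fexp_in_C0 fexp_span_subset_C0 D_cone lincomb)
    then show ?case using C0_lincomb[OF fexp[OF lincomb.hyps(1)] lincomb.IH] by simp
  qed
  have "kernel_op D M f \<in> C0 D" if f_C0: "f \<in> C0 D" for f
  proof -
    obtain g where g_approx: "\<And>n. g n \<in> fexp_span D" "uniform_limit D g f sequentially"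
      using fexp_span_dense[OF D_cone f_C0] by blast
    have "uniform_limit D (\<lambda>n. kernel_op D M (g n)) (kernel_op D M f) sequentially"
      by (intro linear_contraction_uniform_limit[OF linear] always_eventually allI
          fexp_span_subset_C0 D_cone f_C0 g_approx)
    then show ?thesis
      by (rule C0_uniform_limit[rotated]) (simp_all add: span g_approx(1), simp add: kernel_op_def)
  qed
  then show ?thesis
    using linear kernel_op_nonneg[OF D_cone(1) kernel_M] by (simp add: pos_contraction_def)
qed

section \<open>Wishart operators\<close>

subsection \<open>The flow on exponents\<close>

definition wishart_flow :: "real^'n^'n \<Rightarrow> real \<Rightarrow> real^'n^'n" where
  "wishart_flow u t = matrix_inv (matrix_inv u + (2 * t) *\<^sub>R mat 1)"

definition wishart_factor :: "real \<Rightarrow> real^'n^'n \<Rightarrow> real \<Rightarrow> real" where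
  "wishart_factor \<alpha> u t = det (mat 1 + (2 * t) *\<^sub>R u) powr (- \<alpha> / 2)"

lemma wishart_flow_eq:
  fixes u :: "real^'n^'n"
  assumes pd_u: "pd u" and t_nonneg: "0 \<le> t"
  shows "wishart_flow u t = u + t *\<^sub>R ((-2) *\<^sub>R (u ** wishart_flow u t))"
proof -
  let ?w = "matrix_inv u" and ?U = "wishart_flow u t"
  have "pd (?w + (2 * t) *\<^sub>R mat 1)"
    using t_nonneg by (intro pd_add_scaled_mat_1 pd_matrix_inv pd_u) simp
  then have "u ** ((?w + (2 * t) *\<^sub>R mat 1) ** ?U) = u"
    by (simp add: wishart_flow_def pd_inv_cancel)
  moreover have "u ** ((?w + (2 * t) *\<^sub>R mat 1) ** ?U) = ?U + (2 * t) *\<^sub>R (u ** ?U)"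
    by (simp add: matrix_mul_assoc matrix_add_ldistrib matrix_mult_scaleR_right
        pd_inv_cancel[OF pd_u] matrix_add_rdistrib_real matrix_mult_scaleR_left)
  ultimately show ?thesis by (simp add: algebra_simps)
qed

lemma norm_wishart_flow_diff_le:
  fixes u :: "real^'n^'n"
  assumes pd_u: "pd u" and t_nonneg: "0 \<le> t" and small: "4 * t * norm u \<le> 1"
  shows "norm (wishart_flow u t - u) \<le> t * (4 * (norm u)\<^sup>2)"
proof -
  let ?U = "wishart_flow u t"
  have "norm (?U - u) = 2 * t * norm (u ** ?U)"
    using t_nonneg by (subst wishart_flow_eq[OF pd_u t_nonneg]) simp
  also have "\<dots> \<le> 2 * t * (norm u * norm ?U)"
    using t_nonneg by (intro mult_left_mono norm_matrix_mult_le) simp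
  finally have diff: "norm (?U - u) \<le> 2 * t * (norm u * norm ?U)" .
  also have "\<dots> \<le> norm ?U / 2"
    using mult_right_mono[OF small, of "norm ?U"] by (simp add: ac_simps)
  finally have "norm ?U \<le> 2 * norm u" using norm_triangle_ineq2[of ?U u] by linarith
  then have "2 * t * (norm u * norm ?U) \<le> 2 * t * (norm u * (2 * norm u))"
    using t_nonneg by (intro mult_left_mono) auto
  with diff show ?thesis by (simp add: power2_eq_square mult.assoc)
qed

lemma wishart_flow_tendsto:
  fixes u :: "real^'n^'n"
  assumes pd_u: "pd u"
  shows "(wishart_flow u \<longlongrightarrow> u) (at_right 0)"
proof -
  have "((\<lambda>t. t * (4 * (norm u)\<^sup>2)) \<longlongrightarrow> 0 * (4 * (norm u)\<^sup>2)) (at_right 0)" by (intro tendsto_intros)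
  then have bound: "((\<lambda>t. t * (4 * (norm u)\<^sup>2)) \<longlongrightarrow> 0) (at_right 0)" by simp
  have "((\<lambda>t. 4 * t * norm u) \<longlongrightarrow> 4 * 0 * norm u) (at_right 0)" by (intro tendsto_intros)
  then have "\<forall>\<^sub>F t in at_right 0. 4 * t * norm u < 1" by (intro order_tendstoD) auto
  moreover have "\<forall>\<^sub>F t in at_right 0. 0 < (t :: real)" by (rule eventually_at_right_less)
  ultimately have "\<forall>\<^sub>F t in at_right 0. norm (wishart_flow u t - u) \<le> t * (4 * (norm u)\<^sup>2)"
    by eventually_elim (intro norm_wishart_flow_diff_le pd_u, auto)
  then have "((\<lambda>t. wishart_flow u t - u) \<longlongrightarrow> 0) (at_right 0)"
    by (rule Lim_null_comparison[OF _ bound])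
  then show ?thesis by (rule LIM_zero_cancel)
qed

lemma wishart_factor_0 [simp]: "wishart_factor \<alpha> u 0 = 1"
  by (simp add: wishart_factor_def)

lemma wishart_factor_has_derivative:
  "(wishart_factor \<alpha> u has_real_derivative - \<alpha> * trace u) (at 0)"
proof -
  have "((\<lambda>t. det (mat 1 + (2 * t) *\<^sub>R u)) has_real_derivative trace u * 2) (at 0)"
    using DERIV_chain[of "\<lambda>s. det (mat 1 + s *\<^sub>R u)" "trace u" "\<lambda>t. 2 * t" 0 2 UNIV]
      det_one_plus_has_derivative[of u]
    by (auto simp: o_def intro!: derivative_eq_intros)
  from DERIV_powr[OF this, of "\<lambda>_. - \<alpha> / 2" 0] show ?thesis
    by (simp add: wishart_factor_def[abs_def] mult.commute)
qed

lemma wishart_factor_difference_quotient: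
  "((\<lambda>t. (wishart_factor \<alpha> u t - 1) / t) \<longlongrightarrow> - \<alpha> * trace u) (at_right 0)"
  using wishart_factor_has_derivative[of \<alpha> u]
  unfolding has_field_derivative_iff by (auto intro: tendsto_mono[OF at_le])

lemma wishart_factor_tendsto: "(wishart_factor \<alpha> u \<longlongrightarrow> 1) (at_right 0)"
  using DERIV_isCont[OF wishart_factor_has_derivative[of \<alpha> u]]
  by (auto simp: isCont_def intro: tendsto_mono[OF at_le])

definition wishart_symbol :: "real \<Rightarrow> real^'n^'n \<Rightarrow> real^'n^'n \<Rightarrow> real" where
  "wishart_symbol \<alpha> u x = - \<alpha> * trace u + 2 * ((u ** u) \<bullet> x)"

lemma poly_growth_wishart_symbol: "poly_growth (wishart_symbol \<alpha> u)"
  unfolding wishart_symbol_def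
  by (intro poly_growth_add poly_growth_mult poly_growth_const poly_growth_inner)

lemma uniform_limit_wishart_fexp:
  assumes D_psd: "D \<subseteq> Collect psd" and pd_u: "pd u"
  shows "uniform_limit D (\<lambda>t x. wishart_factor \<alpha> u t * fexp D (wishart_flow u t) x)
    (fexp D u) (at_right 0)"
proof -
  have "uniform_limit D (\<lambda>t. fexp D (wishart_flow u t)) (fexp D u) (at_right 0)"
    unfolding fexp_eq_exp_weighted[OF D_psd]
    by (intro uniform_limit_exp_weighted D_psd pd_u poly_growth_const wishart_flow_tendsto)
  moreover have "bounded (fexp D u ` D)"
    unfolding fexp_eq_exp_weighted[OF D_psd]
    by (intro bounded_exp_weighted D_psd pd_u poly_growth_const)
  ultimately show ?thesis
    using uniform_limit_tendsto_mult[OF wishart_factor_tendsto] by fastforce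
qed

lemma uniform_limit_wishart_difference_quotient:
  assumes D_psd: "D \<subseteq> Collect psd" and pd_u: "pd u"
  shows "uniform_limit D
    (\<lambda>t x. (wishart_factor \<alpha> u t * fexp D (wishart_flow u t) x - fexp D u x) / t)
    (exp_weighted D 0 u (wishart_symbol \<alpha> u)) (at_right 0)"
proof -
  let ?V = "\<lambda>t. (-2) *\<^sub>R (u ** wishart_flow u t)"
  let ?quotient = "\<lambda>t x. (fexp D (u + t *\<^sub>R ?V t) x - fexp D u x) / t"
  let ?deriv = "exp_weighted D 0 u (\<lambda>x. - (((-2) *\<^sub>R (u ** u)) \<bullet> (x - 0)) * 1)"
  have "(?V \<longlongrightarrow> (-2) *\<^sub>R (u ** u)) (at_right 0)"
    by (intro tendsto_intros tendsto_matrix_mult_right wishart_flow_tendsto pd_u)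
  then have quotient: "uniform_limit D ?quotient ?deriv (at_right 0)"
    unfolding fexp_eq_exp_weighted[OF D_psd]
    by (intro uniform_limit_exp_weighted_difference_quotient D_psd pd_u poly_growth_const)
  have "bounded (?deriv ` D)"
    by (intro bounded_exp_weighted D_psd pd_u poly_growth_mult poly_growth_uminus poly_growth_const
        poly_growth_inner_diff)
  moreover have "bounded (fexp D u ` D)"
    unfolding fexp_eq_exp_weighted[OF D_psd]
    by (intro bounded_exp_weighted D_psd pd_u poly_growth_const)
  ultimately have "uniform_limit D
      (\<lambda>t x. wishart_factor \<alpha> u t * ?quotient t x + (wishart_factor \<alpha> u t - 1) / t * fexp D u x)
      (\<lambda>x. 1 * ?deriv x + (- \<alpha> * trace u) * fexp D u x) (at_right 0)"
    by (intro uniform_limit_add uniform_limit_tendsto_mult quotient uniform_limit_const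
        wishart_factor_tendsto wishart_factor_difference_quotient)
  then show ?thesis
  proof (rule uniform_limit_cong[THEN iffD1, rotated 2])
    have "\<forall>\<^sub>F t in at_right 0. 0 < (t :: real)" by (rule eventually_at_right_less)
    then show "\<forall>\<^sub>F t in at_right 0. \<forall>x\<in>D.
        wishart_factor \<alpha> u t * ?quotient t x + (wishart_factor \<alpha> u t - 1) / t * fexp D u x =
        (wishart_factor \<alpha> u t * fexp D (wishart_flow u t) x - fexp D u x) / t"
    proof eventually_elim
      case (elim t)
      then have "u + t *\<^sub>R ?V t = wishart_flow u t" using wishart_flow_eq[OF pd_u, of t] by simp
      then show ?case using elim by (simp only:) (simp add: field_simps)
    qed
    show "1 * ?deriv x + - \<alpha> * trace u * fexp D u x = exp_weighted D 0 u (wishart_symbol \<alpha> u) x"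
      for x
      by (simp add: exp_weighted_def fexp_eq[OF D_psd] wishart_symbol_def algebra_simps)
  qed
qed

subsection \<open>Composition and uniqueness\<close>

(* In terms of w = matrix_inv u the flow is w \<mapsto> w + s with s = 2 t I; allowing every positive
   semidefinite s makes it possible to treat the coordinate directions one at a time. *)
definition wishart_op ::
  "(real^'n^'n) set \<Rightarrow> real \<Rightarrow> real^'n^'n \<Rightarrow> ((real^'n^'n \<Rightarrow> real) \<Rightarrow> real^'n^'n \<Rightarrow> real) \<Rightarrow> bool" where
  "wishart_op D \<alpha> s Q \<longleftrightarrow> pos_contraction D Q \<and> (\<forall>w. pd w \<longrightarrow> Q (fexp D (matrix_inv w)) =
    (\<lambda>x. (det (w + s) / det w) powr (- \<alpha> / 2) * fexp D (matrix_inv (w + s)) x))"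

lemma wishart_opD:
  assumes "wishart_op D \<alpha> s Q"
  shows "pos_contraction D Q"
    and "pd w \<Longrightarrow> Q (fexp D (matrix_inv w)) =
      (\<lambda>x. (det (w + s) / det w) powr (- \<alpha> / 2) * fexp D (matrix_inv (w + s)) x)"
  using assms by (auto simp: wishart_op_def)

lemma wishart_op_comp:
  fixes D :: "(real^'n^'n) set"
  assumes D_psd: "D \<subseteq> Collect psd" and op_Q: "wishart_op D \<alpha> s Q" and op_R: "wishart_op D \<alpha> t R"
    and psd_steps: "psd s" "psd t"
  shows "wishart_op D \<alpha> (s + t) (\<lambda>f. Q (R f))"
  unfolding wishart_op_def
proof (intro conjI allI impI)
  show "pos_contraction D (\<lambda>f. Q (R f))"
    by (rule pos_contraction_comp[OF wishart_opD(1)[OF op_Q] wishart_opD(1)[OF op_R]])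
  fix w :: "real^'n^'n" assume pd_w: "pd w"
  have pd_steps: "pd (w + t)" "pd (w + t + s)" using pd_w psd_steps by (auto intro: pd_add_psd)
  let ?f = "\<lambda>w. fexp D (matrix_inv w)"
  have "Q (R (?f w)) = Q (\<lambda>x. (det (w + t) / det w) powr (- \<alpha> / 2) * ?f (w + t) x)"
    by (simp add: wishart_opD(2)[OF op_R pd_w])
  also have "\<dots> = (\<lambda>x. (det (w + t) / det w) powr (- \<alpha> / 2) * Q (?f (w + t)) x)"
    by (rule pos_contraction_scale[OF wishart_opD(1)[OF op_Q]
        fexp_in_C0[OF D_psd pd_matrix_inv[OF pd_steps(1)]]])
  also have "\<dots> = (\<lambda>x. ((det (w + t) / det w) powr (- \<alpha> / 2) *
      (det (w + t + s) / det (w + t)) powr (- \<alpha> / 2)) * ?f (w + t + s) x)"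
    by (simp add: wishart_opD(2)[OF op_Q pd_steps(1)] mult.assoc)
  also have "(det (w + t) / det w) powr (- \<alpha> / 2) * (det (w + t + s) / det (w + t)) powr (- \<alpha> / 2)
      = (det (w + t) / det w * (det (w + t + s) / det (w + t))) powr (- \<alpha> / 2)"
    by (rule powr_mult[symmetric])
  also have "det (w + t) / det w * (det (w + t + s) / det (w + t)) = det (w + t + s) / det w"
    using pd_det_pos[OF pd_steps(1)] by simp
  also have "w + t + s = w + (s + t)" by (simp add: algebra_simps)
  finally show "Q (R (?f w)) =
      (\<lambda>x. (det (w + (s + t)) / det w) powr (- \<alpha> / 2) * ?f (w + (s + t)) x)" .
qed

lemma wishart_op_id: "wishart_op D \<alpha> 0 (\<lambda>f. f)"
  unfolding wishart_op_def using pos_contraction_id pd_det_pos by fastforce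

lemma wishart_op_unique:
  assumes D_cone: "closed D" "D \<subseteq> Collect psd" and op_Q: "wishart_op D \<alpha> s Q"
    and op_R: "wishart_op D \<alpha> s R"
    and f_C0: "f \<in> C0 D"
  shows "Q f = R f"
proof (rule pos_contraction_eqI[OF D_cone wishart_opD(1)[OF op_Q] wishart_opD(1)[OF op_R] _ f_C0])
  fix u :: "real^'a^'a" assume pd_u: "pd u"
  show "Q (fexp D u) = R (fexp D u)"
    using wishart_opD(2)[OF op_Q pd_matrix_inv[OF pd_u]]
      wishart_opD(2)[OF op_R pd_matrix_inv[OF pd_u]]
    by (simp add: matrix_inv_matrix_inv[OF pd_u])
qed

lemma wishart_op_fexp:
  assumes "wishart_op D \<alpha> ((2 * t) *\<^sub>R mat 1) Q" "pd u"
  shows "Q (fexp D u) = (\<lambda>x. wishart_factor \<alpha> u t * fexp D (wishart_flow u t) x)"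
  using wishart_opD(2)[OF assms(1) pd_matrix_inv[OF assms(2)]]
    det_one_plus_matrix_inv[OF pd_matrix_inv[OF assms(2)], of "2 * t"]
  by (simp add: matrix_inv_matrix_inv[OF assms(2)] wishart_factor_def wishart_flow_def)

lemma wishart_op_from_coordinates:
  fixes D :: "(real^'n^'n) set"
  assumes D_psd: "D \<subseteq> Collect psd" and t_nonneg: "0 \<le> t"
    and coordinate_ops: "\<And>i. \<exists>Q. wishart_op D \<alpha> (t *\<^sub>R outer (axis i 1)) Q"
  shows "\<exists>Q. wishart_op D \<alpha> (t *\<^sub>R mat 1) Q"
proof -
  have psd_step: "psd (t *\<^sub>R outer (axis i 1) :: real^'n^'n)" for i
    using t_nonneg by (intro psd_scaleR) auto
  have "\<exists>Q. wishart_op D \<alpha> (\<Sum>i\<in>J. t *\<^sub>R outer (axis i 1)) Q" if "finite J" for J :: "'n set"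
    using that
  proof (induction J)
    case empty
    then show ?case using wishart_op_id[of D \<alpha>] by auto
  next
    case (insert i J)
    then obtain Q where "wishart_op D \<alpha> (\<Sum>i\<in>J. t *\<^sub>R outer (axis i 1)) Q" by blast
    moreover obtain R where "wishart_op D \<alpha> (t *\<^sub>R outer (axis i 1)) R"
      using coordinate_ops by blast
    ultimately have
      "wishart_op D \<alpha> (t *\<^sub>R outer (axis i 1) + (\<Sum>i\<in>J. t *\<^sub>R outer (axis i 1))) (\<lambda>f. R (Q f))"
      by (intro wishart_op_comp D_psd psd_step psd_sum)
    then show ?case using insert.hyps by auto
  qed
  moreover have "(\<Sum>i\<in>UNIV. outer (axis i 1)) = (mat 1 :: real^'n^'n)"
  proof -
    have "(\<Sum>i\<in>UNIV. (axis i 1 :: real^'n) $ a * axis i 1 $ b)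
        = (\<Sum>i\<in>UNIV. if a = i then (if a = b then 1 else 0) else 0)" for a b
      by (rule sum.cong) (auto simp: axis_def)
    then show ?thesis by (simp add: vec_eq_iff mat_def)
  qed
  then have "(\<Sum>i\<in>UNIV. t *\<^sub>R outer (axis i 1)) = (t *\<^sub>R mat 1 :: real^'n^'n)"
    by (simp only: scaleR_sum_right[symmetric])
  ultimately show ?thesis by (metis finite)
qed

lemma wishart_ops_strongly_continuous:
  fixes D :: "(real^'n^'n) set" and P :: "real \<Rightarrow> (real^'n^'n \<Rightarrow> real) \<Rightarrow> real^'n^'n \<Rightarrow> real"
  assumes D_cone: "closed D" "D \<subseteq> Collect psd"
    and op_P: "\<And>t. 0 \<le> t \<Longrightarrow> wishart_op D \<alpha> ((2 * t) *\<^sub>R mat 1) (P t)" and f_C0: "f \<in> C0 D"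
  shows "uniform_limit D (\<lambda>t. P t f) f (at_right 0)"
proof -
  have pos_contraction: "pos_contraction D (P t)" if "0 \<le> t" for t
    by (rule wishart_opD(1)[OF op_P[OF that]])
  have positive: "\<forall>\<^sub>F t in at_right 0. 0 < (t :: real)" by (rule eventually_at_right_less)
  have fexp: "uniform_limit D (\<lambda>t. P t (fexp D u)) (fexp D u) (at_right 0)" if pd_u: "pd u" for u
  proof (rule uniform_limit_cong[THEN iffD1, OF _ _ uniform_limit_wishart_fexp[OF D_cone(2) pd_u]])
    show "\<forall>\<^sub>F t in at_right 0. \<forall>x\<in>D.
        wishart_factor \<alpha> u t * fexp D (wishart_flow u t) x = P t (fexp D u) x"
      using positive by eventually_elim (simp add: wishart_op_fexp[OF op_P pd_u])
  qed simp
  have span: "uniform_limit D (\<lambda>t. P t g) g (at_right 0)" if "g \<in> fexp_span D" for g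
    using that
  proof (induction rule: fexp_span.induct)
    case zero
    show ?case
      by (rule uniform_limit_cong[THEN iffD1, OF _ _ uniform_limit_const])
        (use positive in
            \<open>auto elim!: eventually_mono simp: pos_contraction_zero[OF pos_contraction]\<close>)
  next
    case (lincomb u g a)
    note C0 = fexp_in_C0[OF D_cone(2) lincomb.hyps(1)]
      fexp_span_subset_C0[OF D_cone(2) lincomb.hyps(2)]
    have "uniform_limit D (\<lambda>t x. a * P t (fexp D u) x + P t g x)
        (\<lambda>x. a * fexp D u x + g x) (at_right 0)"
      by (intro uniform_limit_intros fexp lincomb)
    then show ?case
      by (rule uniform_limit_cong[THEN iffD1, rotated 2])
        (use positive in
            \<open>auto elim!: eventually_mono simp: pos_contraction_lincomb[OF pos_contraction C0]\<close>)
  qed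
  obtain g where g_approx: "\<And>n. g n \<in> fexp_span D" "uniform_limit D g f sequentially"
    using fexp_span_dense[OF D_cone f_C0] by blast
  show ?thesis
    by (rule strongly_continuous_if_dense[OF pos_contraction f_C0
        fexp_span_subset_C0[OF D_cone(2) g_approx(1)] g_approx(2)
          span[OF g_approx(1)]])
qed

lemma wishart_semigroup_if_ops:
  fixes D :: "(real^'n^'n) set"
  assumes D_cone: "closed D" "D \<subseteq> Collect psd" and \<alpha>_nonneg: "0 \<le> \<alpha>"
    and ops_exist: "\<And>t. 0 \<le> t \<Longrightarrow> \<exists>Q. wishart_op D \<alpha> ((2 * t) *\<^sub>R mat 1) Q"
  shows "\<exists>P. wishart_semigroup D \<alpha> P"
proof -
  obtain P where op_P: "\<And>t. 0 \<le> t \<Longrightarrow> wishart_op D \<alpha> ((2 * t) *\<^sub>R mat 1) (P t)"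
    using ops_exist by metis
  have "P 0 f = f" if "f \<in> C0 D" for f
    using wishart_op_unique[OF D_cone op_P[of 0] _ that, of "\<lambda>f. f"] wishart_op_id[of D \<alpha>] by simp
  moreover have "P (s + t) f = P s (P t f)"
    if times_nonneg: "0 \<le> s" "0 \<le> t" and f_C0: "f \<in> C0 D" for s t f
  proof (rule wishart_op_unique[OF D_cone op_P _ f_C0])
    have "psd ((2 * t) *\<^sub>R mat 1 :: real^'n^'n)" if "0 \<le> t" for t
      using that by (intro psd_scaleR pd_imp_psd pd_mat_1) auto
    then have "wishart_op D \<alpha> ((2 * s) *\<^sub>R mat 1 + (2 * t) *\<^sub>R mat 1) (\<lambda>f. P s (P t f))"
      using times_nonneg by (intro wishart_op_comp D_cone op_P)
    then show "wishart_op D \<alpha> ((2 * (s + t)) *\<^sub>R mat 1) (\<lambda>f. P s (P t f))"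
      by (simp add: scaleR_add_left[symmetric] distrib_left)
  qed (use times_nonneg in simp)
  ultimately have "pos_sc_contraction_semigroup D P"
    unfolding pos_sc_contraction_semigroup_iff
    using wishart_opD(1)[OF op_P] wishart_ops_strongly_continuous[OF D_cone op_P] by blast
  moreover have "P t (fexp D u) x = wishart_factor \<alpha> u t * exp (- trace (x ** wishart_flow u t))"
    if "pd u" "0 \<le> t" "x \<in> D" for u t x
    using that wishart_op_fexp[OF op_P[OF that(2)] that(1)]
    by (simp add: fexp_def trace_mul_sym[of x])
  ultimately show ?thesis
    using \<alpha>_nonneg unfolding wishart_semigroup_def wishart_factor_def wishart_flow_def by blast
qed

section \<open>Existence\<close>

subsection \<open>Laws of a single entry\<close>

text \<open>The set \<open>B\<close> lists the linear terms for which the Gaussian formula is required: with noise on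
  one entry of a row, the linear term comes from the other entries of that row.\<close>

definition entry_law :: "real \<Rightarrow> real \<Rightarrow> real \<Rightarrow> real set \<Rightarrow> real measure \<Rightarrow> bool" where
  "entry_law t \<delta> m B M \<longleftrightarrow> prob_space M \<and> sets M = sets borel \<and>
    (\<forall>a\<ge>0. \<forall>b\<in>B. has_bochner_integral M (\<lambda>g. exp (- (a * g\<^sup>2 + 2 * b * g)))
      ((1 + 2 * t * a) powr (- \<delta> / 2) *
        exp (- (a * m\<^sup>2 + 2 * b * m - 2 * t * b\<^sup>2) / (1 + 2 * t * a))))"

lemma normal_density_mult_exp_quadratic:
  fixes t m a b g :: real
  assumes t_pos: "0 < t" and a_nonneg: "0 \<le> a"
  defines "k \<equiv> 1 + 2 * t * a"
  shows "normal_density m (sqrt t) g * exp (- (a * g\<^sup>2 + 2 * b * g)) =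
    k powr (- 1 / 2) * exp (- (a * m\<^sup>2 + 2 * b * m - 2 * t * b\<^sup>2) / k) *
      normal_density ((m - 2 * t * b) / k) (sqrt (t / k)) g"
proof -
  let ?m = "(m - 2 * t * b) / k"
  have k_pos: "0 < k" using t_pos a_nonneg by (simp add: k_def add_pos_nonneg)
  have a_eq: "a = (k - 1) / (2 * t)" using t_pos by (simp add: k_def)
  have square: "- (g - m)\<^sup>2 / (2 * t) - (a * g\<^sup>2 + 2 * b * g)
      = - (a * m\<^sup>2 + 2 * b * m - 2 * t * b\<^sup>2) / k - (g - ?m)\<^sup>2 / (2 * (t / k))"
    unfolding a_eq using t_pos k_pos by (simp add: field_simps power2_eq_square)
  have "sqrt (2 * pi * (t / k)) = sqrt (2 * pi * t) / sqrt k"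
    by (simp flip: real_sqrt_divide)
  then have norming: "1 / sqrt (2 * pi * t) = k powr (- 1 / 2) * (1 / sqrt (2 * pi * (t / k)))"
    using k_pos by (simp add: powr_minus_divide powr_half_sqrt)
  have exp_mult: "x * exp X * exp (- Y) = x * exp (X - Y)" for x X Y :: real
    by (simp add: exp_diff exp_minus divide_inverse)
  have "normal_density m (sqrt t) g * exp (- (a * g\<^sup>2 + 2 * b * g)) =
      1 / sqrt (2 * pi * t) * exp (- (g - m)\<^sup>2 / (2 * t) - (a * g\<^sup>2 + 2 * b * g))"
    unfolding normal_density_def exp_mult using t_pos by simp
  also have "\<dots> = k powr (- 1 / 2) * (1 / sqrt (2 * pi * (t / k))) *
      exp (- (a * m\<^sup>2 + 2 * b * m - 2 * t * b\<^sup>2) / k) * exp (- ((g - ?m)\<^sup>2 / (2 * (t / k))))"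
    unfolding square norming exp_mult ..
  also have "\<dots> = k powr (- 1 / 2) * exp (- (a * m\<^sup>2 + 2 * b * m - 2 * t * b\<^sup>2) / k) *
      normal_density ?m (sqrt (t / k)) g"
    unfolding normal_density_def using t_pos k_pos by simp
  finally show ?thesis .
qed

lemma entry_law_normal:
  assumes t_pos: "0 < t"
  shows "entry_law t 1 m B (density lborel (normal_density m (sqrt t)))"
  unfolding entry_law_def
proof (intro conjI allI impI ballI)
  show "prob_space (density lborel (normal_density m (sqrt t)))"
    using t_pos by (intro prob_space_normal_density) simp
  show "sets (density lborel (normal_density m (sqrt t))) = sets borel" by simp
  fix a b :: real assume a_nonneg: "0 \<le> a"
  let ?k = "1 + 2 * t * a"
  let ?c = "?k powr (- 1 / 2) * exp (- (a * m\<^sup>2 + 2 * b * m - 2 * t * b\<^sup>2) / ?k)"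
  have "0 < t / ?k" using t_pos a_nonneg by (simp add: add_pos_nonneg)
  then have "has_bochner_integral lborel
      (\<lambda>g. ?c * normal_density ((m - 2 * t * b) / ?k) (sqrt (t / ?k)) g) (?c * 1)"
    by (intro has_bochner_integral_mult_right) (simp add: has_bochner_integral_iff)
  then show "has_bochner_integral (density lborel (normal_density m (sqrt t)))
      (\<lambda>g. exp (- (a * g\<^sup>2 + 2 * b * g))) ?c"
    by (intro has_bochner_integral_density)
      (simp_all only: real_scaleR_def normal_density_mult_exp_quadratic[OF t_pos a_nonneg]
          mult_1_right, auto)
qed

text \<open>The law of the square root of a squared Bessel process of dimension \<open>\<delta>\<close> started at \<open>s\<close>.\<close>

definition bessel_law :: "real \<Rightarrow> real \<Rightarrow> real \<Rightarrow> real measure \<Rightarrow> bool" where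
  "bessel_law t \<delta> s M \<longleftrightarrow> sets M = sets borel \<and> (\<forall>a\<ge>0. (\<integral>\<^sup>+g. ennreal (exp (- (a * g\<^sup>2))) \<partial>M)
     = ennreal ((1 + 2 * t * a) powr (- \<delta> / 2) * exp (- (a * s) / (1 + 2 * t * a))))"

lemma bessel_lawD:
  assumes "bessel_law t \<delta> s M"
  shows "sets M = sets borel"
    and "0 \<le> a \<Longrightarrow> (\<integral>\<^sup>+g. ennreal (exp (- (a * g\<^sup>2))) \<partial>M)
     = ennreal ((1 + 2 * t * a) powr (- \<delta> / 2) * exp (- (a * s) / (1 + 2 * t * a)))"
  using assms by (auto simp: bessel_law_def)

lemma bessel_law_prob_space:
  assumes "bessel_law t \<delta> s M"
  shows "prob_space M"
  using bessel_lawD(2)[OF assms, of 0] by (intro prob_spaceI) simp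

lemma entry_law_bessel:
  assumes "bessel_law t \<delta> (m\<^sup>2) M"
  shows "entry_law t \<delta> m {0} M"
  unfolding entry_law_def
proof (intro conjI allI impI ballI bessel_law_prob_space[OF assms] bessel_lawD(1)[OF assms])
  fix a b :: real assume a_nonneg: "0 \<le> a" and "b \<in> {0}"
  then have b_zero: "b = 0" by simp
  have "has_bochner_integral M (\<lambda>g. exp (- (a * g\<^sup>2)))
      ((1 + 2 * t * a) powr (- \<delta> / 2) * exp (- (a * m\<^sup>2) / (1 + 2 * t * a)))"
  proof (rule has_bochner_integral_nn_integral)
    show "(\<lambda>g. exp (- (a * g\<^sup>2))) \<in> borel_measurable M"
      unfolding measurable_cong_sets[OF bessel_lawD(1)[OF assms] refl] by measurable
    show "(\<integral>\<^sup>+g. ennreal (exp (- (a * g\<^sup>2))) \<partial>M) =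
        ennreal ((1 + 2 * t * a) powr (- \<delta> / 2) * exp (- (a * m\<^sup>2) / (1 + 2 * t * a)))"
      by (rule bessel_lawD(2)[OF assms a_nonneg])
  qed simp_all
  then show "has_bochner_integral M (\<lambda>g. exp (- (a * g\<^sup>2 + 2 * b * g)))
      ((1 + 2 * t * a) powr (- \<delta> / 2) *
        exp (- (a * m\<^sup>2 + 2 * b * m - 2 * t * b\<^sup>2) / (1 + 2 * t * a)))"
    by (simp add: b_zero)
qed

lemma bessel_law_return:
  assumes t_pos: "0 < t"
  shows "bessel_law t 0 0 (return borel 0)"
  unfolding bessel_law_def
proof (intro conjI allI impI)
  fix a :: real assume "0 \<le> a"
  then have "1 + 2 * t * a \<noteq> 0" using t_pos by (smt (verit) mult_nonneg_nonneg)
  then show "(\<integral>\<^sup>+g. ennreal (exp (- (a * g\<^sup>2))) \<partial>return borel 0) =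
     ennreal ((1 + 2 * t * a) powr (- 0 / 2) * exp (- (a * 0) / (1 + 2 * t * a)))"
    by (subst nn_integral_return) auto
qed simp

definition gamma_density :: "real \<Rightarrow> real \<Rightarrow> real \<Rightarrow> real" where
  "gamma_density \<beta> c x = c powr \<beta> / Gamma \<beta> * (indicator {0..} x * x powr (\<beta> - 1) * exp (- (c * x)))"

lemma borel_measurable_gamma_density [measurable]: "gamma_density \<beta> c \<in> borel_measurable borel"
  unfolding gamma_density_def by measurable

lemma nn_integral_powr_exp:
  assumes \<beta>_pos: "0 < \<beta>" and c_pos: "0 < c"
  shows "(\<integral>\<^sup>+x. ennreal (indicator {0..} x * x powr (\<beta> - 1) * exp (- (c * x))) \<partial>lborel)
    = ennreal (Gamma \<beta> / c powr \<beta>)" (is "?I = _")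
proof -
  have "ennreal (Gamma \<beta>) = ennreal c * (\<integral>\<^sup>+x. ennreal (indicator {0..} (0 + c * x) *
      (0 + c * x) powr (\<beta> - 1) / exp (0 + c * x)) \<partial>lborel)"
    unfolding Gamma_conv_nn_integral_real[OF \<beta>_pos]
    by (subst nn_integral_real_affine[where c = c and t = 0]) (use c_pos in auto)
  also have "(\<integral>\<^sup>+x. ennreal (indicator {0..} (0 + c * x) *
      (0 + c * x) powr (\<beta> - 1) / exp (0 + c * x)) \<partial>lborel)
      = (\<integral>\<^sup>+x. ennreal (c powr (\<beta> - 1)) *
          ennreal (indicator {0..} x * x powr (\<beta> - 1) * exp (- (c * x))) \<partial>lborel)"
    using c_pos by (intro nn_integral_cong)
      (auto simp: ennreal_mult[symmetric] indicator_def powr_mult exp_minus zero_le_mult_iff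
          field_simps)
  also have "\<dots> = ennreal (c powr (\<beta> - 1)) * ?I" by (rule nn_integral_cmult) measurable
  also have "ennreal c * (ennreal (c powr (\<beta> - 1)) * ?I) = ennreal (c powr \<beta>) * ?I"
    using c_pos by (simp add: mult.assoc[symmetric] ennreal_mult[symmetric] powr_diff)
  finally have "ennreal (1 / c powr \<beta>) * ennreal (Gamma \<beta>) =
      ennreal (1 / c powr \<beta>) * (ennreal (c powr \<beta>) * ?I)" by simp
  also have "\<dots> = ?I" using c_pos by (simp add: mult.assoc[symmetric] ennreal_mult[symmetric])
  finally show ?thesis using c_pos \<beta>_pos by (simp add: ennreal_mult[symmetric] Gamma_real_nonneg)
qed

lemma nn_integral_gamma_density_exp:
  assumes \<beta>_pos: "0 < \<beta>" and c_pos: "0 < c" and a_nonneg: "0 \<le> a"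
  shows "(\<integral>\<^sup>+x. ennreal (gamma_density \<beta> c x) * ennreal (exp (- (a * x))) \<partial>lborel)
    = ennreal ((c / (c + a)) powr \<beta>)"
proof -
  have Gamma_pos: "0 < Gamma \<beta>" using \<beta>_pos by (rule Gamma_real_pos)
  have "ennreal (gamma_density \<beta> c x) * ennreal (exp (- (a * x))) = ennreal (c powr \<beta> / Gamma \<beta>) *
      ennreal (indicator {0..} x * x powr (\<beta> - 1) * exp (- ((c + a) * x)))" for x
    using Gamma_pos
    by (simp add: gamma_density_def ennreal_mult[symmetric] distrib_right exp_diff exp_minus
        divide_inverse mult.assoc)
  then have "(\<integral>\<^sup>+x. ennreal (gamma_density \<beta> c x) * ennreal (exp (- (a * x))) \<partial>lborel) =
      ennreal (c powr \<beta> / Gamma \<beta>) *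
      (\<integral>\<^sup>+x. ennreal (indicator {0..} x * x powr (\<beta> - 1) * exp (- ((c + a) * x))) \<partial>lborel)"
    by (simp only:) (rule nn_integral_cmult, measurable)
  also have "\<dots> = ennreal (c powr \<beta> / Gamma \<beta>) * ennreal (Gamma \<beta> / (c + a) powr \<beta>)"
    using c_pos a_nonneg by (simp only: nn_integral_powr_exp[OF \<beta>_pos] add_pos_nonneg)
  also have "\<dots> = ennreal ((c / (c + a)) powr \<beta>)"
    using Gamma_pos c_pos a_nonneg by (simp add: ennreal_mult[symmetric] powr_divide)
  finally show ?thesis .
qed

lemma bessel_law_from_zero:
  assumes t_pos: "0 < t" and \<delta>_nonneg: "0 \<le> \<delta>"
  shows "\<exists>M. bessel_law t \<delta> 0 M"
proof (cases "\<delta> = 0")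
  case True
  then show ?thesis using bessel_law_return[OF t_pos] by auto
next
  case False
  let ?gamma = "gamma_density (\<delta> / 2) (1 / (2 * t))"
  let ?M = "distr (density lborel (\<lambda>x. ennreal (?gamma x))) borel sqrt"
  have "bessel_law t \<delta> 0 ?M"
    unfolding bessel_law_def
  proof (intro conjI allI impI)
    fix a :: real assume a_nonneg: "0 \<le> a"
    have "ennreal (?gamma x) * ennreal (exp (- (a * (sqrt x)\<^sup>2))) =
        ennreal (?gamma x) * ennreal (exp (- (a * x)))" for x
      by (cases "0 \<le> x") (simp_all add: gamma_density_def)
    then have "(\<integral>\<^sup>+g. ennreal (exp (- (a * g\<^sup>2))) \<partial>?M) =
        (\<integral>\<^sup>+x. ennreal (?gamma x) * ennreal (exp (- (a * x))) \<partial>lborel)"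
      by (simp add: nn_integral_distr nn_integral_density)
    also have "\<dots> = ennreal ((1 / (2 * t) / (1 / (2 * t) + a)) powr (\<delta> / 2))"
      using False \<delta>_nonneg t_pos a_nonneg by (intro nn_integral_gamma_density_exp) auto
    also have "1 / (2 * t) / (1 / (2 * t) + a) = inverse (1 + 2 * t * a)"
      using t_pos a_nonneg by (simp add: field_simps add_pos_nonneg)
    also have "inverse (1 + 2 * t * a) powr (\<delta> / 2) = (1 + 2 * t * a) powr (- \<delta> / 2)"
      using t_pos a_nonneg by (simp add: powr_minus inverse_powr)
    finally show "(\<integral>\<^sup>+g. ennreal (exp (- (a * g\<^sup>2))) \<partial>?M) =
       ennreal ((1 + 2 * t * a) powr (- \<delta> / 2) * exp (- (a * 0) / (1 + 2 * t * a)))" by simp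
  qed simp
  then show ?thesis by blast
qed

lemma nn_integral_poisson_powr:
  assumes r_pos: "0 < r" and k_pos: "0 < k"
  shows "(\<integral>\<^sup>+n. ennreal (k powr (- (\<delta> + 2 * real n) / 2)) \<partial>measure_pmf (poisson_pmf r))
    = ennreal (k powr (- \<delta> / 2) * exp (r / k - r))"
proof -
  have "pmf (poisson_pmf r) n * k powr (- (\<delta> + 2 * real n) / 2) =
      k powr (- \<delta> / 2) * exp (- r) * ((r / k) ^ n /\<^sub>R fact n)" for n
  proof -
    have "k powr (- (\<delta> + 2 * real n) / 2) = k powr (- \<delta> / 2 + - real n)"
      by (rule arg_cong[of _ _ "(powr) k"]) (simp add: field_simps)
    also have "\<dots> = k powr (- \<delta> / 2) * (1 / k ^ n)"
      unfolding powr_add using k_pos by (simp add: powr_minus_divide powr_realpow)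
    finally show ?thesis using r_pos k_pos by (simp add: power_divide field_simps)
  qed
  then have "(\<integral>\<^sup>+n. ennreal (k powr (- (\<delta> + 2 * real n) / 2)) \<partial>measure_pmf (poisson_pmf r)) =
      (\<Sum>n. ennreal (k powr (- \<delta> / 2) * exp (- r) * ((r / k) ^ n /\<^sub>R fact n)))"
    unfolding nn_integral_measure_pmf nn_integral_count_space_nat
    by (simp add: ennreal_mult[symmetric])
  also have "\<dots> = ennreal (k powr (- \<delta> / 2) * exp (- r) * exp (r / k))"
    using r_pos k_pos by (intro suminf_ennreal_eq sums_mult exp_converges) auto
  finally show ?thesis by (simp add: mult.assoc mult_exp_exp)
qed

(* A squared Bessel process started at s > 0 is, at time t, a Poisson mixture of squared Bessel
   processes of dimensions \<delta> + 2 n started at 0. *)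
lemma bessel_law_exists:
  assumes t_pos: "0 < t" and \<delta>_nonneg: "0 \<le> \<delta>" and s_nonneg: "0 \<le> s"
  shows "\<exists>M. bessel_law t \<delta> s M"
proof (cases "s = 0")
  case True
  then show ?thesis using bessel_law_from_zero[OF t_pos \<delta>_nonneg] by simp
next
  case False
  define r where "r = s / (2 * t)"
  have r_pos: "0 < r" using False s_nonneg t_pos by (simp add: r_def)
  have "\<exists>M. bessel_law t (\<delta> + 2 * real n) 0 M" for n
    using t_pos \<delta>_nonneg by (intro bessel_law_from_zero) auto
  then obtain N where law_N: "\<And>n::nat. bessel_law t (\<delta> + 2 * real n) 0 (N n)" by metis
  have kernel: "N \<in> measurable (measure_pmf (poisson_pmf r)) (subprob_algebra borel)"
    using bessel_lawD(1)[OF law_N] prob_space_imp_subprob_space[OF bessel_law_prob_space[OF law_N]]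
    by (simp add: measurable_def space_subprob_algebra)
  let ?M = "measure_pmf (poisson_pmf r) \<bind> N"
  have "bessel_law t \<delta> s ?M"
    unfolding bessel_law_def
  proof (intro conjI allI impI)
    show "sets ?M = sets borel"
      by (rule sets_bind[where N = borel]) (use bessel_lawD(1)[OF law_N] in auto)
    fix a :: real assume a_nonneg: "0 \<le> a"
    define k where "k = 1 + 2 * t * a"
    have k_pos: "0 < k" using t_pos a_nonneg by (simp add: k_def add_pos_nonneg)
    have "(\<integral>\<^sup>+g. ennreal (exp (- (a * g\<^sup>2))) \<partial>?M) =
        (\<integral>\<^sup>+n. \<integral>\<^sup>+g. ennreal (exp (- (a * g\<^sup>2))) \<partial>N n \<partial>measure_pmf (poisson_pmf r))"
      by (rule nn_integral_bind[OF _ kernel]) measurable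
    also have "\<dots> = (\<integral>\<^sup>+n. ennreal (k powr (- (\<delta> + 2 * real n) / 2)) \<partial>measure_pmf (poisson_pmf r))"
      using bessel_lawD(2)[OF law_N a_nonneg] by (intro nn_integral_cong) (simp add: k_def)
    also have "\<dots> = ennreal (k powr (- \<delta> / 2) * exp (r / k - r))"
      by (rule nn_integral_poisson_powr[OF r_pos k_pos])
    also have "r / k - r = - (a * s) / k"
      using t_pos k_pos by (simp add: r_def field_simps) (simp add: k_def algebra_simps)
    finally show "(\<integral>\<^sup>+g. ennreal (exp (- (a * g\<^sup>2))) \<partial>?M) =
       ennreal ((1 + 2 * t * a) powr (- \<delta> / 2) * exp (- (a * s) / (1 + 2 * t * a)))"
      by (simp add: k_def)
  qed
  then show ?thesis by blast
qed

subsection \<open>Moving one column of a factor\<close>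

definition replace_column :: "real^'n^'m \<Rightarrow> 'n \<Rightarrow> ('m \<Rightarrow> real) \<Rightarrow> real^'n^'m" where
  "replace_column W i \<omega> = (\<chi> l j. if j = i then \<omega> l else W $ l $ j)"

definition coordinate_flow :: "real^'n^'n \<Rightarrow> real \<Rightarrow> 'n \<Rightarrow> real^'n^'n" where
  "coordinate_flow u t i = u - (2 * t / (1 + 2 * t * u $ i $ i)) *\<^sub>R outer (u *v axis i 1)"

definition has_coordinate_kernel :: "(real^'n^'n) set \<Rightarrow> real \<Rightarrow> real \<Rightarrow> 'n \<Rightarrow> real^'n^'n \<Rightarrow> bool" where
  "has_coordinate_kernel D \<alpha> t i x \<longleftrightarrow>
    (\<exists>N. prob_space N \<and> sets N = sets borel \<and> (AE y in N. y \<in> D) \<and>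
      (\<forall>u. pd u \<longrightarrow> (\<integral>y. exp (- (u \<bullet> y)) \<partial>N) =
        (1 + 2 * t * u $ i $ i) powr (- \<alpha> / 2) * exp (- (coordinate_flow u t i \<bullet> x))))"

lemma matrix_inv_add_outer_axis:
  assumes "pd w" "0 \<le> t"
  shows "matrix_inv (w + (2 * t) *\<^sub>R outer (axis i 1)) = coordinate_flow (matrix_inv w) t i"
  using matrix_inv_add_outer[OF assms(1), of "2 * t" "axis i 1"] assms(2)
  by (simp add: coordinate_flow_def inner_axis_mult_axis)

lemma pd_coordinate_flow:
  assumes "pd u" "0 \<le> t"
  shows "pd (coordinate_flow u t i)"
proof -
  have "pd (matrix_inv u + (2 * t) *\<^sub>R outer (axis i 1))"
    using assms by (intro pd_add_psd pd_matrix_inv psd_scaleR psd_outer) auto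
  from pd_matrix_inv[OF this] show ?thesis
    by (simp add: matrix_inv_add_outer_axis[OF pd_matrix_inv[OF assms(1)] assms(2)]
        matrix_inv_matrix_inv[OF assms(1)])
qed

lemma quadratic_form_add_axis:
  fixes u :: "real^'n^'n"
  assumes "transpose u = u"
  shows "(c + g *\<^sub>R axis i 1) \<bullet> (u *v (c + g *\<^sub>R axis i 1)) =
    c \<bullet> (u *v c) + (u $ i $ i * g\<^sup>2 + 2 * (axis i 1 \<bullet> (u *v c)) * g)"
  using sym_inner[OF assms, of c "axis i 1"]
  by (simp add: inner_add_left inner_add_right matrix_vector_right_distrib matrix_vector_mult_scaleR
      inner_axis_mult_axis power2_eq_square algebra_simps)

lemma coordinate_flow_inner_outer:
  fixes u :: "real^'n^'n" and c :: "real^'n" and i :: 'n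
  assumes pd_u: "pd u" and t_pos: "0 < t"
  defines "a \<equiv> u $ i $ i"
  defines "b \<equiv> axis i 1 \<bullet> (u *v c)"
  shows "coordinate_flow u t i \<bullet> outer (c + m *\<^sub>R axis i 1) =
    c \<bullet> (u *v c) + (a * m\<^sup>2 + 2 * b * m - 2 * t * b\<^sup>2) / (1 + 2 * t * a)"
proof -
  let ?e = "axis i 1 :: real^'n"
  define k where "k = 1 + 2 * t * a"
  have "0 \<le> a" unfolding a_def by (rule psd_diag_nonneg[OF pd_imp_psd[OF pd_u]])
  then have k_pos: "0 < k" using t_pos by (simp add: k_def add_pos_nonneg)
  have linear: "(u *v ?e) \<bullet> (c + m *\<^sub>R ?e) = b + a * m"
    using sym_inner[OF pdD(1)[OF pd_u], of c ?e]
    by (simp add: inner_add_right inner_commute[of "u *v ?e"] inner_axis_mult_axis a_def b_def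
        mult.commute)
  have "coordinate_flow u t i \<bullet> outer v = v \<bullet> (u *v v) - (2 * t / k) * ((u *v ?e) \<bullet> v)\<^sup>2" for v
    by (simp add: coordinate_flow_def a_def[symmetric] k_def[symmetric] inner_outer outer_mult_vec
        matrix_vector_mult_diff_rdistrib scaleR_matrix_vector_assoc[symmetric] inner_diff_right
        power2_eq_square inner_commute[of v "u *v ?e"])
  then have "coordinate_flow u t i \<bullet> outer (c + m *\<^sub>R ?e) =
      c \<bullet> (u *v c) + (a * m\<^sup>2 + 2 * b * m) - (2 * t / k) * (b + a * m)\<^sup>2"
    by (simp only: quadratic_form_add_axis[OF pdD(1)[OF pd_u]] linear a_def b_def)
  also have "\<dots> = c \<bullet> (u *v c) + (a * m\<^sup>2 + 2 * b * m - 2 * t * b\<^sup>2) / k"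
    using k_pos by (simp add: field_simps) (simp add: k_def power2_eq_square algebra_simps)
  finally show ?thesis by (simp add: k_def)
qed

lemma borel_measurable_gram_replace_column:
  fixes W :: "real^'n^'m"
  assumes "\<And>l. sets (M l) = sets borel"
  shows "(\<lambda>\<omega>. gram (replace_column W i \<omega>)) \<in> borel_measurable (PiM UNIV M)"
proof -
  have "sets (PiM UNIV M) = sets (PiM UNIV (\<lambda>_. borel))"
    by (rule sets_PiM_cong) (simp_all add: assms)
  then have "sets (PiM UNIV M) = sets borel" by (simp add: sets_PiM_equal_borel)
  moreover have "continuous_on UNIV (replace_column W i)"
    unfolding replace_column_def
  proof (intro continuous_on_vec_lambda)
    show "continuous_on UNIV (\<lambda>\<omega>. if j = i then \<omega> l else W $ l $ j)" for l j
      by (cases "j = i") (simp_all add: continuous_on_product_coordinates)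
  qed
  then have "(\<lambda>\<omega>. gram (replace_column W i \<omega>)) \<in> borel_measurable borel"
    by (intro borel_measurable_continuous_onI continuous_on_compose2[OF continuous_on_gram]) auto
  ultimately show ?thesis using measurable_cong_sets by blast
qed

lemma has_bochner_integral_exp_row:
  fixes u :: "real^'n^'n" and c :: "real^'n" and i :: 'n
  assumes t_pos: "0 < t" and pd_u: "pd u" and law_M: "entry_law t \<delta> m B M"
    and linear: "axis i 1 \<bullet> (u *v c) \<in> B"
  shows "has_bochner_integral M (\<lambda>g. exp (- ((c + g *\<^sub>R axis i 1) \<bullet> (u *v (c + g *\<^sub>R axis i 1)))))
    ((1 + 2 * t * u $ i $ i) powr (- \<delta> / 2) *
      exp (- (coordinate_flow u t i \<bullet> outer (c + m *\<^sub>R axis i 1))))"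
proof -
  define a where "a = u $ i $ i"
  define b where "b = axis i 1 \<bullet> (u *v c)"
  define K where "K = exp (- (c \<bullet> (u *v c)))"
  have "0 \<le> a" unfolding a_def by (rule psd_diag_nonneg[OF pd_imp_psd[OF pd_u]])
  then have "has_bochner_integral M (\<lambda>g. K * exp (- (a * g\<^sup>2 + 2 * b * g)))
      (K * ((1 + 2 * t * a) powr (- \<delta> / 2) *
        exp (- (a * m\<^sup>2 + 2 * b * m - 2 * t * b\<^sup>2) / (1 + 2 * t * a))))"
    using law_M linear by (intro has_bochner_integral_mult_right) (auto simp: entry_law_def b_def)
  moreover have "exp (- (c \<bullet> (u *v c) + y)) = K * exp (- y)" for y
    by (simp add: K_def mult_exp_exp)
  ultimately show ?thesis
    unfolding quadratic_form_add_axis[OF pdD(1)[OF pd_u]] coordinate_flow_inner_outer[OF pd_u t_pos]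
    by (simp only: a_def b_def minus_divide_left mult.left_commute)
qed

lemma integral_exp_gram_replace_column:
  fixes W :: "real^'n^'m" and u :: "real^'n^'n"
  assumes t_pos: "0 < t" and pd_u: "pd u"
    and law_M: "\<And>l. entry_law t (\<delta> l) (W $ l $ i) (B l) (M l)"
    and linear_terms: "\<And>l. B l = UNIV \<or> 0 \<in> B l \<and> (\<forall>j. j \<noteq> i \<longrightarrow> W $ l $ j = 0)"
  shows "(\<integral>\<omega>. exp (- (u \<bullet> gram (replace_column W i \<omega>))) \<partial>PiM UNIV M) =
    (1 + 2 * t * u $ i $ i) powr (- (\<Sum>l\<in>UNIV. \<delta> l) / 2) * exp (- (coordinate_flow u t i \<bullet> gram W))"
proof -
  let ?e = "axis i 1 :: real^'n"
  define k where "k = 1 + 2 * t * u $ i $ i"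
  define c where "c l = W $ l - (W $ l $ i) *\<^sub>R ?e" for l
  have "0 \<le> u $ i $ i" by (rule psd_diag_nonneg[OF pd_imp_psd[OF pd_u]])
  then have k_pos: "0 < k" using t_pos by (simp add: k_def add_pos_nonneg)
  interpret product_prob_space M UNIV
    using law_M by (intro product_prob_spaceI) (auto simp: entry_law_def)
  have "axis i 1 \<bullet> (u *v c l) \<in> B l" for l
  proof -
    have "c l = 0" if "\<forall>j. j \<noteq> i \<longrightarrow> W $ l $ j = 0"
      using that by (auto simp: c_def vec_eq_iff axis_def)
    then show ?thesis using linear_terms[of l] by auto
  qed
  from has_bochner_integral_exp_row[OF t_pos pd_u law_M this]
  have row_integral:
    "has_bochner_integral (M l) (\<lambda>g. exp (- ((c l + g *\<^sub>R ?e) \<bullet> (u *v (c l + g *\<^sub>R ?e)))))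
      (k powr (- \<delta> l / 2) * exp (- (coordinate_flow u t i \<bullet> outer (W $ l))))" for l
    by (simp add: c_def k_def)
  have row_eq: "replace_column W i \<omega> $ l = c l + \<omega> l *\<^sub>R ?e" for \<omega> l
    by (auto simp: replace_column_def c_def vec_eq_iff axis_def)
  have "(\<integral>\<omega>. exp (- (u \<bullet> gram (replace_column W i \<omega>))) \<partial>PiM UNIV M) =
      (\<integral>\<omega>. (\<Prod>l\<in>UNIV. exp (- ((c l + \<omega> l *\<^sub>R ?e) \<bullet> (u *v (c l + \<omega> l *\<^sub>R ?e))))) \<partial>PiM UNIV M)"
    by (simp add: inner_gram row_eq exp_sum flip: sum_negf)
  also have "\<dots> = (\<Prod>l\<in>UNIV. \<integral>g. exp (- ((c l + g *\<^sub>R ?e) \<bullet> (u *v (c l + g *\<^sub>R ?e)))) \<partial>M l)"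
    using row_integral by (intro product_integral_prod) (auto simp: has_bochner_integral_iff)
  also have "\<dots> = (\<Prod>l\<in>UNIV. k powr (- \<delta> l / 2) * exp (- (coordinate_flow u t i \<bullet> outer (W $ l))))"
    using row_integral by (intro prod.cong refl) (simp add: has_bochner_integral_iff)
  also have "\<dots> = (\<Prod>l\<in>UNIV. k powr (- \<delta> l / 2)) * exp (- (coordinate_flow u t i \<bullet> gram W))"
    by (simp add: prod.distrib exp_sum[symmetric] gram_def inner_sum_right sum_negf)
  also have "(\<Prod>l\<in>UNIV. k powr (- \<delta> l / 2)) = k powr (- (\<Sum>l\<in>UNIV. \<delta> l) / 2)"
    using k_pos by (subst powr_sum[symmetric]) (auto simp: sum_negf[symmetric] sum_divide_distrib)
  finally show ?thesis by (simp add: k_def)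
qed

lemma has_coordinate_kernel_gram:
  fixes W :: "real^'n^'m"
  assumes t_pos: "0 < t" and law_M: "\<And>l. entry_law t (\<delta> l) (W $ l $ i) (B l) (M l)"
    and linear_terms: "\<And>l. B l = UNIV \<or> 0 \<in> B l \<and> (\<forall>j. j \<noteq> i \<longrightarrow> W $ l $ j = 0)"
    and closed_D: "closed D" and AE_in_D: "AE \<omega> in PiM UNIV M. gram (replace_column W i \<omega>) \<in> D"
  shows "has_coordinate_kernel D (\<Sum>l\<in>UNIV. \<delta> l) t i (gram W)"
proof -
  let ?Y = "\<lambda>\<omega>. gram (replace_column W i \<omega>)"
  have M_prob: "prob_space (M l)" and M_sets: "sets (M l) = sets borel" for l
    using law_M[of l] by (auto simp: entry_law_def)
  interpret P: prob_space "PiM UNIV M" by (rule prob_space_PiM[OF M_prob])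
  have measurable_Y: "?Y \<in> borel_measurable (PiM UNIV M)"
    by (rule borel_measurable_gram_replace_column[OF M_sets])
  show ?thesis
    unfolding has_coordinate_kernel_def
  proof (intro exI[of _ "distr (PiM UNIV M) borel ?Y"] conjI allI impI)
    show "prob_space (distr (PiM UNIV M) borel ?Y)" by (rule P.prob_space_distr[OF measurable_Y])
    show "AE y in distr (PiM UNIV M) borel ?Y. y \<in> D"
      using AE_in_D closed_D by (subst AE_distr_iff[OF measurable_Y]) (auto simp: borel_closed)
    fix u :: "real^'n^'n" assume pd_u: "pd u"
    have "(\<integral>y. exp (- (u \<bullet> y)) \<partial>distr (PiM UNIV M) borel ?Y) = (\<integral>\<omega>. exp (- (u \<bullet> ?Y \<omega>)) \<partial>PiM UNIV M)"
      by (rule integral_distr[OF measurable_Y]) measurable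
    then show "(\<integral>y. exp (- (u \<bullet> y)) \<partial>distr (PiM UNIV M) borel ?Y) =
        (1 + 2 * t * u $ i $ i) powr (- (\<Sum>l\<in>UNIV. \<delta> l) / 2) *
        exp (- (coordinate_flow u t i \<bullet> gram W))"
      by (simp add: integral_exp_gram_replace_column[OF t_pos pd_u law_M linear_terms])
  qed simp
qed

lemma wishart_op_if_coordinate_kernels:
  fixes D :: "(real^'n^'n) set"
  assumes D_cone: "closed D" "D \<subseteq> Collect psd" and t_nonneg: "0 \<le> t"
    and kernel: "\<And>x. x \<in> D \<Longrightarrow> has_coordinate_kernel D \<alpha> t i x"
  shows "\<exists>Q. wishart_op D \<alpha> ((2 * t) *\<^sub>R outer (axis i 1)) Q"
proof -
  obtain M where
    kernel_M: "\<And>x. x \<in> D \<Longrightarrow> prob_space (M x) \<and> sets (M x) = sets borel \<and> (AE y in M x. y \<in> D)"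
    and laplace: "\<And>x u. x \<in> D \<Longrightarrow> pd u \<Longrightarrow> (\<integral>y. exp (- (u \<bullet> y)) \<partial>M x) =
      (1 + 2 * t * u $ i $ i) powr (- \<alpha> / 2) * exp (- (coordinate_flow u t i \<bullet> x))"
    using kernel unfolding has_coordinate_kernel_def by metis
  have "markov_kernel D M" using kernel_M by (simp add: markov_kernel_def)
  note markov = markov_kernelD[OF this]
  have fexp: "kernel_op D M (fexp D u) =
      (\<lambda>x. (1 + 2 * t * u $ i $ i) powr (- \<alpha> / 2) * fexp D (coordinate_flow u t i) x)"
    if pd_u: "pd u" for u
  proof
    fix x
    have "(\<integral>y. fexp D u y \<partial>M x) = (\<integral>y. exp (- (u \<bullet> y)) \<partial>M x)" if x_in_D: "x \<in> D"
    proof (rule integral_cong_AE)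
      note measurable_cong_sets[OF markov(2)[OF x_in_D] refl, simp]
      show "fexp D u \<in> borel_measurable (M x)"
        by (simp add: C0_borel_measurable[OF D_cone(1) fexp_in_C0[OF D_cone(2) pd_u]])
      show "(\<lambda>y. exp (- (u \<bullet> y))) \<in> borel_measurable (M x)" by simp
      show "AE y in M x. fexp D u y = exp (- (u \<bullet> y))"
        using markov(3)[OF x_in_D] by eventually_elim (simp add: fexp_eq[OF D_cone(2)])
    qed
    then show "kernel_op D M (fexp D u) x =
        (1 + 2 * t * u $ i $ i) powr (- \<alpha> / 2) * fexp D (coordinate_flow u t i) x"
      using laplace[OF _ pd_u] by (simp add: kernel_op_def fexp_eq[OF D_cone(2)])
  qed
  have "pos_contraction D (kernel_op D M)"
  proof (rule pos_contraction_kernel_op[OF D_cone \<open>markov_kernel D M\<close>])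
    show "kernel_op D M (fexp D u) \<in> C0 D" if "pd u" for u
      unfolding fexp[OF that] by (intro C0_scale fexp_in_C0 D_cone pd_coordinate_flow that t_nonneg)
  qed
  moreover have "kernel_op D M (fexp D (matrix_inv w)) =
      (\<lambda>x. (det (w + (2 * t) *\<^sub>R outer (axis i 1)) / det w) powr (- \<alpha> / 2) *
        fexp D (matrix_inv (w + (2 * t) *\<^sub>R outer (axis i 1))) x)" if pd_w: "pd w" for w
    using fexp[OF pd_matrix_inv[OF pd_w]] matrix_inv_add_outer_axis[OF pd_w t_nonneg]
      det_add_outer_axis[OF pd_w, of "2 * t" i] pd_det_pos[OF pd_w] by simp
  ultimately show ?thesis unfolding wishart_op_def by blast
qed

lemma wishart_semigroup_if_coordinate_kernels:
  fixes D :: "(real^'n^'n) set"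
  assumes D_cone: "closed D" "D \<subseteq> Collect psd" and \<alpha>_nonneg: "0 \<le> \<alpha>"
    and kernel: "\<And>x t i. x \<in> D \<Longrightarrow> 0 < t \<Longrightarrow> has_coordinate_kernel D \<alpha> t i x"
  shows "\<exists>P. wishart_semigroup D \<alpha> P"
proof (rule wishart_semigroup_if_ops[OF D_cone \<alpha>_nonneg])
  fix t :: real assume t_nonneg: "0 \<le> t"
  show "\<exists>Q. wishart_op D \<alpha> ((2 * t) *\<^sub>R mat 1) Q"
  proof (cases "t = 0")
    case True
    then show ?thesis using wishart_op_id[of D \<alpha>] by auto
  next
    case False
    then have "0 < t" using t_nonneg by simp
    then show ?thesis
      by (intro wishart_op_from_coordinates[OF D_cone(2)]
          wishart_op_if_coordinate_kernels[OF D_cone] kernel) auto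
  qed
qed

subsection \<open>The two cases\<close>

theorem wishart_semigroup_low_rank:
  assumes k_le: "k \<le> CARD('n::finite)"
  shows "\<exists>P. wishart_semigroup (Dpk k :: (real^'n^'n) set) (real k) P"
proof (rule wishart_semigroup_if_coordinate_kernels[OF closed_Dpk[OF k_le] Dpk_subset_psd])
  obtain K :: "'n set" where card_K: "card K = k"
    using obtain_subset_with_card_n[OF k_le] by metis
  note Dpk_eq = Dpk_eq_gram_image[of K, unfolded card_K]
  fix x :: "real^'n^'n" and t :: real and i :: 'n
  assume "x \<in> Dpk k" and t_pos: "0 < t"
  then obtain W :: "real^'n^'n" where W_support: "\<And>l. l \<notin> K \<Longrightarrow> W $ l = 0" and x_eq_gram: "x = gram W"
    unfolding Dpk_eq by blast
  define M where "M l = (if l \<in> K then density lborel (normal_density (W $ l $ i) (sqrt t))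
    else return borel 0)" for l
  define B where "B l = (if l \<in> K then UNIV else {0 :: real})" for l
  have law_M: "entry_law t (of_bool (l \<in> K)) (W $ l $ i) (B l) (M l)" for l
    using entry_law_normal[OF t_pos] entry_law_bessel[of t 0 0] bessel_law_return[OF t_pos]
      W_support[of l]
    by (auto simp: M_def B_def)
  have "AE \<omega> in PiM UNIV M. \<forall>l\<in>-K. \<omega> l = 0"
  proof (rule AE_finite_allI)
    fix l assume "l \<in> - K"
    then have "M l = return borel 0" by (simp add: M_def)
    then have "AE g in M l. g = 0" by (simp only:) (subst AE_return, auto)
    then show "AE \<omega> in PiM UNIV M. \<omega> l = 0"
      using law_M by (intro AE_PiM_component) (auto simp: entry_law_def)
  qed simp
  then have "AE \<omega> in PiM UNIV M. gram (replace_column W i \<omega>) \<in> Dpk k"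
  proof eventually_elim
    case (elim \<omega>)
    then have "replace_column W i \<omega> $ l = 0" if "l \<notin> K" for l
      using W_support that by (auto simp: replace_column_def vec_eq_iff)
    then show ?case unfolding Dpk_eq by blast
  qed
  moreover have "B l = UNIV \<or> 0 \<in> B l \<and> (\<forall>j. j \<noteq> i \<longrightarrow> W $ l $ j = 0)" for l
    using W_support by (auto simp: B_def)
  ultimately have "has_coordinate_kernel (Dpk k) (\<Sum>l\<in>UNIV. of_bool (l \<in> K)) t i (gram W)"
    by (intro has_coordinate_kernel_gram[OF t_pos law_M] closed_Dpk k_le)
  then show "has_coordinate_kernel (Dpk k) (real k) t i x"
    by (simp add: x_eq_gram card_K sum_of_bool_eq)
qed simp

theorem wishart_semigroup_full_rank:
  assumes \<alpha>_ge: "real CARD('n::finite) - 1 \<le> \<alpha>"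
  shows "\<exists>P. wishart_semigroup (Dpk CARD('n) :: (real^'n^'n) set) \<alpha> P"
proof (rule wishart_semigroup_if_coordinate_kernels[OF closed_Dpk[OF order_refl] Dpk_subset_psd])
  have "1 \<le> real CARD('n)" by (simp add: Suc_leI)
  then show "0 \<le> \<alpha>" using \<alpha>_ge by linarith
  fix x :: "real^'n^'n" and t :: real and i :: 'n
  assume "x \<in> Dpk CARD('n)" and t_pos: "0 < t"
  then have "psd x" by (simp add: Dpk_def)
  then obtain W :: "real^'n^'n" where x_eq_gram: "x = gram W"
    and W_support: "\<And>j. j \<noteq> i \<Longrightarrow> W $ i $ j = 0"
    using psd_gram_axis_row by blast
  define \<delta> where "\<delta> l = (if l = i then \<alpha> - (real CARD('n) - 1) else 1)" for l
  define B where "B l = (if l = i then {0 :: real} else UNIV)" for l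
  obtain N where law_N: "bessel_law t (\<delta> i) ((W $ i $ i)\<^sup>2) N"
    using bessel_law_exists[OF t_pos, of "\<delta> i" "(W $ i $ i)\<^sup>2"] \<alpha>_ge by (auto simp: \<delta>_def)
  define M where "M l = (if l = i then N else density lborel (normal_density (W $ l $ i) (sqrt t)))"
    for l
  have "entry_law t (\<delta> l) (W $ l $ i) (B l) (M l)" for l
    using entry_law_normal[OF t_pos] entry_law_bessel[OF law_N] by (auto simp: M_def \<delta>_def B_def)
  moreover have "B l = UNIV \<or> 0 \<in> B l \<and> (\<forall>j. j \<noteq> i \<longrightarrow> W $ l $ j = 0)" for l
    using W_support by (auto simp: B_def)
  moreover have "AE \<omega> in PiM UNIV M. gram (replace_column W i \<omega>) \<in> Dpk CARD('n)"
    by (simp add: Dpk_card psd_gram)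
  ultimately have "has_coordinate_kernel (Dpk CARD('n)) (\<Sum>l\<in>UNIV. \<delta> l) t i (gram W)"
    by (intro has_coordinate_kernel_gram[OF t_pos] closed_Dpk order_refl)
  moreover have "(\<Sum>l\<in>UNIV. \<delta> l) = \<alpha>"
  proof -
    have "(\<Sum>l\<in>UNIV - {i}. \<delta> l) = (\<Sum>l\<in>UNIV - {i}. 1)" by (rule sum.cong) (auto simp: \<delta>_def)
    then show ?thesis
      by (simp add: sum.remove[of UNIV i] \<delta>_def card_Diff_singleton Suc_leI of_nat_diff)
  qed
  ultimately show "has_coordinate_kernel (Dpk CARD('n)) \<alpha> t i x" by (simp add: x_eq_gram)
qed

section \<open>Generators of contraction semigroups\<close>

lemma semigroupD:
  assumes "pos_sc_contraction_semigroup D P"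
  shows semigroup_pos_contraction: "0 \<le> t \<Longrightarrow> pos_contraction D (P t)"
    and semigroup_zero: "f \<in> C0 D \<Longrightarrow> P 0 f = f"
    and semigroup_add: "0 \<le> s \<Longrightarrow> 0 \<le> t \<Longrightarrow> f \<in> C0 D \<Longrightarrow> P (s + t) f = P s (P t f)"
    and semigroup_continuous: "f \<in> C0 D \<Longrightarrow> uniform_limit D (\<lambda>t. P t f) f (at_right 0)"
  using assms unfolding pos_sc_contraction_semigroup_iff by auto

definition has_generator :: "'a::real_normed_vector set \<Rightarrow> (real \<Rightarrow> ('a \<Rightarrow> real) \<Rightarrow> 'a \<Rightarrow> real) \<Rightarrow>
    ('a \<Rightarrow> real) \<Rightarrow> ('a \<Rightarrow> real) \<Rightarrow> bool" where
  "has_generator D P f h \<longleftrightarrow> f \<in> C0 D \<and> h \<in> C0 D \<and>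
    uniform_limit D (\<lambda>t x. (P t f x - f x) / t) h (at_right 0)"

lemma has_generatorD:
  assumes "has_generator D P f h"
  shows "f \<in> C0 D" and "h \<in> C0 D"
    and "uniform_limit D (\<lambda>t x. (P t f x - f x) / t) h (at_right 0)"
  using assms by (auto simp: has_generator_def)

lemma has_generator_lincomb:
  assumes semigroup_P: "pos_sc_contraction_semigroup D P" and generator_f: "has_generator D P f h"
    and generator_g: "has_generator D P g k"
  shows "has_generator D P (\<lambda>x. a * f x + g x) (\<lambda>x. a * h x + k x)"
  unfolding has_generator_def
proof (intro conjI C0_lincomb has_generatorD[OF generator_f] has_generatorD[OF generator_g])
  have "uniform_limit D (\<lambda>t x. a * ((P t f x - f x) / t) + (P t g x - g x) / t)
      (\<lambda>x. a * h x + k x) (at_right 0)"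
    by (intro uniform_limit_intros has_generatorD(3)[OF generator_f]
        has_generatorD(3)[OF generator_g])
  then show "uniform_limit D (\<lambda>t x. (P t (\<lambda>x. a * f x + g x) x - (a * f x + g x)) / t)
      (\<lambda>x. a * h x + k x) (at_right 0)"
  proof (rule uniform_limit_cong[THEN iffD1, rotated 2])
    have "\<forall>\<^sub>F t in at_right 0. 0 < (t :: real)" by (rule eventually_at_right_less)
    then show "\<forall>\<^sub>F t in at_right 0. \<forall>x\<in>D. a * ((P t f x - f x) / t) + (P t g x - g x) / t =
        (P t (\<lambda>x. a * f x + g x) x - (a * f x + g x)) / t"
    proof eventually_elim
      case (elim t)
      have "P t (\<lambda>x. a * f x + g x) = (\<lambda>x. a * P t f x + P t g x)"
        by (rule pos_contraction_lincomb[OF semigroup_pos_contraction[OF semigroup_P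
            less_imp_le[OF elim]]
              has_generatorD(1)[OF generator_f] has_generatorD(1)[OF generator_g]])
      then show ?case using elim by (simp add: field_simps)
    qed
  qed simp
qed

lemma has_generator_zero:
  assumes semigroup_P: "pos_sc_contraction_semigroup D P"
  shows "has_generator D P (\<lambda>x. 0) (\<lambda>x. 0)"
  unfolding has_generator_def
proof (intro conjI C0_zero)
  have "\<forall>\<^sub>F t in at_right 0. 0 < (t :: real)" by (rule eventually_at_right_less)
  then have "\<forall>\<^sub>F t in at_right 0. \<forall>x\<in>D. 0 = (P t (\<lambda>x. 0) x - 0) / t"
    by eventually_elim
      (simp add: pos_contraction_zero[OF semigroup_pos_contraction[OF semigroup_P]])
  then show "uniform_limit D (\<lambda>t x. (P t (\<lambda>x. 0) x - 0) / t) (\<lambda>x. 0) (at_right 0)"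
    by (rule uniform_limit_cong[THEN iffD1, OF _ _ uniform_limit_const]) simp
qed

lemma has_generator_scale:
  assumes "pos_sc_contraction_semigroup D P" "has_generator D P f h"
  shows "has_generator D P (\<lambda>x. a * f x) (\<lambda>x. a * h x)"
  using has_generator_lincomb[OF assms has_generator_zero[OF assms(1)], of a] by simp

lemma has_generator_nonneg_at_zero:
  assumes semigroup_P: "pos_sc_contraction_semigroup D P" and generator_f: "has_generator D P f h"
    and nonneg: "\<And>x. x \<in> D \<Longrightarrow> 0 \<le> f x" and zero_at_x: "x \<in> D" "f x = 0"
  shows "0 \<le> h x"
proof (rule tendsto_lowerbound)
  show "((\<lambda>t. (P t f x - f x) / t) \<longlongrightarrow> h x) (at_right 0)"
    by (rule tendsto_uniform_limitI[OF has_generatorD(3)[OF generator_f] zero_at_x(1)])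
  have "\<forall>\<^sub>F t in at_right 0. 0 < (t :: real)" by (rule eventually_at_right_less)
  then show "\<forall>\<^sub>F t in at_right 0. 0 \<le> (P t f x - f x) / t"
  proof eventually_elim
    case (elim t)
    have "0 \<le> P t f x"
      using elim by (intro pos_contraction_nonneg[OF semigroup_pos_contraction[OF semigroup_P]]
          has_generatorD(1)[OF generator_f] nonneg zero_at_x(1)) auto
    then show ?case using elim zero_at_x(2) by simp
  qed
qed simp

subsection \<open>The generator is closed\<close>

lemma semigroup_increment_le:
  assumes semigroup_P: "pos_sc_contraction_semigroup D P" and f_C0: "f \<in> C0 D" and h_C0: "h \<in> C0 D"
    and s_nonneg: "0 \<le> s"
    and step: "\<And>x. x \<in> D \<Longrightarrow> \<bar>P s f x - f x - s * h x\<bar> \<le> s * r"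
    and cont: "\<And>s' x. 0 \<le> s' \<Longrightarrow> s' \<le> real n * s \<Longrightarrow> x \<in> D \<Longrightarrow> \<bar>P s' h x - h x\<bar> \<le> e"
    and "j \<le> n" "x \<in> D"
  shows "\<bar>P (real j * s) f x - f x - real j * s * h x\<bar> \<le> real j * s * (e + r)"
  using assms(7,8)
proof (induction j arbitrary: x)
  case 0
  then show ?case using semigroup_zero[OF semigroup_P f_C0] by simp
next
  case (Suc j)
  define t where "t = real j * s"
  have t_nonneg: "0 \<le> t" using s_nonneg by (simp add: t_def)
  note Pt = semigroup_pos_contraction[OF semigroup_P t_nonneg]
  note Ps_f = pos_contraction_C0[OF semigroup_pos_contraction[OF semigroup_P s_nonneg] f_C0]
  have "\<bar>P t (P s f) x - P t (\<lambda>x. s * h x + f x) x\<bar> \<le> s * r"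
    using step
    by (intro pos_contraction_dist_le[OF Pt Ps_f C0_lincomb[OF h_C0 f_C0] _ Suc.prems(2)])
      (simp add: algebra_simps)
  then have "\<bar>P (t + s) f x - (s * P t h x + P t f x)\<bar> \<le> s * r"
    by (simp add: semigroup_add[OF semigroup_P t_nonneg s_nonneg f_C0]
        pos_contraction_lincomb[OF Pt h_C0 f_C0])
  moreover have "\<bar>s * (P t h x - h x)\<bar> \<le> s * e"
  proof -
    have "t \<le> real n * s"
      unfolding t_def using Suc.prems(1) s_nonneg by (intro mult_right_mono) auto
    then show ?thesis
      unfolding abs_mult using cont[OF t_nonneg _ Suc.prems(2)] s_nonneg
      by (simp add: mult_left_mono)
  qed
  moreover have "\<bar>P t f x - f x - t * h x\<bar> \<le> t * (e + r)"
    using Suc by (simp add: t_def)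
  ultimately have "\<bar>P (t + s) f x - f x - (t + s) * h x\<bar> \<le> (t + s) * (e + r)"
    unfolding distrib_left distrib_right right_diff_distrib by linarith
  then show ?case by (simp add: t_def distrib_right add.commute)
qed

lemma has_generator_increment_le:
  assumes semigroup_P: "pos_sc_contraction_semigroup D P" and generator_f: "has_generator D P f h"
    and t_pos: "0 < t"
    and cont: "\<And>s x. 0 \<le> s \<Longrightarrow> s \<le> t \<Longrightarrow> x \<in> D \<Longrightarrow> \<bar>P s h x - h x\<bar> \<le> e" and x_in_D: "x \<in> D"
  shows "\<bar>P t f x - f x - t * h x\<bar> \<le> t * e"
proof (rule field_le_epsilon)
  fix r :: real assume r_pos: "0 < r"
  then have "\<forall>\<^sub>F s in at_right 0. \<forall>x\<in>D. dist ((P s f x - f x) / s) (h x) < r / t"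
    using t_pos by (intro uniform_limitD[OF has_generatorD(3)[OF generator_f]]) simp
  then obtain d where d_pos: "0 < d"
    and step: "\<And>s x. 0 < s \<Longrightarrow> s < d \<Longrightarrow> x \<in> D \<Longrightarrow> \<bar>(P s f x - f x) / s - h x\<bar> < r / t"
    unfolding eventually_at_right_field dist_real_def by blast
  obtain n :: nat where n_large: "t / d < real n" using reals_Archimedean2 by blast
  have n_pos: "0 < real n" using n_large t_pos d_pos by (meson divide_pos_pos less_trans)
  define s where "s = t / n"
  have s_small: "0 < s" "s < d" using n_large n_pos t_pos d_pos by (auto simp: s_def field_simps)
  have steps_eq: "real n * s = t" using n_pos by (simp add: s_def)
  have "\<bar>P s f x - f x - s * h x\<bar> \<le> s * (r / t)" if "x \<in> D" for x
  proof -
    have "P s f x - f x - s * h x = s * ((P s f x - f x) / s - h x)"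
      using s_small by (simp add: field_simps)
    then show ?thesis
      using mult_left_mono[OF less_imp_le[OF step[OF s_small that]], of s] s_small
      by (simp add: abs_mult)
  qed
  from semigroup_increment_le[OF semigroup_P has_generatorD(1,2)[OF generator_f]
      less_imp_le[OF s_small(1)] this _ order_refl x_in_D, of n e]
  have "\<bar>P t f x - f x - t * h x\<bar> \<le> t * (e + r / t)" using cont by (simp add: steps_eq)
  also have "\<dots> = t * e + r" using t_pos by (simp add: distrib_left)
  finally show "\<bar>P t f x - f x - t * h x\<bar> \<le> t * e + r" .
qed

lemma has_generator_uniform_limit_increment_le:
  assumes semigroup_P: "pos_sc_contraction_semigroup D P"
    and generator_f: "\<forall>\<^sub>F n in F. has_generator D P (f n) (h n)" and F_nontrivial: "F \<noteq> bot"
    and f'_limit: "f' \<in> C0 D" "uniform_limit D f f' F"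
    and h'_limit: "h' \<in> C0 D" "uniform_limit D h h' F"
    and e_pos: "0 < e" and t_pos: "0 < t"
    and cont: "\<And>s x. 0 \<le> s \<Longrightarrow> s \<le> t \<Longrightarrow> x \<in> D \<Longrightarrow> \<bar>P s h' x - h' x\<bar> \<le> e" and x_in_D: "x \<in> D"
  shows "\<bar>P t f' x - f' x - t * h' x\<bar> \<le> t * (2 * e)"
proof (rule tendsto_upperbound)
  note Pt = semigroup_pos_contraction[OF semigroup_P less_imp_le[OF t_pos]]
  have "\<forall>\<^sub>F n in F. f n \<in> C0 D" using generator_f by eventually_elim (rule has_generatorD)
  then have "uniform_limit D (\<lambda>n. P t (f n)) (P t f') F"
    by (intro pos_contraction_uniform_limit[OF Pt] f'_limit)
  then show "((\<lambda>n. \<bar>P t (f n) x - f n x - t * h n x\<bar>) \<longlongrightarrow> \<bar>P t f' x - f' x - t * h' x\<bar>) F"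
    using f'_limit(2) h'_limit(2) x_in_D by (intro tendsto_intros tendsto_uniform_limitI)
  have "\<forall>\<^sub>F n in F. \<forall>x\<in>D. dist (h n x) (h' x) < e / 2"
    using e_pos by (intro uniform_limitD[OF h'_limit(2)]) simp
  with generator_f show "\<forall>\<^sub>F n in F. \<bar>P t (f n) x - f n x - t * h n x\<bar> \<le> t * (2 * e)"
  proof eventually_elim
    case (elim n)
    have "\<bar>P s (h n) y - h n y\<bar> \<le> 2 * e" if s_range: "0 \<le> s" "s \<le> t" and y_in_D: "y \<in> D" for s y
    proof -
      have close: "\<bar>h n y - h' y\<bar> \<le> e / 2" if "y \<in> D" for y
        using elim(2) that by (simp add: dist_real_def less_imp_le)
      have "\<bar>P s (h n) y - P s h' y\<bar> \<le> e / 2"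
        by (rule pos_contraction_dist_le[OF semigroup_pos_contraction[OF semigroup_P s_range(1)]
              has_generatorD(2)[OF elim(1)] h'_limit(1) close y_in_D])
      then show ?thesis using close[OF y_in_D] cont[OF s_range y_in_D] by linarith
    qed
    then show ?case by (rule has_generator_increment_le[OF semigroup_P elim(1) t_pos _ x_in_D])
  qed
qed (rule F_nontrivial)

lemma has_generator_uniform_limit:
  assumes semigroup_P: "pos_sc_contraction_semigroup D P"
    and generator_f: "\<forall>\<^sub>F n in F. has_generator D P (f n) (h n)" and F_nontrivial: "F \<noteq> bot"
    and f'_limit: "f' \<in> C0 D" "uniform_limit D f f' F"
    and h'_limit: "h' \<in> C0 D" "uniform_limit D h h' F"
  shows "has_generator D P f' h'"
  unfolding has_generator_def
proof (intro conjI f'_limit(1) h'_limit(1) uniform_limitI)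
  fix e :: real assume e_pos: "0 < e"
  then have "\<forall>\<^sub>F t in at_right 0. \<forall>x\<in>D. dist (P t h' x) (h' x) < e / 4"
    by (intro uniform_limitD[OF semigroup_continuous[OF semigroup_P h'_limit(1)]]) simp
  then obtain d where d_pos: "0 < d"
    and cont: "\<And>t x. 0 < t \<Longrightarrow> t < d \<Longrightarrow> x \<in> D \<Longrightarrow> \<bar>P t h' x - h' x\<bar> < e / 4"
    unfolding eventually_at_right_field dist_real_def by blast
  have "dist ((P t f' x - f' x) / t) (h' x) < e"
    if t_small: "0 < t" "t < d" and x_in_D: "x \<in> D" for t x
  proof -
    have "\<bar>P s h' y - h' y\<bar> \<le> e / 4" if "0 \<le> s" "s \<le> t" "y \<in> D" for s y
      using cont[of s y] that t_small e_pos semigroup_zero[OF semigroup_P h'_limit(1)]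
      by (cases "s = 0") auto
    from has_generator_uniform_limit_increment_le[OF semigroup_P generator_f F_nontrivial f'_limit
      h'_limit _ t_small(1) this x_in_D]
    have "\<bar>P t f' x - f' x - t * h' x\<bar> \<le> t * (e / 2)" using e_pos by simp
    also have "\<dots> < t * e" using t_small e_pos by simp
    finally have "\<bar>(P t f' x - f' x - t * h' x) / t\<bar> < e"
      using t_small by (simp add: pos_divide_less_eq mult.commute)
    moreover have "(P t f' x - f' x - t * h' x) / t = (P t f' x - f' x) / t - h' x"
      using t_small by (simp add: diff_divide_distrib)
    ultimately show ?thesis by (simp add: dist_real_def)
  qed
  then show "\<forall>\<^sub>F t in at_right 0. \<forall>x\<in>D. dist ((P t f' x - f' x) / t) (h' x) < e"
    unfolding eventually_at_right_field using d_pos by blast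
qed

section \<open>The Wishart generator on polynomials times exponentials\<close>

lemma exp_weighted_eq_scaled:
  "exp_weighted D c u q = (\<lambda>x. exp (u \<bullet> c) * exp_weighted D 0 u q x)"
  by (auto simp: exp_weighted_def fun_eq_iff inner_diff_right exp_diff exp_minus divide_inverse)

lemma wishart_semigroupD:
  assumes "wishart_semigroup D \<alpha> P"
  shows wishart_semigroup_imp_semigroup: "pos_sc_contraction_semigroup D P"
    and wishart_semigroup_fexp: "pd u \<Longrightarrow> 0 \<le> t \<Longrightarrow> x \<in> D \<Longrightarrow>
      P t (fexp D u) x = wishart_factor \<alpha> u t * fexp D (wishart_flow u t) x"
  using assms unfolding wishart_semigroup_def
  by (auto simp: wishart_factor_def wishart_flow_def fexp_def trace_mul_sym[of x])

lemma has_generator_wishart_exp: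
  assumes D_psd: "D \<subseteq> Collect psd" and wishart_P: "wishart_semigroup D \<alpha> P" and pd_u: "pd u"
  shows "has_generator D P (exp_weighted D c u (\<lambda>x. 1)) (exp_weighted D c u (wishart_symbol \<alpha> u))"
proof -
  note semigroup_P = wishart_semigroup_imp_semigroup[OF wishart_P]
  have "P t (fexp D u) x = wishart_factor \<alpha> u t * fexp D (wishart_flow u t) x"
    if "0 < t" "x \<in> D" for t x
    using that by (intro wishart_semigroup_fexp[OF wishart_P pd_u]) auto
  moreover have "\<forall>\<^sub>F t in at_right 0. 0 < (t :: real)" by (rule eventually_at_right_less)
  ultimately have "\<forall>\<^sub>F t in at_right 0. \<forall>x\<in>D.
      (wishart_factor \<alpha> u t * fexp D (wishart_flow u t) x - fexp D u x) / t =
      (P t (fexp D u) x - fexp D u x) / t"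
    by (auto elim!: eventually_mono)
  then have "uniform_limit D (\<lambda>t x. (P t (fexp D u) x - fexp D u x) / t)
      (exp_weighted D 0 u (wishart_symbol \<alpha> u)) (at_right 0)"
    by (rule uniform_limit_cong[THEN iffD1, OF _ _
        uniform_limit_wishart_difference_quotient[OF D_psd pd_u]]) simp
  then have "has_generator D P (exp_weighted D 0 u (\<lambda>x. 1)) (exp_weighted D 0 u (wishart_symbol \<alpha> u))"
    unfolding has_generator_def fexp_eq_exp_weighted[OF D_psd]
    by (intro conjI exp_weighted_in_C0 D_psd pd_u poly_growth_const poly_growth_wishart_symbol)
  from has_generator_scale[OF semigroup_P this, of "exp (u \<bullet> c)"] show ?thesis
    by (simp only: exp_weighted_eq_scaled[of D c])
qed

lemma has_generator_differentiate:
  assumes D_psd: "D \<subseteq> Collect psd" and semigroup_P: "pos_sc_contraction_semigroup D P"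
    and pd_u: "pd u" and sym_v: "transpose v = v"
    and growth_p: "poly_growth p" and growth_r: "poly_growth r0" "poly_growth r1" "poly_growth r2"
    and generator_p: "\<And>s. pd (u + s *\<^sub>R v) \<Longrightarrow> has_generator D P (exp_weighted D c (u + s *\<^sub>R v) p)
      (exp_weighted D c (u + s *\<^sub>R v) (\<lambda>x. r0 x + s * r1 x + s\<^sup>2 * r2 x))"
  shows "has_generator D P (exp_weighted D c u (\<lambda>x. (v \<bullet> (x - c)) * p x))
    (exp_weighted D c u (\<lambda>x. (v \<bullet> (x - c)) * r0 x - r1 x))"
proof -
  let ?E = "\<lambda>s. exp_weighted D c (u + s *\<^sub>R v)" and ?G = "exp_weighted D c u"
  let ?f = "\<lambda>s x. (-1) * ((?E s p x - ?G p x) / s)"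
  let ?h = "\<lambda>s x. (-1) * ((?E s r0 x - ?G r0 x) / s) - (?E s r1 x + s * ?E s r2 x)"
  have "((\<lambda>s. u + s *\<^sub>R v) \<longlongrightarrow> u + 0 *\<^sub>R v) (at_right 0)" by (intro tendsto_intros)
  then have u_tendsto: "((\<lambda>s. u + s *\<^sub>R v) \<longlongrightarrow> u) (at_right 0)" by simp
  have quotient:
    "uniform_limit D (\<lambda>s x. (?E s q x - ?G q x) / s) (?G (\<lambda>x. - (v \<bullet> (x - c)) * q x)) (at_right 0)"
    if "poly_growth q" for q
    by (rule uniform_limit_exp_weighted_difference_quotient[OF D_psd pd_u that tendsto_const])
  have "uniform_limit D ?f (\<lambda>x. (-1) * ?G (\<lambda>x. - (v \<bullet> (x - c)) * p x) x) (at_right 0)"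
    by (intro uniform_limit_intros quotient growth_p)
  then have f_tendsto: "uniform_limit D ?f (?G (\<lambda>x. (v \<bullet> (x - c)) * p x)) (at_right 0)"
    by (rule uniform_limit_eq_rhs) (auto simp: exp_weighted_def)
  have "uniform_limit D ?h
      (\<lambda>x. (-1) * ?G (\<lambda>x. - (v \<bullet> (x - c)) * r0 x) x - (?G r1 x + 0 * ?G r2 x)) (at_right 0)"
    by (intro uniform_limit_add uniform_limit_minus
        bounded_linear.uniform_limit[OF bounded_linear_mult_right]
        uniform_limit_tendsto_mult quotient uniform_limit_exp_weighted bounded_exp_weighted
        tendsto_ident_at D_psd pd_u growth_r u_tendsto)
  then have h_tendsto: "uniform_limit D ?h (?G (\<lambda>x. (v \<bullet> (x - c)) * r0 x - r1 x)) (at_right 0)"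
    by (rule uniform_limit_eq_rhs) (auto simp: exp_weighted_def fun_eq_iff algebra_simps)
  have "\<forall>\<^sub>F s in at_right 0. pd (u + s *\<^sub>R v)"
    using eventually_pd_perturb[OF pd_u sym_v] by (rule filter_leD[OF at_le[OF subset_UNIV]])
  moreover have "\<forall>\<^sub>F s in at_right 0. 0 < (s :: real)" by (rule eventually_at_right_less)
  ultimately have "\<forall>\<^sub>F s in at_right 0. has_generator D P (?f s) (?h s)"
  proof eventually_elim
    case (elim s)
    have "has_generator D P (?G p) (?G r0)" using generator_p[of 0] pd_u by simp
    note generator = has_generator_lincomb[OF semigroup_P generator_p[OF elim(1)]
        has_generator_scale[OF semigroup_P this], of "-1 / s" "1 / s"]
    have "?f s = (\<lambda>x. -1 / s * ?E s p x + 1 / s * ?G p x)"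
      using elim(2) by (simp add: fun_eq_iff field_simps)
    moreover have
      "?h s = (\<lambda>x. -1 / s * ?E s (\<lambda>x. r0 x + s * r1 x + s\<^sup>2 * r2 x) x + 1 / s * ?G r0 x)"
      using elim(2) by (auto simp: exp_weighted_def fun_eq_iff field_simps power2_eq_square)
    ultimately show ?case using generator by (simp only:)
  qed
  then show ?thesis
    by (rule has_generator_uniform_limit[OF semigroup_P _ _ _ f_tendsto _ h_tendsto])
      (auto intro!: exp_weighted_in_C0 D_psd pd_u poly_growth_mult poly_growth_diff
          poly_growth_inner_diff growth_p growth_r)
qed

text \<open>For a product of linear forms \<open>v \<bullet> (x - c)\<close> the generator follows from the symbol, which is
  quadratic in \<open>u\<close>, by the Leibniz rule: only derivatives of order at most two occur.\<close>

definition wishart_diffusion :: "real^'n^'n \<Rightarrow> real^'n^'n \<Rightarrow> real^'n^'n \<Rightarrow> real" where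
  "wishart_diffusion v w x = 2 * ((v ** w + w ** v) \<bullet> x)"

definition wishart_symbol_deriv :: "real \<Rightarrow> real^'n^'n \<Rightarrow> real^'n^'n \<Rightarrow> real^'n^'n \<Rightarrow> real" where
  "wishart_symbol_deriv \<alpha> u v x = - \<alpha> * trace v + wishart_diffusion u v x"

lemma wishart_symbol_add_scaleR:
  "wishart_symbol \<alpha> (u + s *\<^sub>R v) x =
    wishart_symbol \<alpha> u x + s * wishart_symbol_deriv \<alpha> u v x + s\<^sup>2 * wishart_symbol 0 v x"
  by (simp add: wishart_symbol_def wishart_symbol_deriv_def wishart_diffusion_def trace_add
      trace_scaleR matrix_add_ldistrib matrix_add_rdistrib_real matrix_mult_scaleR_left
      matrix_mult_scaleR_right inner_add_left power2_eq_square algebra_simps)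

lemma wishart_symbol_deriv_add_scaleR:
  "wishart_symbol_deriv \<alpha> (u + s *\<^sub>R v) w x =
    wishart_symbol_deriv \<alpha> u w x + s * wishart_diffusion v w x"
  by (simp add: wishart_symbol_deriv_def wishart_diffusion_def matrix_add_ldistrib
      matrix_add_rdistrib_real matrix_mult_scaleR_left matrix_mult_scaleR_right inner_add_left
      algebra_simps)

lemma poly_growth_wishart_diffusion: "poly_growth (wishart_diffusion v w)"
  unfolding wishart_diffusion_def by (intro poly_growth_mult poly_growth_const poly_growth_inner)

lemma poly_growth_wishart_symbol_deriv: "poly_growth (wishart_symbol_deriv \<alpha> u v)"
  unfolding wishart_symbol_deriv_def
  by (intro poly_growth_add poly_growth_const poly_growth_wishart_diffusion)

subsection \<open>Products of linear forms\<close>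

primrec linear_prod :: "'a::real_inner \<Rightarrow> 'a list \<Rightarrow> 'a \<Rightarrow> real" where
  "linear_prod c [] x = 1"
| "linear_prod c (v # vs) x = (v \<bullet> (x - c)) * linear_prod c vs x"

primrec leibniz_sum :: "'a::real_inner \<Rightarrow> ('a \<Rightarrow> 'a \<Rightarrow> real) \<Rightarrow> 'a list \<Rightarrow> 'a \<Rightarrow> real" where
  "leibniz_sum c g [] x = 0"
| "leibniz_sum c g (v # vs) x = g v x * linear_prod c vs x + (v \<bullet> (x - c)) * leibniz_sum c g vs x"

primrec leibniz_pair_sum :: "'a::real_inner \<Rightarrow> ('a \<Rightarrow> 'a \<Rightarrow> 'a \<Rightarrow> real) \<Rightarrow> 'a list \<Rightarrow> 'a \<Rightarrow> real" where
  "leibniz_pair_sum c b [] x = 0"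
| "leibniz_pair_sum c b (v # vs) x =
    leibniz_sum c (b v) vs x + (v \<bullet> (x - c)) * leibniz_pair_sum c b vs x"

lemma poly_growth_linear_prod: "poly_growth (linear_prod c vs)"
  by (induction vs) (simp_all add: poly_growth_const poly_growth_mult poly_growth_inner_diff)

lemma poly_growth_leibniz_sum:
  assumes "\<And>v. poly_growth (g v)"
  shows "poly_growth (leibniz_sum c g vs)"
  by (induction vs) (simp_all add: poly_growth_const poly_growth_add poly_growth_mult
      poly_growth_inner_diff poly_growth_linear_prod assms)

lemma poly_growth_leibniz_pair_sum:
  assumes "\<And>v w. poly_growth (b v w)"
  shows "poly_growth (leibniz_pair_sum c b vs)"
  by (induction vs) (simp_all add: poly_growth_const poly_growth_add poly_growth_mult
      poly_growth_inner_diff poly_growth_leibniz_sum assms)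

lemma leibniz_sum_wishart_symbol_deriv_add_scaleR:
  "leibniz_sum c (wishart_symbol_deriv \<alpha> (u + s *\<^sub>R v)) vs x =
    leibniz_sum c (wishart_symbol_deriv \<alpha> u) vs x + s * leibniz_sum c (wishart_diffusion v) vs x"
  by (induction vs) (simp_all add: wishart_symbol_deriv_add_scaleR algebra_simps)

definition wishart_generator_prod ::
  "real \<Rightarrow> real^'n^'n \<Rightarrow> real^'n^'n \<Rightarrow> (real^'n^'n) list \<Rightarrow> real^'n^'n \<Rightarrow> real" where
  "wishart_generator_prod \<alpha> c u vs x = wishart_symbol \<alpha> u x * linear_prod c vs x
    - leibniz_sum c (wishart_symbol_deriv \<alpha> u) vs x + leibniz_pair_sum c wishart_diffusion vs x"

lemma poly_growth_wishart_generator_prod: "poly_growth (wishart_generator_prod \<alpha> c u vs)"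
  unfolding wishart_generator_prod_def
  by (intro poly_growth_add poly_growth_diff poly_growth_mult poly_growth_wishart_symbol
      poly_growth_linear_prod poly_growth_leibniz_sum poly_growth_leibniz_pair_sum
      poly_growth_wishart_symbol_deriv poly_growth_wishart_diffusion)

lemma has_generator_linear_prod:
  assumes D_psd: "D \<subseteq> Collect psd" and wishart_P: "wishart_semigroup D \<alpha> P"
  shows "pd u \<Longrightarrow> \<forall>v\<in>set vs. transpose v = v \<Longrightarrow>
    has_generator D P (exp_weighted D c u (linear_prod c vs))
      (exp_weighted D c u (wishart_generator_prod \<alpha> c u vs))"
proof (induction vs arbitrary: u)
  case Nil
  have "linear_prod c [] = (\<lambda>x. 1)" "wishart_generator_prod \<alpha> c u [] = wishart_symbol \<alpha> u"
    by (auto simp: wishart_generator_prod_def fun_eq_iff)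
  then show ?case using has_generator_wishart_exp[OF D_psd wishart_P Nil(1)] by simp
next
  case (Cons v vs)
  note semigroup_P = wishart_semigroup_imp_semigroup[OF wishart_P]
  let ?r1 = "\<lambda>x. wishart_symbol_deriv \<alpha> u v x * linear_prod c vs x -
    leibniz_sum c (wishart_diffusion v) vs x"
  let ?r2 = "\<lambda>x. wishart_symbol 0 v x * linear_prod c vs x"
  have "has_generator D P (exp_weighted D c u (\<lambda>x. (v \<bullet> (x - c)) * linear_prod c vs x))
      (exp_weighted D c u (\<lambda>x. (v \<bullet> (x - c)) * wishart_generator_prod \<alpha> c u vs x - ?r1 x))"
  proof (rule has_generator_differentiate[OF D_psd semigroup_P Cons.prems(1), where ?r2.0 = ?r2])
    show "transpose v = v" using Cons.prems by simp
    show "poly_growth ?r1" "poly_growth ?r2"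
      by (intro poly_growth_diff poly_growth_mult poly_growth_wishart_symbol poly_growth_linear_prod
          poly_growth_leibniz_sum poly_growth_wishart_symbol_deriv poly_growth_wishart_diffusion)+
    fix s assume pd_s: "pd (u + s *\<^sub>R v)"
    have "wishart_generator_prod \<alpha> c (u + s *\<^sub>R v) vs =
        (\<lambda>x. wishart_generator_prod \<alpha> c u vs x + s * ?r1 x + s\<^sup>2 * ?r2 x)"
      by (simp add: wishart_generator_prod_def fun_eq_iff wishart_symbol_add_scaleR
          leibniz_sum_wishart_symbol_deriv_add_scaleR algebra_simps)
    then show "has_generator D P (exp_weighted D c (u + s *\<^sub>R v) (linear_prod c vs))
        (exp_weighted D c (u + s *\<^sub>R v)
          (\<lambda>x. wishart_generator_prod \<alpha> c u vs x + s * ?r1 x + s\<^sup>2 * ?r2 x))"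
      using Cons.IH[OF pd_s] Cons.prems(2) by simp
  qed (rule poly_growth_linear_prod poly_growth_wishart_generator_prod)+
  moreover have
    "(\<lambda>x. (v \<bullet> (x - c)) * wishart_generator_prod \<alpha> c u vs x - ?r1 x) =
      wishart_generator_prod \<alpha> c u (v # vs)"
    by (simp add: fun_eq_iff wishart_generator_prod_def algebra_simps)
  moreover have "(\<lambda>x. (v \<bullet> (x - c)) * linear_prod c vs x) = linear_prod c (v # vs)"
    by (simp add: fun_eq_iff)
  ultimately show ?case by (simp only:)
qed

subsection \<open>Value of the generator at the centre\<close>

definition generator_value ::
  "(real^'n^'n) set \<Rightarrow> (real \<Rightarrow> (real^'n^'n \<Rightarrow> real) \<Rightarrow> real^'n^'n \<Rightarrow> real) \<Rightarrow> real^'n^'n \<Rightarrow>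
    (real^'n^'n \<Rightarrow> real) \<Rightarrow> real \<Rightarrow> bool" where
  "generator_value D P c q r \<longleftrightarrow> (\<exists>h. has_generator D P (exp_weighted D c (mat 1) q) h \<and> h c = r)"

lemma generator_value_cong:
  assumes "generator_value D P c q r" "\<And>x. x \<in> D \<Longrightarrow> q x = q' x"
  shows "generator_value D P c q' r"
proof -
  have "exp_weighted D c (mat 1) q = exp_weighted D c (mat 1) q'"
    using assms(2) by (auto simp: exp_weighted_def)
  then show ?thesis using assms(1) by (simp add: generator_value_def)
qed

lemma generator_value_lincomb:
  assumes semigroup_P: "pos_sc_contraction_semigroup D P"
    and value_q: "generator_value D P c q r" and value_q': "generator_value D P c q' r'"
  shows "generator_value D P c (\<lambda>x. a * q x + q' x) (a * r + r')"
proof -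
  have "exp_weighted D c (mat 1) (\<lambda>x. a * q x + q' x) =
      (\<lambda>x. a * exp_weighted D c (mat 1) q x + exp_weighted D c (mat 1) q' x)"
    by (auto simp: exp_weighted_def distrib_right)
  then show ?thesis
    using value_q value_q' has_generator_lincomb[OF semigroup_P] unfolding generator_value_def
    by fastforce
qed

lemma generator_value_zero:
  "pos_sc_contraction_semigroup D P \<Longrightarrow> generator_value D P c (\<lambda>x. 0) 0"
  using has_generator_zero by (auto simp: generator_value_def exp_weighted_def cong: if_cong)

lemma generator_value_sum:
  assumes semigroup_P: "pos_sc_contraction_semigroup D P"
    and "\<And>i. i \<in> I \<Longrightarrow> generator_value D P c (q i) (r i)"
  shows "generator_value D P c (\<lambda>x. \<Sum>i\<in>I. q i x) (\<Sum>i\<in>I. r i)"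
  using assms(2)
proof (induction I rule: infinite_finite_induct)
  case (insert i I)
  then show ?case
    using generator_value_lincomb[OF semigroup_P, of c "q i" "r i" "\<lambda>x. \<Sum>i\<in>I. q i x" "\<Sum>i\<in>I. r i" 1]
    by simp
qed (simp_all add: generator_value_zero[OF semigroup_P])

lemma generator_value_nonneg:
  assumes semigroup_P: "pos_sc_contraction_semigroup D P" and value_q: "generator_value D P c q r"
    and nonneg: "\<And>x. x \<in> D \<Longrightarrow> 0 \<le> q x" and zero_at_c: "c \<in> D" "q c = 0"
  shows "0 \<le> r"
proof -
  obtain h where generator_h: "has_generator D P (exp_weighted D c (mat 1) q) h" "h c = r"
    using value_q by (auto simp: generator_value_def)
  have "0 \<le> h c"
    by (rule has_generator_nonneg_at_zero[OF semigroup_P generator_h(1) _ zero_at_c(1)])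
      (use nonneg zero_at_c in \<open>auto simp: exp_weighted_def\<close>)
  then show ?thesis by (simp add: generator_h(2))
qed

context
  fixes D :: "(real^'n^'n) set" and \<alpha> :: real and P and c :: "real^'n^'n"
  assumes D_psd: "D \<subseteq> Collect psd" and wishart_P: "wishart_semigroup D \<alpha> P" and c_in_D: "c \<in> D"
begin

lemma generator_value_linear_prod:
  assumes "\<forall>v\<in>set vs. transpose v = v"
  shows "generator_value D P c (linear_prod c vs) (wishart_generator_prod \<alpha> c (mat 1) vs c)"
  using has_generator_linear_prod[OF D_psd wishart_P pd_mat_1 assms, of c] c_in_D
  by (auto simp: generator_value_def exp_weighted_def)

lemma generator_value_linear:
  assumes "transpose v = v"
  shows "generator_value D P c (\<lambda>x. v \<bullet> (x - c)) (- wishart_symbol_deriv \<alpha> (mat 1) v c)"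
  using generator_value_cong[OF generator_value_linear_prod[of "[v]"], of "\<lambda>x. v \<bullet> (x - c)"] assms
  by (simp add: wishart_generator_prod_def)

lemma generator_value_quadratic:
  assumes "transpose v = v" "transpose w = w"
  shows "generator_value D P c (\<lambda>x. (v \<bullet> (x - c)) * (w \<bullet> (x - c))) (wishart_diffusion v w c)"
  using generator_value_cong[OF generator_value_linear_prod[of "[v, w]"],
      of "\<lambda>x. (v \<bullet> (x - c)) * (w \<bullet> (x - c))"] assms
  by (simp add: wishart_generator_prod_def)

lemma generator_value_higher_order:
  assumes "\<forall>v\<in>set vs. transpose v = v" "3 \<le> length vs"
  shows "generator_value D P c (linear_prod c vs) 0"
proof -
  obtain v1 v2 v3 ws where "vs = v1 # v2 # v3 # ws"
    using assms(2) by (metis Suc_le_length_iff numeral_3_eq_3)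
  then show ?thesis
    using generator_value_linear_prod[OF assms(1)] by (simp add: wishart_generator_prod_def)
qed

end

section \<open>Necessity\<close>

subsection \<open>Coordinate projections\<close>

definition coord_proj :: "'n set \<Rightarrow> real^'n^'n" where
  "coord_proj K = (\<Sum>a\<in>K. outer (axis a 1))"

lemma coord_proj_mult: "coord_proj K *v v = (\<Sum>a\<in>K. v $ a *\<^sub>R axis a 1)"
  by (simp add: coord_proj_def sum_matrix_mult_vec outer_mult_vec inner_axis')

lemma coord_proj_mult_nth: "(coord_proj K *v v) $ a = (if a \<in> K then v $ a else 0)"
proof -
  have "(coord_proj K *v v) $ a = (\<Sum>b\<in>K. v $ b * axis b 1 $ a)" by (simp add: coord_proj_mult)
  also have "\<dots> = (\<Sum>b\<in>K. if a = b then v $ b else 0)" by (rule sum.cong) (auto simp: axis_def)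
  finally show ?thesis by simp
qed

lemma coord_proj_nth: "coord_proj K $ a $ b = (if a = b \<and> a \<in> K then 1 else 0)"
proof -
  have "coord_proj K $ a $ b = (if a \<in> K then axis b 1 $ a else 0)"
    by (simp only: matrix_mult_axis_nth[symmetric] coord_proj_mult_nth)
  then show ?thesis by (simp add: axis_def)
qed

lemma psd_coord_proj: "psd (coord_proj K)"
  unfolding coord_proj_def by (intro psd_sum psd_outer)

lemma coord_proj_idem: "coord_proj K *v (coord_proj K *v v) = coord_proj K *v v"
  by (simp add: vec_eq_iff coord_proj_mult_nth)

lemma norm_coord_proj_mult_le: "norm (coord_proj K *v v) \<le> norm v"
  by (rule norm_le_componentwise_cart) (simp add: coord_proj_mult_nth)

lemma coord_proj_in_Dpk: "card (K :: 'n::finite set) \<le> k \<Longrightarrow> (coord_proj K :: real^'n^'n) \<in> Dpk k"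
  using rank_sum_outer_le[of K "\<lambda>a. axis a 1"] psd_coord_proj[of K]
  by (simp add: Dpk_def coord_proj_def)

definition sym_unit :: "'n \<Rightarrow> 'n \<Rightarrow> real^'n^'n" where
  "sym_unit a b = (1 / 2) *\<^sub>R (axis a (axis b 1) + axis b (axis a 1))"

lemma transpose_sym_unit [simp]: "transpose (sym_unit a b) = sym_unit a b"
  by (auto simp: sym_unit_def transpose_def vec_eq_iff axis_def)

lemma inner_sym_unit: "transpose x = x \<Longrightarrow> sym_unit a b \<bullet> x = x $ a $ b"
  using sym_nth[of x b a] by (simp add: sym_unit_def inner_add_left inner_axis')

lemma wishart_symbol_deriv_coord_proj:
  fixes m :: "'n::finite"
  assumes "m \<notin> K"
  shows "wishart_symbol_deriv \<alpha> (mat 1) (sym_unit m m) (coord_proj K) = - \<alpha>"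
proof -
  have "trace (sym_unit m m) = 1"
    unfolding trace_eq_inner inner_commute[of "mat 1"]
    by (subst inner_sym_unit[OF transpose_mat]) (simp add: mat_def)
  then show ?thesis
    using assms inner_sym_unit[OF psdD(1)[OF psd_coord_proj], of m m K]
    unfolding wishart_symbol_deriv_def wishart_diffusion_def matrix_mul_lid
      matrix_mul_rid inner_add_left
    by (simp add: coord_proj_nth)
qed

lemma wishart_diffusion_coord_proj:
  fixes m :: "'n::finite"
  assumes m_notin_K: "m \<notin> K" and a_in_K: "a \<in> K"
  shows "wishart_diffusion (sym_unit a m) (sym_unit a m) (coord_proj K) = 1"
proof -
  let ?v = "sym_unit a m"
  have "(?v ** ?v) \<bullet> outer (axis c 1) = (if a = c then 1 / 4 else 0)" if c_in_K: "c \<in> K" for c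
  proof -
    have column: "(?v *v axis c 1) $ j = (if a = c \<and> j = m then 1 / 2 else 0)" for j
      using a_in_K c_in_K m_notin_K unfolding matrix_mult_axis_nth
      by (auto simp: sym_unit_def axis_def)
    have "(?v ** ?v) \<bullet> outer (axis c 1) = axis c 1 \<bullet> (?v *v (?v *v axis c 1))"
      by (simp add: inner_outer matrix_vector_mul_assoc)
    also have "\<dots> = (?v *v axis c 1) \<bullet> (?v *v axis c 1)"
      by (rule sym_inner[OF transpose_sym_unit])
    also have "\<dots> = (\<Sum>j\<in>UNIV. if m = j then (if a = c then 1 / 4 else 0) else 0)"
      unfolding inner_vec_def by (rule sum.cong) (auto simp: column)
    finally show ?thesis by simp
  qed
  then have "(?v ** ?v) \<bullet> coord_proj K = (\<Sum>c\<in>K. if a = c then 1 / 4 else 0)"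
    unfolding coord_proj_def inner_sum_right by (rule sum.cong[OF refl])
  then show ?thesis using a_in_K unfolding wishart_diffusion_def inner_add_left by simp
qed

subsection \<open>The test functions\<close>

text \<open>The polynomial \<open>z\<^sup>T x z\<close> with \<open>z = e\<^sub>m - \<pi> x e\<^sub>m\<close>, where \<open>\<pi>\<close> is the projection to the
  coordinates in \<open>K\<close>, is nonnegative on the cone and agrees to second order at \<open>x = \<pi>\<close> with the
  principal minor of \<open>x\<close> on \<open>K \<union> {m}\<close>.\<close>

definition minor_probe :: "'n set \<Rightarrow> 'n \<Rightarrow> real^'n^'n \<Rightarrow> real" where
  "minor_probe K m x = (let z = axis m 1 - coord_proj K *v (x *v axis m 1) in z \<bullet> (x *v z))"

lemma minor_probe_nonneg: "psd x \<Longrightarrow> 0 \<le> minor_probe K m x"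
  unfolding minor_probe_def Let_def by (rule psdD)

lemma minor_probe_eq:
  fixes x :: "real^'n^'n"
  assumes sym_x: "transpose x = x"
  shows "minor_probe K m x = x $ m $ m - 2 * (\<Sum>a\<in>K. (x $ a $ m)\<^sup>2)
    + (\<Sum>a\<in>K. x $ a $ m * (\<Sum>b\<in>K. x $ a $ b * x $ b $ m))"
proof -
  let ?e = "axis m 1 :: real^'n"
  define b where "b = coord_proj K *v (x *v ?e)"
  have b_eq: "b = (\<Sum>a\<in>K. x $ a $ m *\<^sub>R axis a 1)"
    by (simp add: b_def coord_proj_mult matrix_mult_axis_nth)
  have "axis a 1 \<bullet> (x *v b) = (\<Sum>c\<in>K. x $ a $ c * x $ c $ m)" for a
    by (simp add: b_eq linear_sum[OF matrix_vector_mul_linear] inner_sum_right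
        matrix_vector_mult_scaleR
        inner_axis_mult_axis mult.commute)
  then have "b \<bullet> (x *v b) = (\<Sum>a\<in>K. x $ a $ m * (\<Sum>c\<in>K. x $ a $ c * x $ c $ m))"
    by (subst b_eq) (simp add: inner_sum_left)
  moreover have "b \<bullet> (x *v ?e) = (\<Sum>a\<in>K. (x $ a $ m)\<^sup>2)"
    by (simp add: b_eq inner_sum_left inner_axis_mult_axis power2_eq_square)
  moreover have "minor_probe K m x = x $ m $ m - 2 * (b \<bullet> (x *v ?e)) + b \<bullet> (x *v b)"
    using sym_inner[OF sym_x, of ?e b]
    by (simp add: minor_probe_def Let_def b_def[symmetric] inner_diff_left inner_diff_right
        matrix_vector_mult_diff_distrib inner_axis_mult_axis)
  ultimately show ?thesis by simp
qed

lemma minor_probe_expand: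
  fixes x :: "real^'n^'n"
  assumes sym_x: "transpose x = x" and m_notin_K: "m \<notin> K"
  defines "h \<equiv> x - coord_proj K"
  shows "minor_probe K m x = h $ m $ m - (\<Sum>a\<in>K. (h $ a $ m)\<^sup>2)
    + (\<Sum>a\<in>K. \<Sum>b\<in>K. h $ a $ m * (h $ a $ b * h $ b $ m))"
proof -
  have column: "x $ a $ m = h $ a $ m" for a
    using m_notin_K by (auto simp: h_def coord_proj_nth)
  have "(\<Sum>b\<in>K. x $ a $ b * x $ b $ m) = h $ a $ m + (\<Sum>b\<in>K. h $ a $ b * h $ b $ m)"
    if a_in_K: "a \<in> K" for a
  proof -
    have "(\<Sum>b\<in>K. x $ a $ b * x $ b $ m) =
        (\<Sum>b\<in>K. (if a = b then h $ b $ m else 0) + h $ a $ b * h $ b $ m)"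
      unfolding column using a_in_K
      by (intro sum.cong) (auto simp: h_def coord_proj_nth algebra_simps)
    then show ?thesis using a_in_K by (simp add: sum.distrib)
  qed
  then have "(\<Sum>a\<in>K. x $ a $ m * (\<Sum>b\<in>K. x $ a $ b * x $ b $ m)) =
      (\<Sum>a\<in>K. (h $ a $ m)\<^sup>2 + (\<Sum>b\<in>K. h $ a $ m * (h $ a $ b * h $ b $ m)))"
    unfolding column
    by (intro sum.cong refl) (simp add: distrib_left power2_eq_square sum_distrib_left)
  then show ?thesis unfolding minor_probe_eq[OF sym_x] column by (simp add: sum.distrib)
qed

lemma generator_value_minor_probe:
  fixes D :: "(real^'n^'n) set"
  assumes D_psd: "D \<subseteq> Collect psd" and wishart_P: "wishart_semigroup D \<alpha> P"
    and coord_proj_in_D: "coord_proj K \<in> D" and m_notin_K: "m \<notin> K"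
  shows "generator_value D P (coord_proj K) (minor_probe K m) (\<alpha> - real (card K))"
proof -
  note semigroup_P = wishart_semigroup_imp_semigroup[OF wishart_P]
  let ?c = "coord_proj K :: real^'n^'n"
  let ?l = "\<lambda>a b x. sym_unit a b \<bullet> (x - ?c)"
  have linear: "generator_value D P ?c (?l m m) \<alpha>"
    using generator_value_linear[OF D_psd wishart_P coord_proj_in_D transpose_sym_unit[of m m]]
    by (simp add: wishart_symbol_deriv_coord_proj[OF m_notin_K])
  have quadratic: "generator_value D P ?c (\<lambda>x. ?l a m x * ?l a m x) 1" if "a \<in> K" for a
    using generator_value_quadratic[OF D_psd wishart_P coord_proj_in_D, of "sym_unit a m"
      "sym_unit a m"]
    by (simp add: wishart_diffusion_coord_proj[OF m_notin_K that])
  have cubic: "generator_value D P ?c (\<lambda>x. ?l a m x * (?l a b x * ?l b m x)) 0" for a b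
    using generator_value_cong[OF generator_value_higher_order[OF D_psd wishart_P coord_proj_in_D],
        of "[sym_unit a m, sym_unit a b, sym_unit b m]"
        "\<lambda>x. ?l a m x * (?l a b x * ?l b m x)"] by simp
  have "generator_value D P ?c
      (\<lambda>x. (-1) * (\<Sum>a\<in>K. ?l a m x * ?l a m x) +
        (1 * ?l m m x + (\<Sum>a\<in>K. \<Sum>b\<in>K. ?l a m x * (?l a b x * ?l b m x))))
      ((-1) * (\<Sum>a\<in>K. 1) + (1 * \<alpha> + (\<Sum>a\<in>K. \<Sum>b\<in>K. 0)))"
    by (intro generator_value_lincomb[OF semigroup_P] generator_value_sum[OF semigroup_P] linear
        quadratic cubic)
  then have "generator_value D P ?c (minor_probe K m) ((-1) * (\<Sum>a\<in>K. 1) + (1 * \<alpha> + (\<Sum>a\<in>K. \<Sum>b\<in>K. 0)))"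
  proof (rule generator_value_cong)
    fix x assume "x \<in> D"
    then have sym_x: "transpose x = x" using D_psd psdD(1) by auto
    then have "transpose (x - ?c) = x - ?c" by (simp add: transpose_diff psdD(1)[OF psd_coord_proj])
    then show "(-1) * (\<Sum>a\<in>K. ?l a m x * ?l a m x) +
        (1 * ?l m m x + (\<Sum>a\<in>K. \<Sum>b\<in>K. ?l a m x * (?l a b x * ?l b m x))) = minor_probe K m x"
      unfolding minor_probe_expand[OF sym_x m_notin_K]
      by (simp add: inner_sym_unit power2_eq_square)
  qed
  then show ?thesis by simp
qed

lemma generator_value_norm_power4:
  fixes D :: "(real^'n^'n) set"
  assumes D_psd: "D \<subseteq> Collect psd" and wishart_P: "wishart_semigroup D \<alpha> P" and c_in_D: "c \<in> D"
  shows "generator_value D P c (\<lambda>x. norm (x - c) ^ 4) 0"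
proof -
  note semigroup_P = wishart_semigroup_imp_semigroup[OF wishart_P]
  let ?forms = "\<lambda>i j k l. [sym_unit i j, sym_unit i j, sym_unit k l, sym_unit k l] :: (real^'n^'n) list"
  have "generator_value D P c
      (\<lambda>x. \<Sum>i\<in>UNIV. \<Sum>j\<in>UNIV. \<Sum>k\<in>UNIV. \<Sum>l\<in>UNIV. linear_prod c (?forms i j k l) x)
      (\<Sum>i\<in>(UNIV :: 'n set). \<Sum>j\<in>(UNIV :: 'n set). \<Sum>k\<in>(UNIV :: 'n set). \<Sum>l\<in>(UNIV :: 'n set). 0)"
    by (intro generator_value_sum[OF semigroup_P]
        generator_value_higher_order[OF D_psd wishart_P c_in_D]) auto
  then have "generator_value D P c (\<lambda>x. norm (x - c) ^ 4)
      (\<Sum>i\<in>(UNIV :: 'n set). \<Sum>j\<in>(UNIV :: 'n set). \<Sum>k\<in>(UNIV :: 'n set). \<Sum>l\<in>(UNIV :: 'n set). 0)"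
  proof (rule generator_value_cong)
    fix x assume x_in_D: "x \<in> D"
    define h where "h = x - c"
    have "transpose x = x" "transpose c = c" using D_psd x_in_D c_in_D psdD(1) by auto
    then have "transpose h = h" by (simp add: h_def transpose_diff)
    then have "linear_prod c (?forms i j k l) x = (h $ i $ j)\<^sup>2 * (h $ k $ l)\<^sup>2" for i j k l
      by (simp add: h_def[symmetric] inner_sym_unit power2_eq_square)
    then have "(\<Sum>i\<in>UNIV. \<Sum>j\<in>UNIV. \<Sum>k\<in>UNIV. \<Sum>l\<in>UNIV. linear_prod c (?forms i j k l) x)
        = (\<Sum>i\<in>UNIV. \<Sum>j\<in>UNIV. (h $ i $ j)\<^sup>2) * (\<Sum>k\<in>UNIV. \<Sum>l\<in>UNIV. (h $ k $ l)\<^sup>2)"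
      by (simp only: sum_distrib_right) (simp only: sum_distrib_left)
    also have "\<dots> = norm h ^ 4"
      by (simp only: power2_norm_matrix[symmetric]) (simp add: power2_eq_square power4_eq_xxxx)
    finally show "(\<Sum>i\<in>UNIV. \<Sum>j\<in>UNIV. \<Sum>k\<in>UNIV. \<Sum>l\<in>UNIV. linear_prod c (?forms i j k l) x)
        = norm (x - c) ^ 4" by (simp only: h_def)
  qed
  then show ?thesis by simp
qed

subsection \<open>Lower bound for the drift\<close>

lemma wishart_drift_ge:
  fixes D :: "(real^'n^'n) set"
  assumes D_psd: "D \<subseteq> Collect psd" and wishart_P: "wishart_semigroup D \<alpha> P"
    and coord_proj_in_D: "coord_proj K \<in> D" and m_notin_K: "m \<notin> K"
  shows "real (card K) \<le> \<alpha>"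
proof -
  note semigroup_P = wishart_semigroup_imp_semigroup[OF wishart_P]
  have "minor_probe K m (coord_proj K) = 0"
    by (simp add: minor_probe_expand[OF psdD(1)[OF psd_coord_proj] m_notin_K])
  then have "0 \<le> \<alpha> - real (card K)"
    using D_psd
    by (intro generator_value_nonneg[OF semigroup_P
        generator_value_minor_probe[OF D_psd wishart_P coord_proj_in_D m_notin_K]] coord_proj_in_D)
      (auto intro: minor_probe_nonneg)
  then show ?thesis by simp
qed

subsection \<open>Upper bound for the drift\<close>

lemma rank_less_card_kernel_vector:
  fixes x :: "real^'n^'n"
  assumes "rank x < card J"
  obtains v where "v \<noteq> 0" "x *v v = 0" "\<And>j. j \<notin> J \<Longrightarrow> v $ j = 0"
proof -
  let ?S = "(\<lambda>a. axis a 1 :: real^'n) ` J"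
  have "independent ?S"
    by (rule independent_mono[OF independent_Basis]) (auto simp: Basis_vec_def)
  then have "dim ?S = card ?S" by (rule dim_eq_card_independent)
  also have "\<dots> = card J" by (intro card_image) (auto simp: inj_on_def axis_eq_axis)
  finally have dim_image: "dim ?S = card J" .
  have "\<not> inj_on ((*v) x) (span ?S)"
  proof
    assume "inj_on ((*v) x) (span ?S)"
    then have "dim ((*v) x ` ?S) = dim ?S" by (intro dim_image_eq) auto
    moreover have "dim ((*v) x ` ?S) \<le> dim (range ((*v) x))" by (intro dim_subset) auto
    ultimately show False using dim_image assms by (simp add: rank_dim_range)
  qed
  then obtain v w where same_image: "v \<in> span ?S" "w \<in> span ?S" "v \<noteq> w" "x *v v = x *v w"
    unfolding inj_on_def by blast
  have "span ?S \<subseteq> {v. \<forall>j. j \<notin> J \<longrightarrow> v $ j = 0}"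
    by (intro span_minimal) (auto simp: subspace_def axis_def)
  moreover have "v - w \<in> span ?S" using same_image by (intro span_diff)
  moreover have "x *v (v - w) = 0" using same_image by (simp add: matrix_vector_mult_diff_distrib)
  ultimately show thesis using same_image(3) by (intro that[of "v - w"]) auto
qed

lemma kernel_vector_near_coord_proj:
  fixes x :: "real^'n^'n"
  assumes rank: "rank x \<le> card K" and m_notin_K: "m \<notin> K" and near: "norm (x - coord_proj K) < 1"
  obtains w where "coord_proj K *v w = w" "x *v (axis m 1 - w) = 0"
proof -
  let ?c = "coord_proj K :: real^'n^'n"
  have "rank x < card (insert m K)" using rank m_notin_K by simp
  then obtain v where v_kernel: "v \<noteq> 0" "x *v v = 0" and support: "\<And>j. j \<notin> insert m K \<Longrightarrow> v $ j = 0"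
    using rank_less_card_kernel_vector by blast
  have decomp: "v = ?c *v v + (v $ m) *\<^sub>R axis m 1"
    using support m_notin_K by (auto simp: vec_eq_iff coord_proj_mult_nth axis_def)
  have v_m_nonzero: "v $ m \<noteq> 0"
  proof
    assume "v $ m = 0"
    then have c_mult_v: "?c *v v = v" using decomp by simp
    have "(norm v)\<^sup>2 = - (v \<bullet> ((x - ?c) *v v))"
      by (simp add: matrix_vector_mult_diff_rdistrib v_kernel(2) c_mult_v power2_norm_eq_inner)
    also have "\<dots> \<le> norm (x - ?c) * (norm v)\<^sup>2"
      using abs_quadratic_form_le[of v "x - ?c"] by simp
    also have "\<dots> < 1 * (norm v)\<^sup>2" using near v_kernel(1) by (intro mult_strict_right_mono) auto
    finally show False by simp
  qed
  define w where "w = - (1 / v $ m) *\<^sub>R (?c *v v)"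
  have "?c *v w = w" by (simp only: w_def matrix_vector_mult_scaleR coord_proj_idem)
  moreover have "axis m 1 - w = (1 / v $ m) *\<^sub>R v"
    using v_m_nonzero by (subst (2) decomp) (simp add: w_def scaleR_add_right)
  then have "x *v (axis m 1 - w) = 0" by (simp add: matrix_vector_mult_scaleR v_kernel(2))
  ultimately show thesis by (rule that)
qed

context
  fixes x c :: "real^'n^'n" and K :: "'n set" and m :: 'n and b :: "real^'n" and \<eta> :: real
  assumes m_notin_K: "m \<notin> K"
  defines "c \<equiv> coord_proj K" and "\<eta> \<equiv> norm (x - coord_proj K)"
    and "b \<equiv> coord_proj K *v (x *v axis m 1)"
begin

lemma norm_near_coord_proj: "norm x \<le> norm c + \<eta>"
  using norm_triangle_ineq[of c "x - c"] by (simp add: \<eta>_def c_def)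

lemma minor_probe_column: "norm b \<le> \<eta>"
proof -
  have "c *v axis m 1 = 0"
    using m_notin_K by (simp add: c_def vec_eq_iff coord_proj_mult_nth axis_def)
  then have "b = c *v ((x - c) *v axis m 1)"
    by (simp add: b_def c_def matrix_vector_mult_diff_rdistrib)
  then have "norm b \<le> norm ((x - c) *v axis m 1)"
    using norm_coord_proj_mult_le by (metis c_def)
  also have "\<dots> \<le> \<eta>" using norm_matrix_vector_mult_le[of "x - c" "axis m 1"]
    by (simp add: \<eta>_def c_def norm_axis_1)
  finally show ?thesis .
qed

lemma minor_probe_le_far:
  assumes eta_ge: "1 / 2 \<le> \<eta>"
  shows "minor_probe K m x \<le> (20 * norm c + 10) * \<eta> ^ 4"
proof -
  let ?z = "axis m 1 - b"
  have \<eta>_power: "\<eta> ^ i \<le> 2 ^ (4 - i) * \<eta> ^ 4" if "i \<le> 4" for i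
  proof -
    have "\<eta> ^ i * 1 \<le> \<eta> ^ i * (2 * \<eta>) ^ (4 - i)"
      using eta_ge by (intro mult_left_mono one_le_power) auto
    also have "\<dots> = 2 ^ (4 - i) * \<eta> ^ 4"
      using that by (simp add: power_mult_distrib power_add[symmetric])
    finally show ?thesis by simp
  qed
  have "axis m 1 \<bullet> b = 0" using m_notin_K by (simp add: b_def inner_axis' coord_proj_mult_nth)
  then have "(norm ?z)\<^sup>2 = 1 + (norm b)\<^sup>2"
    by (simp add: power2_norm_eq_inner inner_diff_left inner_diff_right inner_commute
        inner_axis_axis)
  also have "\<dots> \<le> 1 + \<eta>\<^sup>2" using minor_probe_column by (simp add: power_mono)
  finally have "norm x * (norm ?z)\<^sup>2 \<le> (norm c + \<eta>) * (1 + \<eta>\<^sup>2)"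
    using norm_near_coord_proj by (intro mult_mono) (auto simp: \<eta>_def)
  then have "minor_probe K m x \<le> (norm c + \<eta>) * (1 + \<eta>\<^sup>2)"
    using abs_quadratic_form_le[of ?z x] by (simp add: minor_probe_def Let_def b_def)
  also have "\<dots> = norm c * \<eta> ^ 0 + norm c * \<eta> ^ 2 + \<eta> ^ 1 + \<eta> ^ 3"
    by (simp add: algebra_simps power2_eq_square power3_eq_cube)
  also have "\<dots> \<le> norm c * (16 * \<eta> ^ 4) + norm c * (4 * \<eta> ^ 4) + 8 * \<eta> ^ 4 + 2 * \<eta> ^ 4"
    using \<eta>_power[of 0] \<eta>_power[of 1] \<eta>_power[of 2] \<eta>_power[of 3]
    by (intro add_mono mult_left_mono) auto
  finally show ?thesis by (simp add: algebra_simps)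
qed

lemma minor_probe_le_near:
  assumes x_low_rank: "psd x" "rank x \<le> card K" and near: "\<eta> \<le> 1 / 2"
  shows "minor_probe K m x \<le> (20 * norm c + 10) * \<eta> ^ 4"
proof -
  obtain w where c_mult_w: "c *v w = w" and x_kernel: "x *v (axis m 1 - w) = 0"
    using kernel_vector_near_coord_proj[OF x_low_rank(2) m_notin_K] near by (auto simp: c_def \<eta>_def)
  have "x *v axis m 1 = x *v w" using x_kernel by (simp add: matrix_vector_mult_diff_distrib)
  then have "b - w = c *v ((x - c) *v w)"
    by (simp add: b_def c_def[symmetric] matrix_vector_mult_diff_rdistrib
        matrix_vector_mult_diff_distrib c_mult_w)
  then have "norm (b - w) \<le> norm ((x - c) *v w)"
    using norm_coord_proj_mult_le by (metis c_def)
  also have "\<dots> \<le> \<eta> * norm w"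
    using norm_matrix_vector_mult_le[of "x - c" w] by (simp add: \<eta>_def c_def)
  finally have dist_le: "norm (b - w) \<le> \<eta> * norm w" .
  also have "\<dots> \<le> 1 / 2 * norm w" using near by (intro mult_right_mono) auto
  finally have "norm w \<le> 2 * \<eta>"
    using norm_triangle_ineq2[of w b] minor_probe_column by (simp add: norm_minus_commute)
  then have "\<eta> * norm w \<le> \<eta> * (2 * \<eta>)" by (intro mult_left_mono) (simp_all add: \<eta>_def)
  then have "norm (b - w) \<le> \<eta> * (2 * \<eta>)" using dist_le by linarith
  then have "(norm (b - w))\<^sup>2 \<le> (\<eta> * (2 * \<eta>))\<^sup>2" by (intro power_mono) auto
  then have dist_sq_le: "(norm (b - w))\<^sup>2 \<le> 4 * \<eta> ^ 4"
    by (simp add: power2_eq_square power4_eq_xxxx ac_simps)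
  define y where "y = axis m 1 - w"
  have "y \<bullet> (x *v (b - w)) = 0"
    using sym_inner[OF psdD(1)[OF x_low_rank(1)], of y "b - w"] x_kernel by (simp add: y_def)
  then have "(y - (b - w)) \<bullet> (x *v (y - (b - w))) = (b - w) \<bullet> (x *v (b - w))"
    using x_kernel
    by (simp add: y_def[symmetric] matrix_vector_mult_diff_distrib[of x y] inner_diff_left[of y])
  moreover have "minor_probe K m x = (y - (b - w)) \<bullet> (x *v (y - (b - w)))"
    by (simp add: minor_probe_def Let_def b_def y_def)
  ultimately have "minor_probe K m x = (b - w) \<bullet> (x *v (b - w))" by simp
  also have "\<dots> \<le> norm x * (norm (b - w))\<^sup>2" using abs_quadratic_form_le[of "b - w" x] by linarith
  also have "\<dots> \<le> (norm c + 1) * (4 * \<eta> ^ 4)"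
    using norm_near_coord_proj dist_sq_le near by (intro mult_mono) auto
  also have "\<dots> = (4 * norm c + 4) * \<eta> ^ 4" by (simp add: algebra_simps)
  also have "\<dots> \<le> (20 * norm c + 10) * \<eta> ^ 4" by (intro mult_right_mono) (auto simp: \<eta>_def)
  finally show ?thesis .
qed

end

text \<open>On matrices of rank at most \<open>card K\<close> the minor vanishes, so the probe is of fourth order.\<close>

lemma minor_probe_le_norm_power4:
  fixes x :: "real^'n^'n"
  assumes "psd x" "rank x \<le> card K" "m \<notin> K"
  shows "minor_probe K m x
    \<le> (20 * norm (coord_proj K :: real^'n^'n) + 10) * norm (x - coord_proj K) ^ 4"
  using minor_probe_le_near[OF assms(3,1,2)] minor_probe_le_far[OF assms(3), of x] by linarith

lemma wishart_drift_le:
  fixes K :: "'n::finite set"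
  assumes wishart_P: "wishart_semigroup (Dpk (card K) :: (real^'n^'n) set) \<alpha> P"
    and m_notin_K: "m \<notin> K"
  shows "\<alpha> \<le> real (card K)"
proof -
  let ?D = "Dpk (card K) :: (real^'n^'n) set" and ?c = "coord_proj K :: real^'n^'n"
  let ?C = "20 * norm ?c + 10"
  note semigroup_P = wishart_semigroup_imp_semigroup[OF wishart_P]
  have coord_proj_in_D: "?c \<in> ?D" by (rule coord_proj_in_Dpk) simp
  have "generator_value ?D P ?c (\<lambda>x. (-1) * minor_probe K m x + (?C * norm (x - ?c) ^ 4 + 0))
      ((-1) * (\<alpha> - real (card K)) + (?C * 0 + 0))"
    by (intro generator_value_lincomb[OF semigroup_P] generator_value_zero[OF semigroup_P]
        generator_value_minor_probe[OF Dpk_subset_psd wishart_P coord_proj_in_D m_notin_K]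
        generator_value_norm_power4[OF Dpk_subset_psd wishart_P coord_proj_in_D])
  then have "0 \<le> (-1) * (\<alpha> - real (card K)) + (?C * 0 + 0)"
  proof (rule generator_value_nonneg[OF semigroup_P _ _ coord_proj_in_D])
    show "0 \<le> (-1) * minor_probe K m x + (?C * norm (x - ?c) ^ 4 + 0)" if "x \<in> ?D" for x
      using minor_probe_le_norm_power4[of x K m] that m_notin_K by (simp add: Dpk_def)
    show "(-1) * minor_probe K m ?c + (?C * norm (?c - ?c) ^ 4 + 0) = 0"
      by (simp add: minor_probe_expand[OF psdD(1)[OF psd_coord_proj] m_notin_K])
  qed
  then show ?thesis by simp
qed

lemma obtain_coordinates:
  assumes "k < CARD('n::finite)"
  obtains K :: "'n::finite set" and m where "card K = k" "m \<notin> K"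
proof -
  obtain K :: "'n set" where card_K: "card K = k"
    using obtain_subset_with_card_n[OF less_imp_le[OF assms]] by metis
  then have "K \<noteq> UNIV" using assms by auto
  with card_K show thesis using that by blast
qed

theorem mainTheorem9:
  fixes k :: nat and \<alpha> :: real
  assumes "1 \<le> k" and "k \<le> CARD('n::finite)" and "0 \<le> \<alpha>"
  shows "(\<exists>P. wishart_semigroup (Dpk k :: (real^'n^'n) set) \<alpha> P) \<longleftrightarrow>
         ((k < CARD('n) \<longrightarrow> \<alpha> = real k) \<and>
          (k = CARD('n) \<longrightarrow> \<alpha> \<ge> real (CARD('n)) - 1))"
proof
  assume "\<exists>P. wishart_semigroup (Dpk k :: (real^'n^'n) set) \<alpha> P"
  then obtain P where wishart_P: "wishart_semigroup (Dpk k :: (real^'n^'n) set) \<alpha> P" by blast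
  have lower: "real j \<le> \<alpha>" if "j \<le> k" "j < CARD('n)" for j
    using obtain_coordinates[OF that(2)] that(1)
      wishart_drift_ge[OF Dpk_subset_psd wishart_P coord_proj_in_Dpk]
    by metis
  have "\<alpha> \<le> real k" if "k < CARD('n)"
    using obtain_coordinates[OF that] wishart_drift_le wishart_P by metis
  then show "(k < CARD('n) \<longrightarrow> \<alpha> = real k) \<and> (k = CARD('n) \<longrightarrow> \<alpha> \<ge> real (CARD('n)) - 1)"
    using lower[of k] lower[of "k - 1"] assms(1) by (auto simp: of_nat_diff)
next
  assume drift: "(k < CARD('n) \<longrightarrow> \<alpha> = real k) \<and> (k = CARD('n) \<longrightarrow> \<alpha> \<ge> real (CARD('n)) - 1)"
  show "\<exists>P. wishart_semigroup (Dpk k :: (real^'n^'n) set) \<alpha> P"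
  proof (cases "k = CARD('n)")
    case True
    then show ?thesis using drift wishart_semigroup_full_rank by blast
  next
    case False
    then have "\<alpha> = real k" using drift assms(2) by simp
    then show ?thesis using wishart_semigroup_low_rank[OF assms(2)] by simp
  qed
qed

end
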